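(* Let $n$ be a positive integer, let $a,b,b_1,\ldots,b_n\ge 0$ be real numbers, and let $f,g,g_1,\ldots,g_n$ be non-constant, non-negative operator monotone functions on $[0,\infty)$. (1) If $\dfrac{f(t)g(t)}{t}$ is operator monotone on $[0,\infty)$, then the function \[ h(t)=\frac{(t-a)(t-b)}{(f(t)-f(a))(g(t)-g(b))} \] is operator monotone on $[0,\infty)$. (2) If $\dfrac{f(t)}{\prod_{i=1}^n g_i(t)}$ is operator monotone on $[0,\infty)$, then the function \[ h(t)=\frac{t-a}{f(t)-f(a)}\prod_{i=1}^n\frac{g_i(t)(t-b_i)}{t g_i(t)-b_i g_i(b_i)} \] is operator monotone on $[0,\infty)$.
   Context: A real continuous function $f$ on an interval $I$ is called operator monotone on $I$ if $A\le B$ implies $f(A)\le f(B)$ for all self-adjoint matrices $A,B$ (of any common size) with spectra contained in $I$. Functions given by a formula that is formally undefined at isolated points of $[0,\infty)$ (for example $f(t)g(t)/t$ or $f(t)/\prod_i g_i(t)$ at $t=0$, or $h$ at $a$, $b$, $b_i$) are understood there by continuous extension; in particular the hypothesis that such a quotient is operator monotone on $[0,\infty)$ means that it extends continuously to $[0,\infty)$ and the extension is operator monotone. *)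

theory Defs
  imports
    "HOL-Analysis.Abstract_Topology_2"
    "Jordan_Normal_Form.Spectral_Radius"
begin

text \<open>
  The size of a matrix has to be quantified over inside the definition of operator
  monotonicity, so matrices are taken from the carrier-based type of Jordan_Normal_Form.
\<close>

definition hermitian_mat :: "complex mat \<Rightarrow> bool" where
  "hermitian_mat A \<longleftrightarrow> square_mat A \<and> mat_adjoint A = A"

definition unitary_mat :: "complex mat \<Rightarrow> bool" where
  "unitary_mat U \<longleftrightarrow> square_mat U \<and> mat_adjoint U * U = 1\<^sub>m (dim_row U)
     \<and> U * mat_adjoint U = 1\<^sub>m (dim_row U)"

text \<open>The order on complex numbers is that of Complex_Order: \<open>0 \<le> z\<close> says that \<open>z\<close> is
  real and non-negative.\<close>

definition psd_mat :: "complex mat \<Rightarrow> bool" where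
  "psd_mat A \<longleftrightarrow> hermitian_mat A \<and> (\<forall>v \<in> carrier_vec (dim_row A). 0 \<le> (A *\<^sub>v v) \<bullet>c v)"

definition loewner_le :: "complex mat \<Rightarrow> complex mat \<Rightarrow> bool"  (infix \<open>\<le>\<^sub>L\<close> 50) where
  "A \<le>\<^sub>L B \<longleftrightarrow> dim_row A = dim_row B \<and> dim_col A = dim_col B \<and> psd_mat (B - A)"

definition real_diag :: "nat \<Rightarrow> (nat \<Rightarrow> real) \<Rightarrow> complex mat" where
  "real_diag n d = mat_diag n (\<lambda>i. complex_of_real (d i))"

definition diagonalizes :: "nat \<Rightarrow> complex mat \<Rightarrow> (nat \<Rightarrow> real) \<Rightarrow> complex mat \<Rightarrow> bool" where
  "diagonalizes n U d A \<longleftrightarrow>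
     U \<in> carrier_mat n n \<and> unitary_mat U \<and> A = U * real_diag n d * mat_adjoint U"

text \<open>Functional calculus: \<open>U diag(d) U\<^sup>*\<close> is mapped to \<open>U diag(f \<circ> d) U\<^sup>*\<close>. By the lemma
  \<open>mat_fun_eq\<close> below the result does not depend on the diagonalization; one exists
  for every Hermitian matrix by the spectral theorem.\<close>

definition mat_fun :: "(real \<Rightarrow> real) \<Rightarrow> complex mat \<Rightarrow> complex mat" where
  "mat_fun f A = (THE B. \<exists>U d. diagonalizes (dim_row A) U d A
                        \<and> B = U * real_diag (dim_row A) (f \<circ> d) * mat_adjoint U)"

lemma mat_adjoint_carrier:
  assumes "U \<in> carrier_mat n n"
  shows "mat_adjoint U \<in> carrier_mat n n"
  using assms by (auto simp: mat_adjoint_def mat_of_rows_def)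

lemma real_diag_carrier: "real_diag n d \<in> carrier_mat n n"
  by (simp add: real_diag_def)

lemma diagonalizes_fun_unique:
  assumes U: "diagonalizes n U d A" and V: "diagonalizes n V e A"
  shows "U * real_diag n (f \<circ> d) * mat_adjoint U = V * real_diag n (f \<circ> e) * mat_adjoint V"
proof -
  define U' where "U' = mat_adjoint U"
  define V' where "V' = mat_adjoint V"
  define W where "W = V' * U"
  have c: "U \<in> carrier_mat n n" "V \<in> carrier_mat n n" "U' \<in> carrier_mat n n"
      "V' \<in> carrier_mat n n" "W \<in> carrier_mat n n"
    using U V by (auto simp: diagonalizes_def U'_def V'_def W_def mat_adjoint_carrier
        intro!: mult_carrier_mat[of _ n n])
  have dc: "real_diag n x \<in> carrier_mat n n" for x by (rule real_diag_carrier)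
  have uu: "U' * U = 1\<^sub>m n" "U * U' = 1\<^sub>m n" "V' * V = 1\<^sub>m n" "V * V' = 1\<^sub>m n"
    using U V by (auto simp: diagonalizes_def unitary_mat_def U'_def V'_def)
  have m: "X * Y \<in> carrier_mat n n" if "X \<in> carrier_mat n n" "Y \<in> carrier_mat n n"
    for X Y :: "complex mat" using that by simp
  have as: "X * Y * Z = X * (Y * Z)"
    if "X \<in> carrier_mat n n" "Y \<in> carrier_mat n n" "Z \<in> carrier_mat n n"
    for X Y Z :: "complex mat" using that by (rule assoc_mult_mat)
  note one = left_mult_one_mat[of _ n n] right_mult_one_mat[of _ n n]
  have eq: "U * real_diag n d * U' = V * real_diag n e * V'"
    using U V by (simp add: diagonalizes_def U'_def V'_def)
  have "W * real_diag n d = V' * (U * real_diag n d * U') * U"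
    using c dc uu by (simp add: W_def as m one)
  also have "\<dots> = (V' * V) * (real_diag n e * (V' * U))"
    unfolding eq using c dc by (simp add: as m)
  also have "\<dots> = real_diag n e * W"
    using c dc uu by (simp add: W_def one m)
  finally have com: "W * real_diag n d = real_diag n e * W" .
  have ent: "W $$ (i,j) * complex_of_real (d j) = complex_of_real (e i) * W $$ (i,j)"
    if "i < n" "j < n" for i j
    using arg_cong[OF com, of "\<lambda>M. M $$ (i,j)"] that c
    by (simp add: real_diag_def mat_diag_mult_left[of _ n n] mat_diag_mult_right[of _ n n])
  have "W $$ (i,j) * complex_of_real (f (d j)) = complex_of_real (f (e i)) * W $$ (i,j)"
    if "i < n" "j < n" for i j
    using ent[OF that] by (cases "W $$ (i,j) = 0") auto
  then have comf: "W * real_diag n (f \<circ> d) = real_diag n (f \<circ> e) * W"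
    using c by (intro eq_matI)
      (auto simp: real_diag_def mat_diag_mult_left[of _ n n] mat_diag_mult_right[of _ n n])
  have "U * real_diag n (f \<circ> d) * U' = (V * V') * (U * real_diag n (f \<circ> d) * U')"
    using c dc uu by (simp add: m one)
  also have "\<dots> = V * (W * real_diag n (f \<circ> d)) * U'"
    using c dc by (simp add: W_def as m)
  also have "\<dots> = V * real_diag n (f \<circ> e) * (V' * (U * U'))"
    unfolding comf using c dc by (simp add: W_def as m)
  also have "\<dots> = V * real_diag n (f \<circ> e) * V'"
    using c dc uu by (simp add: m one)
  finally show ?thesis by (simp add: U'_def V'_def)
qed

lemma mat_fun_eq:
  assumes "diagonalizes n U d A"
  shows "mat_fun f A = U * real_diag n (f \<circ> d) * mat_adjoint U"
proof -
  have n: "dim_row A = n"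
    using assms by (auto simp: diagonalizes_def)
  show ?thesis
    unfolding mat_fun_def n
    using assms diagonalizes_fun_unique by (intro the_equality) blast+
qed

definition operator_monotone_on :: "real set \<Rightarrow> (real \<Rightarrow> real) \<Rightarrow> bool" where
  "operator_monotone_on I f \<longleftrightarrow> continuous_on I f \<and>
     (\<forall>n. \<forall>A \<in> carrier_mat n n. \<forall>B \<in> carrier_mat n n.
        hermitian_mat A \<longrightarrow> hermitian_mat B \<longrightarrow>
        spectrum A \<subseteq> complex_of_real ` I \<longrightarrow> spectrum B \<subseteq> complex_of_real ` I \<longrightarrow>
        A \<le>\<^sub>L B \<longrightarrow> mat_fun f A \<le>\<^sub>L mat_fun f B)"

text \<open>
  For a formula \<open>\<phi>\<close> that is undefined at the points of the finite set \<open>S\<close>: \<open>\<phi>\<close> extends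
  continuously to \<open>I\<close>, and the extension is operator monotone (which includes its
  continuity). The values of \<open>\<phi>\<close> on \<open>S\<close>, artefacts of \<open>x / 0 = 0\<close>, are ignored; the
  extension is unique on \<open>I\<close> when \<open>I\<close> has no isolated points.
\<close>

definition extends_operator_monotone_on ::
    "real set \<Rightarrow> real set \<Rightarrow> (real \<Rightarrow> real) \<Rightarrow> bool" where
  "extends_operator_monotone_on I S \<phi> \<longleftrightarrow>
     finite S \<and> (\<exists>F. operator_monotone_on I F \<and> (\<forall>t \<in> I - S. F t = \<phi> t))"

end

theory Submission
  imports Defs "HOL-Complex_Analysis.Complex_Analysis"
begin

text \<open>
  An operator monotone function \<open>f \<ge> 0\<close> on \<open>[0, \<infinity>)\<close> extends to a holomorphic function on the
  plane slit along \<open>(-\<infinity>, 0]\<close>, and a function given there by \<open>exp \<phi>\<close> with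
  \<open>0 \<le> Im \<phi>(z) \<le> arg z\<close> on the upper half-plane is operator monotone (both directions of
  Loewner's theorem). With this the theorem becomes a count of arguments: for
  \<open>u\<^sub>a(z) = (f(z) - f(a)) / (z - a)\<close> one has \<open>arg f - arg z \<le> arg u\<^sub>a \<le> 0\<close>, and the \<open>i\<close>-th factor in
  (2) has argument between \<open>0\<close> and \<open>arg g\<^sub>i\<close>. The hypotheses give \<open>arg z \<le> arg f + arg g\<close> in (1) and
  \<open>\<Sum>\<^sub>i arg g\<^sub>i \<le> arg f\<close> in (2), which bounds \<open>arg h\<close> by \<open>arg z\<close>.

  The extension is obtained by interpolating \<open>f\<close>, up to a small error, at finitely many points
  by positive combinations of the functions \<open>t / (1 - x + x t)\<close>, \<open>0 \<le> x \<le> 1\<close>: comparing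
  rank-one perturbations with interlacing spectra makes two Hankel forms semidefinite, and
  diagonalizing them simultaneously is a Gauss quadrature. Montel's theorem yields the limit.
  Conversely, the Poisson formula writes \<open>h\<close> as an integral of functions \<open>t / (\<alpha> + \<beta> t)\<close>.
\<close>

text \<open>Matrices yield inequalities at finitely many nodes only, so the extension has to be
  assembled from discrete data. The Hankel form of f comes from monotonicity; the one of f(t)/t,
  with the opposite sign, comes from sending one extra node to infinity and placing another at 0,
  where f(0) \<ge> 0 enters. Both signs together confine the quadrature nodes to the half-line from
  -\<infinity> to 0, ends included. The bound arg f - arg z \<le> arg u_a is Cauchy-Schwarz for the
  discrete measures; it is written between imaginary parts, since in that form it is closed under
  limits.

  Arguments are added as imaginary parts of logarithms and not as arguments of products: in (2) the
  sum of the arg g_i may a priori exceed pi, so a non-negative sine fixes it only modulo 2 pi, and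
  continuity along a segment from 1 has to decide.

  In the converse direction squaring maps the right half-plane onto the slit plane; after division
  by z the bounds 0 \<le> Im \<phi> \<le> arg z become symmetric about 0 and say that a real part is
  non-negative. This is what the Poisson formula can use.\<close>

unbundle no vec_syntax
no_notation fps_nth (infixl "$" 75)
hide_const (open) Finite_Cartesian_Product.vec Finite_Cartesian_Product.mat
  Finite_Cartesian_Product.row Finite_Cartesian_Product.column Determinants.det
hide_type (open) Finite_Cartesian_Product.vec

section \<open>The spectral theorem\<close>

lemma dim_mat_adjoint [simp]:
  "dim_row (mat_adjoint A) = dim_col A" "dim_col (mat_adjoint A) = dim_row A"
  by (auto simp: mat_adjoint_def)

lemma index_mat_adjoint [simp]:
  fixes A :: "complex mat"
  assumes "i < dim_col A" "j < dim_row A"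
  shows "mat_adjoint A $$ (i,j) = cnj (A $$ (j,i))"
  using assms by (simp add: mat_adjoint_def mat_of_rows_index)

lemma mat_adjoint_mult:
  fixes A B :: "complex mat"
  assumes "A \<in> carrier_mat n m" "B \<in> carrier_mat m k"
  shows "mat_adjoint (A * B) = mat_adjoint B * mat_adjoint A"
  by (rule eq_matI) (use assms in \<open>auto simp: scalar_prod_def mult.commute intro!: sum.cong\<close>)

lemma mat_adjoint_adjoint [simp]: "mat_adjoint (mat_adjoint A) = (A :: complex mat)"
  by (rule eq_matI) auto

lemma mat_adjoint_one [simp]: "mat_adjoint (1\<^sub>m n) = (1\<^sub>m n :: complex mat)"
  by (rule eq_matI) auto

lemma mat_adjoint_real_diag [simp]: "mat_adjoint (real_diag n d) = real_diag n d"
  by (rule eq_matI) (auto simp: real_diag_def mat_diag_def)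

lemma index_adjoint_mult:
  assumes "U \<in> carrier_mat n m" "V \<in> carrier_mat n k" "i < m" "j < k"
  shows "(mat_adjoint U * V) $$ (i,j) = (\<Sum>l<n. cnj (U $$ (l,i)) * V $$ (l,j))"
  using assms by (auto simp: scalar_prod_def atLeast0LessThan intro!: sum.cong)

lemma index_diagonalized:
  assumes "U \<in> carrier_mat n n" "i < n" "j < n"
  shows "(U * real_diag n d * mat_adjoint U) $$ (i,j)
    = (\<Sum>k<n. U $$ (i,k) * of_real (d k) * cnj (U $$ (j,k)))"
  using assms real_diag_carrier[of n d]
  by (auto simp: scalar_prod_def atLeast0LessThan real_diag_def mat_diag_mult_right[of _ n n]
      mult.commute intro!: sum.cong)

text \<open>\<open>H\<close> is the reflection in the hyperplane orthogonal to v - e_0, since |v -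
  e_0|^2 = 2 (1 - r). It carries e_0 to v because v_0 is real, and \<open>r \<le> 0\<close> keeps
  the denominator away from 0, so that v = e_0 needs no separate case.\<close>

lemma householder_unitary:
  assumes v: "(\<Sum>i<Suc n. (cmod (v i))\<^sup>2) = 1" and v0: "v 0 = of_real r" "r \<le> 0"
  defines "u \<equiv> \<lambda>i. v i - (if i = 0 then 1 else 0)"
  defines "H \<equiv> mat (Suc n) (Suc n) (\<lambda>(i,j). (if i = j then 1 else 0) - u i * cnj (u j) / of_real (1 - r))"
  shows "mat_adjoint H = H" "H * H = 1\<^sub>m (Suc n)" "\<And>i. i < Suc n \<Longrightarrow> H $$ (i,0) = v i"
proof -
  have r: "complex_of_real (1 - r) \<noteq> 0" using v0 by (simp del: of_real_diff)
  have H: "H \<in> carrier_mat (Suc n) (Suc n)" by (simp add: H_def)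
  show "mat_adjoint H = H"
    by (rule eq_matI) (auto simp: H_def mult.commute)
  have nu: "(\<Sum>k<Suc n. cnj (u k) * u k) = 2 * of_real (1 - r)"
  proof -
    have "(\<Sum>k<Suc n. cnj (u k) * u k)
        = (\<Sum>k<Suc n. of_real ((cmod (v k))\<^sup>2) + (if k = 0 then 1 - 2 * of_real r else 0))"
      unfolding complex_norm_square by (intro sum.cong refl) (auto simp: u_def v0 algebra_simps)
    also have "\<dots> = of_real (\<Sum>k<Suc n. (cmod (v k))\<^sup>2) + (1 - 2 * of_real r)"
      by (subst sum.distrib) (simp add: sum.delta)
    finally show ?thesis unfolding v by simp
  qed
  show "H * H = 1\<^sub>m (Suc n)"
  proof (rule eq_matI)
    fix i j assume ij: "i < dim_row (1\<^sub>m (Suc n) :: complex mat)" "j < dim_col (1\<^sub>m (Suc n) :: complex mat)"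
    let ?c = "complex_of_real (1 - r)"
    have "(H * H) $$ (i,j) = (\<Sum>k<Suc n. H $$ (i,k) * H $$ (k,j))"
      using ij H by (auto simp: scalar_prod_def atLeast0LessThan intro!: sum.cong)
    also have "\<dots> = (\<Sum>k<Suc n. (if k = i then (if i = j then 1 else 0) - u i * cnj (u j) / ?c else 0)
          - (if k = j then u i * cnj (u j) / ?c else 0)
          + u i * cnj (u j) / ?c^2 * (cnj (u k) * u k))"
      using ij by (intro sum.cong refl) (auto simp: H_def algebra_simps power2_eq_square simp del: of_real_diff)
    also have "\<dots> = (if i = j then 1 else 0) - 2 * (u i * cnj (u j) / ?c)
          + u i * cnj (u j) / ?c^2 * (\<Sum>k<Suc n. cnj (u k) * u k)"
      unfolding sum.distrib sum_subtractf sum_distrib_left[symmetric]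
      using ij by (simp add: sum.delta del: sum.lessThan_Suc)
    also have "\<dots> = (if i = j then 1 else 0)"
      unfolding nu using r by (simp add: power2_eq_square del: of_real_diff)
    finally show "(H * H) $$ (i,j) = 1\<^sub>m (Suc n) $$ (i,j)" using ij by simp
  qed (use H in auto)
  fix i assume "i < Suc n"
  then show "H $$ (i,0) = v i"
    using r by (auto simp: H_def u_def v0 field_simps simp del: of_real_diff) (auto simp: algebra_simps)
qed

lemma sum_norm_pos:
  assumes "v \<in> carrier_vec n" "v \<noteq> 0\<^sub>v n"
  shows "(\<Sum>i<n. (cmod (v $ i))\<^sup>2) > 0"
proof -
  obtain i where "i < n" "v $ i \<noteq> 0" using assms by force
  then show ?thesis by (intro sum_pos2[of _ i]) auto
qed

lemma unit_eigenvector: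
  assumes A: "A \<in> carrier_mat (Suc n) (Suc n)"
  obtains v l r where "v \<in> carrier_vec (Suc n)" "A *\<^sub>v v = l \<cdot>\<^sub>v v"
    "(\<Sum>i<Suc n. (cmod (v $ i))\<^sup>2) = 1" "v $ 0 = complex_of_real r" "r \<le> 0"
proof -
  obtain l where "l \<in> spectrum A" using spectrum_non_empty[OF A] by auto
  then obtain v where v: "v \<in> carrier_vec (Suc n)" "v \<noteq> 0\<^sub>v (Suc n)" "A *\<^sub>v v = l \<cdot>\<^sub>v v"
    using A by (auto simp: spectrum_def eigenvalue_def eigenvector_def)
  define s where "s = (\<Sum>i<Suc n. (cmod (v $ i))\<^sup>2)"
  have s: "s > 0" unfolding s_def using sum_norm_pos[OF v(1,2)] .
  \<comment> \<open>The scalar normalizes v and rotates its first coordinate onto the non-positive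
    real axis, as the reflection requires.\<close>
  define c where "c = (if v $ 0 = 0 then 1 else - cnj (v $ 0) / cmod (v $ 0)) / sqrt s"
  have c: "(cmod c)\<^sup>2 = 1 / s"
    using s by (auto simp: c_def norm_divide power_divide)
  have "c * v $ 0 = of_real (- cmod (v $ 0) / sqrt s)"
    using complex_norm_square[of "v $ 0"] s
    by (auto simp: c_def field_simps power2_eq_square)
  moreover have "(\<Sum>i<Suc n. (cmod ((c \<cdot>\<^sub>v v) $ i))\<^sup>2) = (cmod c)\<^sup>2 * s"
    unfolding s_def sum_distrib_left using v
    by (intro sum.cong) (auto simp: norm_mult power_mult_distrib)
  moreover have "A *\<^sub>v (c \<cdot>\<^sub>v v) = l \<cdot>\<^sub>v (c \<cdot>\<^sub>v v)"
    using A v by (simp add: mult_mat_vec smult_smult_assoc mult.commute)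
  ultimately show ?thesis
    using that[of "c \<cdot>\<^sub>v v" l "- cmod (v $ 0) / sqrt s"] c s v by (auto simp: field_simps)
qed

text \<open>Deflation: conjugation by a reflection moves a unit eigenvector to e_0, which clears the
  first column, and Hermitian symmetry then clears the first row. The remaining block is
  diagonalized by induction and bordered by 1.\<close>

theorem hermitian_diagonalizable:
  assumes "A \<in> carrier_mat n n" "mat_adjoint A = A"
  shows "\<exists>U d. diagonalizes n U d A"
  using assms
proof (induction n arbitrary: A)
  case 0
  then have "diagonalizes 0 (1\<^sub>m 0) (\<lambda>_. 0) A"
    by (auto simp: diagonalizes_def unitary_mat_def)
  then show ?case by blast
next
  case (Suc n)
  note A = Suc.prems
  let ?N = "Suc n"
  obtain v l r where v: "v \<in> carrier_vec ?N" "A *\<^sub>v v = l \<cdot>\<^sub>v v"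
    "(\<Sum>i<?N. (cmod (v $ i))\<^sup>2) = 1" "v $ 0 = complex_of_real r" "r \<le> 0"
    using unit_eigenvector[OF A(1)] .
  define u where "u = (\<lambda>i. v $ i - (if i = 0 then 1 else 0))"
  define H where "H = mat ?N ?N (\<lambda>(i,j). (if i = j then 1 else 0) - u i * cnj (u j) / of_real (1 - r))"
  note hh = householder_unitary[of "($) v", OF v(3-5), folded u_def H_def]
  have H: "H \<in> carrier_mat ?N ?N" by (simp add: H_def)
  have Hadj: "mat_adjoint H = H" using hh(1) by (simp add: H_def u_def)
  have HH: "H * H = 1\<^sub>m ?N" using hh(2) by (simp add: H_def u_def)
  have H0: "H $$ (i,0) = v $ i" if "i < ?N" for i using hh(3)[OF that] by (simp add: H_def u_def)
  define B where "B = H * (A * H)"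
  have B: "B \<in> carrier_mat ?N ?N" using H A by (simp add: B_def)
  have Badj: "mat_adjoint B = B"
    using H A Hadj by (simp add: B_def mat_adjoint_mult[of _ ?N ?N _ ?N] assoc_mult_mat[of _ ?N ?N _ ?N _ ?N])
  have colH: "col H 0 = v" using H H0 v(1) by (intro eq_vecI) auto
  have "col B 0 = H *\<^sub>v (A *\<^sub>v col H 0)"
    using col_mult2[of H ?N ?N "A * H" ?N 0] col_mult2[of A ?N ?N H ?N 0] H A unfolding B_def by simp
  also have "\<dots> = l \<cdot>\<^sub>v (H *\<^sub>v col H 0)"
    unfolding colH v(2) using H v(1) by (simp add: mult_mat_vec)
  also have "H *\<^sub>v col H 0 = col (1\<^sub>m ?N) 0"
    using H by (subst col_mult2[of _ ?N ?N _ ?N, symmetric]) (auto simp: HH)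
  finally have colB: "col B 0 = l \<cdot>\<^sub>v unit_vec ?N 0" by simp
  have B0: "B $$ (i,0) = (if i = 0 then l else 0)" if "i < ?N" for i
    using arg_cong[OF colB, of "\<lambda>w. w $ i"] that B by (auto simp: unit_vec_def)
  have B0': "B $$ (0,i) = (if i = 0 then l else 0)" if "i < ?N" for i
    using arg_cong[OF Badj, of "\<lambda>M. M $$ (0,i)"] that B B0[OF that] B0[of 0]
    by (auto split: if_splits)
  have lr: "l = of_real (Re l)"
    using arg_cong[OF Badj, of "\<lambda>M. M $$ (0,0)"] B B0[of 0] by (auto simp: complex_eq_iff)
  define B' where "B' = mat n n (\<lambda>(i,j). B $$ (Suc i, Suc j))"
  have B': "B' \<in> carrier_mat n n" by (simp add: B'_def)
  have "mat_adjoint B' = B'"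
  proof (rule eq_matI)
    fix i j assume "i < dim_row B'" "j < dim_col B'"
    then show "mat_adjoint B' $$ (i,j) = B' $$ (i,j)"
      using arg_cong[OF Badj, of "\<lambda>M. M $$ (Suc i,Suc j)"] B by (auto simp: B'_def)
  qed (auto simp: B'_def)
  then obtain U' d' where U': "diagonalizes n U' d' B'" using Suc.IH[OF B'] by blast
  define W where "W = mat ?N ?N (\<lambda>(i,j). if i = 0 \<and> j = 0 then 1 else if i = 0 \<or> j = 0 then 0
      else U' $$ (i - 1, j - 1))"
  define d where "d = (\<lambda>i. if i = 0 then Re l else d' (i - 1))"
  have W: "W \<in> carrier_mat ?N ?N" by (simp add: W_def)
  have U'c: "U' \<in> carrier_mat n n" using U' by (auto simp: diagonalizes_def)
  have UU: "mat_adjoint U' * U' = 1\<^sub>m n" "U' * mat_adjoint U' = 1\<^sub>m n"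
    using U' U'c by (auto simp: diagonalizes_def unitary_mat_def)
  have UU1: "(\<Sum>k<n. cnj (U' $$ (k,i)) * U' $$ (k,j)) = (if i = j then 1 else 0)" if "i < n" "j < n" for i j
    using index_adjoint_mult[OF U'c U'c that] UU(1) that by simp
  have WW1: "mat_adjoint W * W = 1\<^sub>m ?N"
  proof (rule eq_matI)
    fix i j assume ij: "i < dim_row (1\<^sub>m ?N :: complex mat)" "j < dim_col (1\<^sub>m ?N :: complex mat)"
    have "(mat_adjoint W * W) $$ (i,j) = (\<Sum>k<?N. cnj (W $$ (k,i)) * W $$ (k,j))"
      using ij by (intro index_adjoint_mult[OF W W]) auto
    also have "\<dots> = 1\<^sub>m ?N $$ (i,j)"
      using ij UU1[of "i-1" "j-1"]
      by (cases i; cases j) (auto simp: sum.lessThan_Suc_shift W_def simp del: sum.lessThan_Suc)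
    finally show "(mat_adjoint W * W) $$ (i,j) = 1\<^sub>m ?N $$ (i,j)" .
  qed (use W in auto)
  have WW2: "W * mat_adjoint W = 1\<^sub>m ?N"
    using mat_mult_left_right_inverse[OF mat_adjoint_carrier[OF W] W WW1] .
  have dc: "real_diag n x \<in> carrier_mat n n" for x n by (rule real_diag_carrier)
  have B'e: "B' = U' * real_diag n d' * mat_adjoint U'" using U' by (auto simp: diagonalizes_def)
  have B'e1: "B' $$ (i,j) = (\<Sum>k<n. U' $$ (i,k) * of_real (d' k) * cnj (U' $$ (j,k)))"
    if "i < n" "j < n" for i j
    unfolding B'e using that by (rule index_diagonalized[OF U'c])
  have BW: "B = W * real_diag ?N d * mat_adjoint W"
  proof (rule eq_matI)
    fix i j assume ij: "i < dim_row (W * real_diag ?N d * mat_adjoint W)"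
       "j < dim_col (W * real_diag ?N d * mat_adjoint W)"
    then have ij': "i < ?N" "j < ?N" using W by auto
    have "(W * real_diag ?N d * mat_adjoint W) $$ (i,j)
        = (\<Sum>k<?N. W $$ (i,k) * of_real (d k) * cnj (W $$ (j,k)))"
      using ij' by (rule index_diagonalized[OF W])
    also have "\<dots> = B $$ (i,j)"
    proof (cases "i = 0 \<or> j = 0")
      case True
      then show ?thesis using ij' B0[of i] B0'[of j] lr
        by (auto simp: sum.lessThan_Suc_shift W_def d_def simp del: sum.lessThan_Suc)
    next
      case False
      then show ?thesis using ij' B'e1[of "i-1" "j-1"]
        by (auto simp: sum.lessThan_Suc_shift W_def d_def B'_def simp del: sum.lessThan_Suc)
    qed
    finally show "B $$ (i,j) = (W * real_diag ?N d * mat_adjoint W) $$ (i,j)" by simp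
  qed (use W B in auto)
  note as = assoc_mult_mat[of _ ?N ?N _ ?N _ ?N]
  have m: "X * Y \<in> carrier_mat ?N ?N" if "X \<in> carrier_mat ?N ?N" "Y \<in> carrier_mat ?N ?N"
    for X Y :: "complex mat" using that by simp
  have "H * B * H = (H * H) * A * (H * H)"
    using H A by (simp add: B_def as m)
  then have "A = H * B * H" using A H by (simp add: HH)
  also have "\<dots> = H * W * real_diag ?N d * mat_adjoint (H * W)"
    unfolding BW using H W dc[of ?N d]
    by (simp add: mat_adjoint_mult[of _ ?N ?N _ ?N] Hadj as m mat_adjoint_carrier)
  finally have "A = H * W * real_diag ?N d * mat_adjoint (H * W)" .
  moreover have "mat_adjoint (H * W) * (H * W) = 1\<^sub>m ?N"
  proof -
    have "mat_adjoint (H * W) * (H * W) = mat_adjoint W * ((H * H) * W)"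
      using H W by (simp add: mat_adjoint_mult[of _ ?N ?N _ ?N] Hadj as m mat_adjoint_carrier)
    then show ?thesis using W by (simp add: HH WW1)
  qed
  moreover from this have "(H * W) * mat_adjoint (H * W) = 1\<^sub>m ?N"
    using mat_mult_left_right_inverse[OF mat_adjoint_carrier m[OF H W]] m[OF H W] by blast
  ultimately have "diagonalizes ?N (H * W) d A"
    using H W by (auto simp: diagonalizes_def unitary_mat_def)
  then show ?case by blast
qed

section \<open>Operator monotonicity through quadratic forms\<close>

text \<open>The quadratic form of U diag(d) U^H at v. Carrying the pair (U, d) in place of the
  matrix turns functional calculus into the composition \<open>f \<circ> d\<close> and leaves only
  finite real sums.\<close>

definition spectral_form :: "nat \<Rightarrow> complex mat \<Rightarrow> (nat \<Rightarrow> real) \<Rightarrow> complex vec \<Rightarrow> real" where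
  "spectral_form n U d v = (\<Sum>k<n. d k * (cmod (\<Sum>i<n. cnj (U $$ (i,k)) * v $ i))\<^sup>2)"

lemma spectral_form_eq:
  assumes U: "U \<in> carrier_mat n n" and v: "v \<in> carrier_vec n"
  shows "((U * real_diag n d * mat_adjoint U) *\<^sub>v v) \<bullet>c v = of_real (spectral_form n U d v)"
proof -
  let ?M = "U * real_diag n d * mat_adjoint U"
  have "(?M *\<^sub>v v) \<bullet>c v = (\<Sum>i<n. (\<Sum>j<n. ?M $$ (i,j) * v $ j) * cnj (v $ i))"
    using U v by (auto simp: scalar_prod_def atLeast0LessThan intro!: sum.cong)
  also have "\<dots> = (\<Sum>i<n. (\<Sum>j<n. (\<Sum>k<n. U $$ (i,k) * of_real (d k) * cnj (U $$ (j,k))) * v $ j) * cnj (v $ i))"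
    by (intro sum.cong refl arg_cong2[of _ _ _ _ "(*)"] index_diagonalized[OF U]) auto
  also have "\<dots> = (\<Sum>i<n. \<Sum>j<n. \<Sum>k<n. U $$ (i,k) * of_real (d k) * cnj (U $$ (j,k)) * v $ j * cnj (v $ i))"
    by (simp add: sum_distrib_right)
  also have "\<dots> = (\<Sum>k<n. \<Sum>i<n. \<Sum>j<n. U $$ (i,k) * of_real (d k) * cnj (U $$ (j,k)) * v $ j * cnj (v $ i))"
    by (rule trans[OF sum.cong[OF refl sum.swap] sum.swap])
  also have "\<dots> = (\<Sum>k<n. of_real (d k) * ((\<Sum>j<n. cnj (U $$ (j,k)) * v $ j) * cnj (\<Sum>i<n. cnj (U $$ (i,k)) * v $ i)))"
    by (intro sum.cong refl, simp add: sum_distrib_left sum_distrib_right mult_ac)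
  also have "\<dots> = of_real (spectral_form n U d v)"
    unfolding complex_norm_square[symmetric] by (simp add: spectral_form_def)
  finally show ?thesis .
qed

lemma diagonalizes_carrier:
  "diagonalizes n U d A \<Longrightarrow> A \<in> carrier_mat n n"
  by (auto simp: diagonalizes_def)

lemma diagonalizes_hermitian:
  assumes "diagonalizes n U d A"
  shows "mat_adjoint A = A"
proof -
  have U: "U \<in> carrier_mat n n" and A: "A = U * real_diag n d * mat_adjoint U"
    using assms by (auto simp: diagonalizes_def)
  show ?thesis
  proof (rule eq_matI)
    fix i j assume "i < dim_row A" "j < dim_col A"
    then have "i < n" "j < n" using diagonalizes_carrier[OF assms] by auto
    then show "mat_adjoint A $$ (i,j) = A $$ (i,j)"
      using diagonalizes_carrier[OF assms] index_diagonalized[OF U, of i j d] index_diagonalized[OF U, of j i d]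
      by (auto simp: A[symmetric] mult_ac intro!: sum.cong)
  qed (use diagonalizes_carrier[OF assms] in auto)
qed

lemma loewner_le_iff_form:
  assumes A: "diagonalizes n U d A" and B: "diagonalizes n V e B"
  shows "A \<le>\<^sub>L B \<longleftrightarrow> (\<forall>v \<in> carrier_vec n. spectral_form n U d v \<le> spectral_form n V e v)"
proof -
  note c = diagonalizes_carrier[OF A] diagonalizes_carrier[OF B]
  have herm: "hermitian_mat (B - A)"
    unfolding hermitian_mat_def
  proof (intro conjI eq_matI)
    fix i j assume "i < dim_row (B - A)" "j < dim_col (B - A)"
    then show "mat_adjoint (B - A) $$ (i,j) = (B - A) $$ (i,j)"
      using c arg_cong[OF diagonalizes_hermitian[OF A], of "\<lambda>M. M $$ (i,j)"]
       arg_cong[OF diagonalizes_hermitian[OF B], of "\<lambda>M. M $$ (i,j)"] by auto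
  qed (use c in auto)
  have q: "((B - A) *\<^sub>v v) \<bullet>c v = of_real (spectral_form n V e v - spectral_form n U d v)"
    if v: "v \<in> carrier_vec n" for v
  proof -
    have "((B - A) *\<^sub>v v) \<bullet>c v = (B *\<^sub>v v) \<bullet>c v - (A *\<^sub>v v) \<bullet>c v"
      using c v by (simp add: minus_mult_distrib_mat_vec[of _ n n] minus_scalar_prod_distrib[of _ n])
    then show ?thesis
      using A B v by (simp add: diagonalizes_def spectral_form_eq)
  qed
  show ?thesis
    using c herm by (auto simp: loewner_le_def psd_mat_def q less_eq_complex_def)
qed

lemma diagonalizes_mat_fun:
  "diagonalizes n U d A \<Longrightarrow> diagonalizes n U (f \<circ> d) (mat_fun f A)"
  by (simp add: mat_fun_eq) (simp add: diagonalizes_def)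

lemma spectrum_diagonalizes:
  assumes "diagonalizes n U d A"
  shows "spectrum A = complex_of_real ` d ` {..<n}"
proof -
  have A: "A \<in> carrier_mat n n" using diagonalizes_carrier[OF assms] .
  have "similar_mat_wit A (real_diag n d) U (mat_adjoint U)"
    using assms A real_diag_carrier[of n d]
    by (intro similar_mat_witI[of _ _ n]) (auto simp: diagonalizes_def unitary_mat_def mat_adjoint_carrier)
  then have "char_poly A = char_poly (real_diag n d)"
    by (intro char_poly_similar) (auto simp: similar_mat_def)
  also have "\<dots> = (\<Prod>a\<leftarrow>diag_mat (real_diag n d). [:- a, 1:])"
    by (intro char_poly_upper_triangular[OF real_diag_carrier])
       (auto simp: real_diag_def upper_triangular_def mat_diag_def)
  also have "diag_mat (real_diag n d) = map (\<lambda>k. complex_of_real (d k)) [0..<n]"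
    by (auto simp: diag_mat_def real_diag_def mat_diag_def)
  finally have cp: "char_poly A = (\<Prod>k\<leftarrow>[0..<n]. [:- complex_of_real (d k), 1:])"
    by (simp add: o_def)
  have "poly (\<Prod>k\<leftarrow>ks. [:- complex_of_real (d k), 1:]) l = 0 \<longleftrightarrow> (\<exists>k\<in>set ks. l = of_real (d k))" for l ks
    by (induction ks) auto
  from this[of "[0..<n]"] have "poly (char_poly A) l = 0 \<longleftrightarrow> l \<in> complex_of_real ` d ` {..<n}" for l
    unfolding cp set_upt atLeast0LessThan image_image image_iff .
  moreover have "l \<in> spectrum A \<longleftrightarrow> poly (char_poly A) l = 0" for l
    by (simp add: spectrum_def eigenvalue_root_char_poly[OF A])
  ultimately show ?thesis by blast
qed

definition form_le :: "real set \<Rightarrow> nat \<Rightarrow> complex mat \<Rightarrow> (nat \<Rightarrow> real) \<Rightarrow> complex mat \<Rightarrow> (nat \<Rightarrow> real) \<Rightarrow> bool" where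
  "form_le I n U d V e \<longleftrightarrow> U \<in> carrier_mat n n \<and> unitary_mat U \<and> V \<in> carrier_mat n n \<and> unitary_mat V \<and>
     (\<forall>k<n. d k \<in> I \<and> e k \<in> I) \<and> (\<forall>v \<in> carrier_vec n. spectral_form n U d v \<le> spectral_form n V e v)"

text \<open>Operator monotonicity separated from continuity: this half is stable under pointwise
  limits, integrals, positive multiples and shifts, and it can be used on the open
  half-line.\<close>

definition form_monotone :: "real set \<Rightarrow> (real \<Rightarrow> real) \<Rightarrow> bool" where
  "form_monotone I f \<longleftrightarrow> (\<forall>n U d V e v. form_le I n U d V e \<longrightarrow> v \<in> carrier_vec n \<longrightarrow>
     spectral_form n U (f \<circ> d) v \<le> spectral_form n V (f \<circ> e) v)"

lemma form_monotoneI: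
  assumes "\<And>n U d V e v. form_le I n U d V e \<Longrightarrow> v \<in> carrier_vec n \<Longrightarrow>
     spectral_form n U (f \<circ> d) v \<le> spectral_form n V (f \<circ> e) v"
  shows "form_monotone I f"
  using assms by (simp add: form_monotone_def)

lemma form_monotoneD:
  assumes "form_monotone I f" "form_le I n U d V e" "v \<in> carrier_vec n"
  shows "spectral_form n U (f \<circ> d) v \<le> spectral_form n V (f \<circ> e) v"
  using assms by (simp add: form_monotone_def)

lemma operator_monotone_on_iff_form:
  "operator_monotone_on I f \<longleftrightarrow> continuous_on I f \<and> form_monotone I f"
proof (intro iffI conjI)
  assume f: "operator_monotone_on I f"
  then show "continuous_on I f" by (simp add: operator_monotone_on_def)
  show "form_monotone I f"
  proof (rule form_monotoneI)
    fix n U d V e and v :: "complex vec"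
    assume le: "form_le I n U d V e" and v: "v \<in> carrier_vec n"
    define A where "A = U * real_diag n d * mat_adjoint U"
    define B where "B = V * real_diag n e * mat_adjoint V"
    have A: "diagonalizes n U d A" and B: "diagonalizes n V e B"
      using le by (auto simp: diagonalizes_def form_le_def A_def B_def)
    have "hermitian_mat A" "hermitian_mat B"
      using diagonalizes_carrier[OF A] diagonalizes_carrier[OF B]
        diagonalizes_hermitian[OF A] diagonalizes_hermitian[OF B] by (auto simp: hermitian_mat_def)
    moreover have "spectrum A \<subseteq> complex_of_real ` I" "spectrum B \<subseteq> complex_of_real ` I"
      using le by (auto simp: form_le_def spectrum_diagonalizes[OF A] spectrum_diagonalizes[OF B])
    moreover have "A \<le>\<^sub>L B" using le loewner_le_iff_form[OF A B] by (simp add: form_le_def)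
    ultimately have "mat_fun f A \<le>\<^sub>L mat_fun f B"
      using f[unfolded operator_monotone_on_def, THEN conjunct2, rule_format,
          OF diagonalizes_carrier[OF A] diagonalizes_carrier[OF B]] by simp
    then show "spectral_form n U (f \<circ> d) v \<le> spectral_form n V (f \<circ> e) v"
      using loewner_le_iff_form[OF diagonalizes_mat_fun[OF A] diagonalizes_mat_fun[OF B]] v by blast
  qed
next
  assume f: "continuous_on I f \<and> form_monotone I f"
  show "operator_monotone_on I f"
    unfolding operator_monotone_on_def
  proof (intro conjI allI ballI impI)
    show "continuous_on I f" using f by simp
    fix n and A B :: "complex mat"
    assume AB: "A \<in> carrier_mat n n" "B \<in> carrier_mat n n" "hermitian_mat A" "hermitian_mat B"
      and sp: "spectrum A \<subseteq> complex_of_real ` I" "spectrum B \<subseteq> complex_of_real ` I"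
      and le: "A \<le>\<^sub>L B"
    obtain U d where A: "diagonalizes n U d A"
      using hermitian_diagonalizable[of A n] AB by (auto simp: hermitian_mat_def)
    obtain V e where B: "diagonalizes n V e B"
      using hermitian_diagonalizable[of B n] AB by (auto simp: hermitian_mat_def)
    have "\<forall>k<n. d k \<in> I \<and> e k \<in> I"
      using sp unfolding spectrum_diagonalizes[OF A] spectrum_diagonalizes[OF B]
      by (auto simp: inj_image_subset_iff[OF inj_of_real])
    moreover have "U \<in> carrier_mat n n" "V \<in> carrier_mat n n" "unitary_mat U" "unitary_mat V"
      using A B by (auto simp: diagonalizes_def)
    ultimately have "form_le I n U d V e"
      using le loewner_le_iff_form[OF A B] by (simp add: form_le_def)
    then have "\<forall>v \<in> carrier_vec n. spectral_form n U (f \<circ> d) v \<le> spectral_form n V (f \<circ> e) v"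
      using f form_monotoneD by blast
    then show "mat_fun f A \<le>\<^sub>L mat_fun f B"
      using loewner_le_iff_form[OF diagonalizes_mat_fun[OF A] diagonalizes_mat_fun[OF B]] by blast
  qed
qed

section \<open>Divided differences\<close>

lemma lagrange_poly:
  fixes q :: "real poly"
  assumes S: "finite S" and q: "degree q < card S"
  shows "q = (\<Sum>s\<in>S. Polynomial.smult (poly q s / (\<Prod>r\<in>S-{s}. s - r)) (\<Prod>r\<in>S-{s}. [:-r, 1:]))"
proof (rule poly_eqI_degree[of S])
  have deg: "degree (\<Prod>r\<in>S-{s}. [:-r, 1:]) = card S - 1" if "s \<in> S" for s
    using S that by (subst degree_prod_eq_sum_degree) auto
  show "degree (\<Sum>s\<in>S. Polynomial.smult (poly q s / (\<Prod>r\<in>S-{s}. s - r)) (\<Prod>r\<in>S-{s}. [:-r, 1:])) < card S"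
  proof (rule le_less_trans)
    show "degree (\<Sum>s\<in>S. Polynomial.smult (poly q s / (\<Prod>r\<in>S-{s}. s - r)) (\<Prod>r\<in>S-{s}. [:-r, 1:])) \<le> card S - 1"
      using S deg by (intro degree_sum_le) auto
  qed (use q in auto)
  fix t assume t: "t \<in> S"
  have "poly (\<Sum>s\<in>S. Polynomial.smult (poly q s / (\<Prod>r\<in>S-{s}. s - r)) (\<Prod>r\<in>S-{s}. [:-r, 1:])) t
      = (\<Sum>s\<in>S. if s = t then poly q t else 0)"
    unfolding poly_sum
  proof (intro sum.cong refl)
    fix s assume s: "s \<in> S"
    show "poly (Polynomial.smult (poly q s / (\<Prod>r\<in>S-{s}. s - r)) (\<Prod>r\<in>S-{s}. [:-r, 1:])) t = (if s = t then poly q t else 0)"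
    proof (cases "s = t")
      case False
      then have "(\<Prod>r\<in>S-{s}. t - r) = 0" using t S by (intro prod_zero) auto
      then show ?thesis using False by (simp add: poly_prod)
    next
      case True
      have "(\<Prod>r\<in>S-{t}. t - r) \<noteq> 0" using S by auto
      then show ?thesis using True by (simp add: poly_prod)
    qed
  qed
  then show "poly q t = poly (\<Sum>s\<in>S. Polynomial.smult (poly q s / (\<Prod>r\<in>S-{s}. s - r)) (\<Prod>r\<in>S-{s}. [:-r, 1:])) t"
    using t S by (simp add: sum.delta)
qed (use q in auto)

text \<open>Dividing Lagrange's formula by the node polynomial gives the partial fraction expansion
  of a rational function with simple poles in \<open>S\<close>.\<close>

lemma lagrange_eval:
  fixes q :: "real poly"
  assumes S: "finite S" and q: "degree q < card S" and z: "z \<notin> S"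
  shows "(\<Sum>s\<in>S. poly q s / ((\<Prod>r\<in>S-{s}. s - r) * (z - s))) = poly q z / (\<Prod>s\<in>S. z - s)"
proof -
  have nz: "(\<Prod>s\<in>S. z - s) \<noteq> 0" using S z by auto
  have "poly q z = (\<Sum>s\<in>S. poly q s / (\<Prod>r\<in>S-{s}. s - r) * (\<Prod>r\<in>S-{s}. z - r))"
    by (subst lagrange_poly[OF S q]) (simp add: poly_sum poly_prod)
  also have "\<dots> = (\<Sum>s\<in>S. poly q s / ((\<Prod>r\<in>S-{s}. s - r) * (z - s)) * (\<Prod>s\<in>S. z - s))"
  proof (intro sum.cong refl)
    fix s assume s: "s \<in> S"
    then have "(\<Prod>s\<in>S. z - s) = (z - s) * (\<Prod>r\<in>S-{s}. z - r)" using S by (simp add: prod.remove)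
    moreover have "z - s \<noteq> 0" using s z by auto
    ultimately show "poly q s / (\<Prod>r\<in>S-{s}. s - r) * (\<Prod>r\<in>S-{s}. z - r)
      = poly q s / ((\<Prod>r\<in>S-{s}. s - r) * (z - s)) * (\<Prod>s\<in>S. z - s)" by simp
  qed
  finally show ?thesis
    using nz unfolding sum_distrib_right[symmetric] by (metis nonzero_eq_divide_eq)
qed

text \<open>Compare the coefficients of degree \<open>card S - 1\<close> in Lagrange's formula,
  whose basis products are monic of exactly that degree.\<close>

lemma lagrange_lead:
  fixes q :: "real poly"
  assumes S: "finite S" and q: "degree q < card S"
  shows "(\<Sum>s\<in>S. poly q s / (\<Prod>r\<in>S-{s}. s - r)) = poly.coeff q (card S - 1)"
proof -
  have "poly.coeff q (card S - 1) = (\<Sum>s\<in>S. poly q s / (\<Prod>r\<in>S-{s}. s - r) * poly.coeff (\<Prod>r\<in>S-{s}. [:-r, 1:]) (card S - 1))"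
    by (subst lagrange_poly[OF S q]) (simp add: coeff_sum)
  also have "\<dots> = (\<Sum>s\<in>S. poly q s / (\<Prod>r\<in>S-{s}. s - r))"
  proof (intro sum.cong refl)
    fix s assume s: "s \<in> S"
    have "degree (\<Prod>r\<in>S-{s}. [:-r, 1:]) = card S - 1"
      using S s by (subst degree_prod_eq_sum_degree) auto
    moreover have "lead_coeff (\<Prod>r\<in>S-{s}. [:-r, 1:]) = 1"
      by (subst lead_coeff_prod) simp
    ultimately show "poly q s / (\<Prod>r\<in>S-{s}. s - r) * poly.coeff (\<Prod>r\<in>S-{s}. [:-r, 1:]) (card S - 1)
      = poly q s / (\<Prod>r\<in>S-{s}. s - r)" by simp
  qed
  finally show ?thesis by simp
qed

text \<open>Pair the factors with equal index. For i \<noteq> k the nodes \<alpha>_i and \<beta>_i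
  are neighbours and lie on the same side of the k-th node, so their ratio is positive; the
  remaining factor is \<beta>_k - \<alpha>_k. The square roots of these numbers are the weights of
  the Cauchy matrix below.\<close>

lemma interlacing_ratio_pos:
  fixes \<alpha> \<beta> :: "nat \<Rightarrow> real"
  assumes "\<And>i j. i \<le> j \<Longrightarrow> j < n \<Longrightarrow> \<alpha> i < \<beta> j" "\<And>i j. i < j \<Longrightarrow> j < n \<Longrightarrow> \<beta> i < \<alpha> j" and k: "k < n"
  shows "- (\<Prod>j<n. \<alpha> k - \<beta> j) / (\<Prod>i\<in>{..<n}-{k}. \<alpha> k - \<alpha> i) > 0"
    "(\<Prod>i<n. \<beta> k - \<alpha> i) / (\<Prod>j\<in>{..<n}-{k}. \<beta> k - \<beta> j) > 0"
proof -
  have \<alpha>: "\<alpha> i < \<alpha> j" and \<beta>: "\<beta> i < \<beta> j" if "i < j" "j < n" for i j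
    using assms(1)[of i i] assms(2)[OF that] assms(1)[of j j] that by auto
  have "(\<Prod>j<n. \<alpha> k - \<beta> j) = (\<alpha> k - \<beta> k) * (\<Prod>j\<in>{..<n}-{k}. \<alpha> k - \<beta> j)"
    using k by (simp add: prod.remove)
  then have "- (\<Prod>j<n. \<alpha> k - \<beta> j) / (\<Prod>i\<in>{..<n}-{k}. \<alpha> k - \<alpha> i)
     = (\<beta> k - \<alpha> k) * (\<Prod>i\<in>{..<n}-{k}. (\<alpha> k - \<beta> i) / (\<alpha> k - \<alpha> i))"
    by (simp only: prod_dividef mult_minus_left[symmetric] minus_diff_eq times_divide_eq_right)
  also have "\<dots> > 0"
  proof (intro mult_pos_pos prod_pos ballI)
    fix i assume "i \<in> {..<n}-{k}"
    then consider "i < k" | "k < i" "i < n" by fastforce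
    then show "(\<alpha> k - \<beta> i) / (\<alpha> k - \<alpha> i) > 0"
      using assms(2)[of i k] \<alpha>[of i k] assms(1)[of k i] \<alpha>[of k i] k
      by cases (auto intro: divide_pos_pos divide_neg_neg)
  qed (use k assms(1) in auto)
  finally show "- (\<Prod>j<n. \<alpha> k - \<beta> j) / (\<Prod>i\<in>{..<n}-{k}. \<alpha> k - \<alpha> i) > 0" .
  have "(\<Prod>i<n. \<beta> k - \<alpha> i) = (\<beta> k - \<alpha> k) * (\<Prod>j\<in>{..<n}-{k}. \<beta> k - \<alpha> j)"
    using k by (simp add: prod.remove)
  then have "(\<Prod>i<n. \<beta> k - \<alpha> i) / (\<Prod>j\<in>{..<n}-{k}. \<beta> k - \<beta> j)
     = (\<beta> k - \<alpha> k) * (\<Prod>i\<in>{..<n}-{k}. (\<beta> k - \<alpha> i) / (\<beta> k - \<beta> i))"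
    by (simp add: prod_dividef)
  also have "\<dots> > 0"
  proof (intro mult_pos_pos prod_pos ballI)
    fix i assume "i \<in> {..<n}-{k}"
    then consider "i < k" | "k < i" "i < n" by fastforce
    then show "(\<beta> k - \<alpha> i) / (\<beta> k - \<beta> i) > 0"
      using assms(1)[of i k] \<beta>[of i k] assms(2)[of k i] \<beta>[of k i] k
      by cases (auto intro: divide_pos_pos divide_neg_neg)
  qed (use k assms(1) in auto)
  finally show "(\<Prod>i<n. \<beta> k - \<alpha> i) / (\<Prod>j\<in>{..<n}-{k}. \<beta> k - \<beta> j) > 0" .
qed

lemma sum_image_lessThan:
  fixes \<alpha> :: "nat \<Rightarrow> real" and F :: "real \<Rightarrow> real \<Rightarrow> real"
  assumes "inj_on \<alpha> {..<n}"
  shows "(\<Sum>s\<in>\<alpha>`{..<n}. F s (\<Prod>r\<in>\<alpha>`{..<n}-{s}. s - r))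
    = (\<Sum>i<n. F (\<alpha> i) (\<Prod>j\<in>{..<n}-{i}. \<alpha> i - \<alpha> j))"
proof (subst sum.reindex[OF assms], unfold o_def, intro sum.cong refl)
  fix i assume i: "i \<in> {..<n}"
  have "\<alpha>`{..<n} - {\<alpha> i} = \<alpha>`({..<n}-{i})" using assms i by (auto simp: inj_on_def)
  moreover have "inj_on \<alpha> ({..<n}-{i})" using assms by (rule inj_on_subset) auto
  ultimately show "F (\<alpha> i) (\<Prod>r\<in>\<alpha>`{..<n}-{\<alpha> i}. \<alpha> i - r) = F (\<alpha> i) (\<Prod>j\<in>{..<n}-{i}. \<alpha> i - \<alpha> j)"
    by (simp add: prod.reindex)
qed

text \<open>The Cauchy matrix of interlacing sequences is orthogonal, and conjugating
  \<open>diag \<beta>\<close> by it gives a rank-one perturbation of \<open>diag \<alpha>\<close>.\<close>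

lemma form_monotone_interlacing:
  fixes \<alpha> \<beta> :: "nat \<Rightarrow> real" and p :: "real poly"
  assumes f: "form_monotone I f"
    and il: "\<And>i j. i \<le> j \<Longrightarrow> j < n \<Longrightarrow> \<alpha> i < \<beta> j" "\<And>i j. i < j \<Longrightarrow> j < n \<Longrightarrow> \<beta> i < \<alpha> j"
    and I: "\<And>i. i < n \<Longrightarrow> \<alpha> i \<in> I" "\<And>i. i < n \<Longrightarrow> \<beta> i \<in> I"
    and p: "degree p < n"
  shows "0 \<le> (\<Sum>i<n. (poly p (\<alpha> i))\<^sup>2 * f (\<alpha> i) / ((\<Prod>k\<in>{..<n}-{i}. \<alpha> i - \<alpha> k) * (\<Prod>j<n. \<alpha> i - \<beta> j)))
          + (\<Sum>j<n. (poly p (\<beta> j))\<^sup>2 * f (\<beta> j) / ((\<Prod>k\<in>{..<n}-{j}. \<beta> j - \<beta> k) * (\<Prod>i<n. \<beta> j - \<alpha> i)))"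
proof -
  have \<alpha>m: "\<alpha> i < \<alpha> j" and \<beta>m: "\<beta> i < \<beta> j" if "i < j" "j < n" for i j
    using il(1)[of i i] il(2)[OF that] il(1)[of j j] that by auto
  have inj\<alpha>: "inj_on \<alpha> {..<n}" and inj\<beta>: "inj_on \<beta> {..<n}"
    using \<alpha>m \<beta>m unfolding inj_on_def by (metis lessThan_iff nat_neq_iff order_less_irrefl)+
  have ne: "\<alpha> i \<noteq> \<beta> j" if "i < n" "j < n" for i j
    using il(1)[of i j] il(2)[of j i] that by (cases "i \<le> j") auto
  define A where "A = (\<lambda>i. \<Prod>k\<in>{..<n}-{i}. \<alpha> i - \<alpha> k)"
  define B where "B = (\<lambda>i. \<Prod>k\<in>{..<n}-{i}. \<beta> i - \<beta> k)"
  define a where "a = (\<lambda>z. \<Prod>i<n. z - \<alpha> i)"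
  define b where "b = (\<lambda>z. \<Prod>i<n. z - \<beta> i)"
  define X where "X = (\<lambda>i. - b (\<alpha> i) / A i)"
  define Y where "Y = (\<lambda>j. a (\<beta> j) / B j)"
  have XY: "X i > 0" "Y i > 0" if "i < n" for i
    using interlacing_ratio_pos[OF il that] by (auto simp: X_def Y_def a_def b_def A_def B_def)
  have nz: "A i \<noteq> 0" "B i \<noteq> 0" "a (\<beta> i) \<noteq> 0" "b (\<alpha> i) \<noteq> 0" if "i < n" for i
    using XY[OF that] by (auto simp: X_def Y_def)
  have c\<alpha>: "card (\<alpha>`{..<n}) = n" and c\<beta>: "card (\<beta>`{..<n}) = n"
    using card_image[OF inj\<alpha>] card_image[OF inj\<beta>] by auto
  have lag\<beta>: "(\<Sum>j<n. poly q (\<beta> j) / (B j * (z - \<beta> j))) = poly q z / b z"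
    if "degree q < n" "z \<notin> \<beta>`{..<n}" for q z
    using lagrange_eval[of "\<beta>`{..<n}" q z] that c\<beta>
      sum_image_lessThan[OF inj\<beta>, of "\<lambda>s w. poly q s / (w * (z - s))"]
    by (simp add: B_def b_def prod.reindex[OF inj\<beta>])
  have lag\<alpha>: "(\<Sum>j<n. poly q (\<alpha> j) / (A j * (z - \<alpha> j))) = poly q z / a z"
    if "degree q < n" "z \<notin> \<alpha>`{..<n}" for q z
    using lagrange_eval[of "\<alpha>`{..<n}" q z] that c\<alpha>
      sum_image_lessThan[OF inj\<alpha>, of "\<lambda>s w. poly q s / (w * (z - s))"]
    by (simp add: A_def a_def prod.reindex[OF inj\<alpha>])
  have lead\<beta>: "(\<Sum>j<n. poly q (\<beta> j) / B j) = poly.coeff q (n - 1)" if "degree q < n" for q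
    using lagrange_lead[of "\<beta>`{..<n}" q] that c\<beta>
      sum_image_lessThan[OF inj\<beta>, of "\<lambda>s w. poly q s / w"]
    by (simp add: B_def)
  \<comment> \<open>\<open>Q k\<close> is the polynomial a(z) / (z - \<alpha>_k). It turns sums of
    Y_j / (\<beta>_j - \<alpha>_k) into Lagrange sums over the nodes \<beta>_j.\<close>
  define Q where "Q = (\<lambda>k. \<Prod>l\<in>{..<n}-{k}. [:- \<alpha> l, 1:])"
  have degQ: "degree (Q k) = n - 1" and leadQ: "poly.coeff (Q k) (n - 1) = 1" if "k < n" for k
  proof -
    show d: "degree (Q k) = n - 1"
      using that unfolding Q_def by (subst degree_prod_eq_sum_degree) auto
    have "lead_coeff (Q k) = 1" unfolding Q_def by (subst lead_coeff_prod) simp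
    then show "poly.coeff (Q k) (n - 1) = 1" using d by simp
  qed
  have Qa: "a z = (z - \<alpha> k) * poly (Q k) z" if "k < n" for z k
    using that by (simp add: a_def Q_def poly_prod prod.remove[of "{..<n}" k])
  have QA: "poly (Q k) (\<alpha> i) = (if i = k then A k else 0)" if "i < n" "k < n" for i k
    using that by (auto simp: Q_def A_def poly_prod intro!: prod_zero)
  \<comment> \<open>The sum is, up to sign, the partial fraction expansion of \<open>Q k\<close> / b
    evaluated at \<alpha>_i, and \<open>Q k\<close> vanishes at every \<alpha>_i other than
    \<alpha>_k.\<close>
  have orth: "(\<Sum>j<n. Y j / ((\<beta> j - \<alpha> i) * (\<beta> j - \<alpha> k))) = (if i = k then 1 / X i else 0)"
    if "i < n" "k < n" for i k
  proof -
    have "(\<Sum>j<n. Y j / ((\<beta> j - \<alpha> i) * (\<beta> j - \<alpha> k))) = (\<Sum>j<n. - (poly (Q k) (\<beta> j) / (B j * (\<alpha> i - \<beta> j))))"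
    proof (intro sum.cong refl)
      fix j assume "j \<in> {..<n}"
      then have "\<beta> j - \<alpha> k \<noteq> 0" "\<beta> j - \<alpha> i \<noteq> 0" "B j \<noteq> 0" using ne[of k j] ne[of i j] nz that by auto
      then show "Y j / ((\<beta> j - \<alpha> i) * (\<beta> j - \<alpha> k)) = - (poly (Q k) (\<beta> j) / (B j * (\<alpha> i - \<beta> j)))"
        by (simp add: Y_def Qa[OF that(2)] divide_simps) (simp add: algebra_simps)
    qed
    also have "\<dots> = - (poly (Q k) (\<alpha> i) / b (\<alpha> i))"
      unfolding sum_negf using that ne by (subst lag\<beta>) (auto simp: degQ)
    also have "\<dots> = (if i = k then 1 / X i else 0)"
      using that by (auto simp: QA X_def)
    finally show ?thesis .
  qed
  \<comment> \<open>Without the second denominator the same substitution leaves the leading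
    coefficient of the monic polynomial \<open>Q k\<close>.\<close>
  have one: "(\<Sum>j<n. Y j / (\<beta> j - \<alpha> k)) = 1" if "k < n" for k
  proof -
    have "(\<Sum>j<n. Y j / (\<beta> j - \<alpha> k)) = (\<Sum>j<n. poly (Q k) (\<beta> j) / B j)"
    proof (intro sum.cong refl)
      fix j assume "j \<in> {..<n}"
      then have "\<beta> j - \<alpha> k \<noteq> 0" using ne[of k j] that by auto
      then show "Y j / (\<beta> j - \<alpha> k) = poly (Q k) (\<beta> j) / B j"
        by (simp add: Y_def Qa[OF that])
    qed
    also have "\<dots> = 1" using that leadQ[OF that] by (subst lead\<beta>) (auto simp: degQ)
    finally show ?thesis .
  qed
  define x where "x = (\<lambda>i. sqrt (X i))"
  define y where "y = (\<lambda>i. sqrt (Y i))"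
  have xx: "x i * x i = X i" "x i \<noteq> 0" and yy: "y i * y i = Y i" if "i < n" for i
    using XY[OF that] by (auto simp: x_def y_def)
  define C where "C = (\<lambda>i j. x i * y j / (\<beta> j - \<alpha> i))"
  have CC: "(\<Sum>j<n. C i j * C k j) = (if i = k then 1 else 0)" if "i < n" "k < n" for i k
  proof -
    have "(\<Sum>j<n. C i j * C k j) = x i * x k * (\<Sum>j<n. Y j / ((\<beta> j - \<alpha> i) * (\<beta> j - \<alpha> k)))"
      unfolding sum_distrib_left by (intro sum.cong refl) (auto simp: C_def yy[symmetric])
    then show ?thesis using that xx XY[OF that(2)] by (auto simp: orth)
  qed
  \<comment> \<open>Write \<beta>_j = \<alpha>_i + (\<beta>_j - \<alpha>_i). The first part
    reproduces diag \<alpha> by orthogonality; in the second the denominator cancels and, by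
    \<open>one\<close>, the rank-one matrix x_i x_k remains.\<close>
  have CbC: "(\<Sum>j<n. \<beta> j * (C i j * C k j)) = (if i = k then \<alpha> i else 0) + x i * x k"
    if "i < n" "k < n" for i k
  proof -
    have "(\<Sum>j<n. \<beta> j * (C i j * C k j)) = (\<Sum>j<n. \<alpha> i * (C i j * C k j) + x i * x k * (Y j / (\<beta> j - \<alpha> k)))"
    proof (intro sum.cong refl)
      fix j assume "j \<in> {..<n}"
      then have "\<beta> j - \<alpha> i \<noteq> 0" "Y j = y j * y j" using ne[of i j] yy that by auto
      moreover have "C i j * (\<beta> j - \<alpha> i) = x i * y j" using \<open>\<beta> j - \<alpha> i \<noteq> 0\<close> by (simp add: C_def)
      moreover have "\<beta> j * (C i j * C k j) = \<alpha> i * (C i j * C k j) + (C i j * (\<beta> j - \<alpha> i)) * C k j"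
        by (simp add: algebra_simps)
      moreover have "(x i * y j) * C k j = x i * x k * (Y j / (\<beta> j - \<alpha> k))"
        unfolding \<open>Y j = y j * y j\<close> by (simp add: C_def)
      ultimately show "\<beta> j * (C i j * C k j) = \<alpha> i * (C i j * C k j) + x i * x k * (Y j / (\<beta> j - \<alpha> k))"
        by metis
    qed
    also have "\<dots> = \<alpha> i * (if i = k then 1 else 0) + x i * x k"
      unfolding sum.distrib sum_distrib_left[symmetric] using that by (simp add: CC one)
    finally show ?thesis by simp
  qed
  define V where "V = mat n n (\<lambda>(i,j). complex_of_real (C i j))"
  have V: "V \<in> carrier_mat n n" by (simp add: V_def)
  have "V * mat_adjoint V = 1\<^sub>m n"
  proof (rule eq_matI)
    fix i k assume ik: "i < dim_row (1\<^sub>m n :: complex mat)" "k < dim_col (1\<^sub>m n :: complex mat)"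
    have "(V * mat_adjoint V) $$ (i,k) = (\<Sum>j<n. complex_of_real (C i j * C k j))"
      using ik by (auto simp: scalar_prod_def atLeast0LessThan V_def intro!: sum.cong)
    also have "\<dots> = 1\<^sub>m n $$ (i,k)" unfolding of_real_sum[symmetric] using ik by (simp add: CC)
    finally show "(V * mat_adjoint V) $$ (i,k) = 1\<^sub>m n $$ (i,k)" .
  qed (use V in auto)
  moreover from this have "mat_adjoint V * V = 1\<^sub>m n"
    using mat_mult_left_right_inverse[OF V mat_adjoint_carrier[OF V]] by blast
  ultimately have uV: "unitary_mat V" using V by (auto simp: unitary_mat_def)
  have u1: "unitary_mat (1\<^sub>m n)" by (auto simp: unitary_mat_def)
  have form1: "spectral_form n (1\<^sub>m n) d v = (\<Sum>k<n. d k * (cmod (v $ k))\<^sup>2)" for d v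
  proof -
    have "(\<Sum>i<n. cnj (1\<^sub>m n $$ (i,k)) * v $ i) = v $ k" if "k < n" for k
    proof -
      have "(\<Sum>i<n. cnj (1\<^sub>m n $$ (i,k)) * v $ i) = (\<Sum>i<n. if i = k then v $ i else 0)"
        using that by (intro sum.cong) auto
      then show ?thesis using that by (simp add: sum.delta)
    qed
    then show ?thesis by (simp add: spectral_form_def)
  qed
  have le: "spectral_form n (1\<^sub>m n) \<alpha> v \<le> spectral_form n V \<beta> v" if v: "v \<in> carrier_vec n" for v
  proof -
    have "complex_of_real (spectral_form n V \<beta> v)
      = (\<Sum>j<n. of_real (\<beta> j) * ((\<Sum>i<n. of_real (C i j) * v $ i) * cnj (\<Sum>k<n. of_real (C k j) * v $ k)))"
      unfolding complex_norm_square[symmetric] spectral_form_def by (simp add: V_def)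
    also have "\<dots> = (\<Sum>j<n. \<Sum>i<n. \<Sum>k<n. of_real (\<beta> j * (C i j * C k j)) * (v $ i * cnj (v $ k)))"
      unfolding cnj_sum sum_product by (simp add: sum_distrib_left mult_ac)
    also have "\<dots> = (\<Sum>i<n. \<Sum>k<n. \<Sum>j<n. of_real (\<beta> j * (C i j * C k j)) * (v $ i * cnj (v $ k)))"
      by (rule trans[OF sum.swap sum.cong[OF refl sum.swap]])
    also have "\<dots> = (\<Sum>i<n. \<Sum>k<n. of_real ((if i = k then \<alpha> i else 0) + x i * x k) * (v $ i * cnj (v $ k)))"
      unfolding sum_distrib_right[symmetric] of_real_sum[symmetric]
      by (intro sum.cong refl) (simp add: CbC)
    also have "\<dots> = (\<Sum>i<n. \<Sum>k<n. (if k = i then of_real (\<alpha> i) * (v $ i * cnj (v $ k)) else 0)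
         + (of_real (x i) * v $ i) * cnj (of_real (x k) * v $ k))"
      by (intro sum.cong refl) (auto simp: algebra_simps)
    also have "\<dots> = (\<Sum>i<n. of_real (\<alpha> i) * (v $ i * cnj (v $ i)))
         + (\<Sum>i<n. of_real (x i) * v $ i) * cnj (\<Sum>i<n. of_real (x i) * v $ i)"
      by (simp add: sum.distrib sum.delta sum_product)
    also have "\<dots> = of_real (spectral_form n (1\<^sub>m n) \<alpha> v + (cmod (\<Sum>i<n. of_real (x i) * v $ i))\<^sup>2)"
      unfolding complex_norm_square[symmetric] form1 by simp
    finally have "spectral_form n V \<beta> v
        = spectral_form n (1\<^sub>m n) \<alpha> v + (cmod (\<Sum>i<n. of_real (x i) * v $ i))\<^sup>2"
      unfolding of_real_eq_iff .
    then show ?thesis by simp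
  qed
  \<comment> \<open>The test vector is chosen so that its coordinates with respect to
    \<open>V\<close> are partial fraction sums, equal to y_j p(\<beta>_j) / a(\<beta>_j).\<close>
  define w where "w = vec n (\<lambda>i. complex_of_real (poly p (\<alpha> i) / (A i * x i)))"
  have w: "w \<in> carrier_vec n" by (simp add: w_def)
  have "spectral_form n (1\<^sub>m n) (f \<circ> \<alpha>) w \<le> spectral_form n V (f \<circ> \<beta>) w"
    using V uV u1 I le by (intro form_monotoneD[OF f _ w]) (auto simp: form_le_def)
  moreover have "spectral_form n (1\<^sub>m n) (f \<circ> \<alpha>) w = - (\<Sum>i<n. (poly p (\<alpha> i))\<^sup>2 * f (\<alpha> i) / (A i * b (\<alpha> i)))"
    unfolding form1 sum_negf[symmetric]
  proof (intro sum.cong refl)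
    fix i assume i: "i \<in> {..<n}"
    have "(cmod (w $ i))\<^sup>2 = (poly p (\<alpha> i))\<^sup>2 / (A i * A i * X i)"
      using i xx[of i] by (simp add: w_def norm_divide norm_mult power_divide power_mult_distrib power2_eq_square mult_ac)
    then show "(f \<circ> \<alpha>) i * (cmod (w $ i))\<^sup>2 = - ((poly p (\<alpha> i))\<^sup>2 * f (\<alpha> i) / (A i * b (\<alpha> i)))"
      using nz[of i] i by (simp add: X_def)
  qed
  moreover have "spectral_form n V (f \<circ> \<beta>) w = (\<Sum>j<n. (poly p (\<beta> j))\<^sup>2 * f (\<beta> j) / (B j * a (\<beta> j)))"
    unfolding spectral_form_def
  proof (intro sum.cong refl)
    fix j assume j: "j \<in> {..<n}"
    have "(\<Sum>i<n. cnj (V $$ (i,j)) * w $ i) = of_real (y j * (\<Sum>i<n. poly p (\<alpha> i) / (A i * (\<beta> j - \<alpha> i))))"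
      unfolding sum_distrib_left of_real_sum using j
      by (intro sum.cong refl) (simp add: V_def w_def C_def xx)
    also have "(\<Sum>i<n. poly p (\<alpha> i) / (A i * (\<beta> j - \<alpha> i))) = poly p (\<beta> j) / a (\<beta> j)"
    proof (rule lag\<alpha>[OF p])
      show "\<beta> j \<notin> \<alpha> ` {..<n}" using ne j by fastforce
    qed
    finally have "(cmod (\<Sum>i<n. cnj (V $$ (i,j)) * w $ i))\<^sup>2 = Y j * (poly p (\<beta> j))\<^sup>2 / (a (\<beta> j) * a (\<beta> j))"
      using yy[of j] j by (simp add: norm_divide norm_mult power_divide power_mult_distrib power2_eq_square mult_ac)
    then show "(f \<circ> \<beta>) j * (cmod (\<Sum>i<n. cnj (V $$ (i,j)) * w $ i))\<^sup>2 = (poly p (\<beta> j))\<^sup>2 * f (\<beta> j) / (B j * a (\<beta> j))"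
      using nz[of j] j by (simp add: Y_def)
  qed
  ultimately show ?thesis by (simp add: A_def B_def a_def b_def)
qed

section \<open>Signs of divided differences\<close>

definition divided_diff :: "real set \<Rightarrow> (real \<Rightarrow> real) \<Rightarrow> real" where
  "divided_diff T g = (\<Sum>t\<in>T. g t / (\<Prod>s\<in>T-{t}. t - s))"

text \<open>Sort \<open>T\<close> and take its points alternately as \<alpha> and \<beta>: the two
  sequences interlace, and the two products in each denominator merge into the product over the rest
  of \<open>T\<close>.\<close>

lemma divided_diff_nonneg:
  fixes p :: "real poly"
  assumes f: "form_monotone I f" and T: "finite T" "T \<subseteq> I" "card T = 2 * n" and p: "degree p < n"
  shows "0 \<le> divided_diff T (\<lambda>t. (poly p t)\<^sup>2 * f t)"
proof -
  define xs where "xs = sorted_list_of_set T"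
  have xs: "sorted_wrt (<) xs" "set xs = T" "length xs = 2 * n"
    using T by (auto simp: xs_def strict_sorted_list_of_set)
  define \<alpha> where "\<alpha> = (\<lambda>i. xs ! (2 * i))"
  define \<beta> where "\<beta> = (\<lambda>i. xs ! (2 * i + 1))"
  have il: "i \<le> j \<Longrightarrow> j < n \<Longrightarrow> \<alpha> i < \<beta> j" "i < j \<Longrightarrow> j < n \<Longrightarrow> \<beta> i < \<alpha> j" for i j
    using xs by (auto simp: \<alpha>_def \<beta>_def intro!: sorted_wrt_nth_less[OF xs(1)])
  have mono: "i < j \<Longrightarrow> j < n \<Longrightarrow> \<alpha> i < \<alpha> j" "i < j \<Longrightarrow> j < n \<Longrightarrow> \<beta> i < \<beta> j" for i j
    using xs by (auto simp: \<alpha>_def \<beta>_def intro!: sorted_wrt_nth_less[OF xs(1)])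
  have inj: "inj_on \<alpha> {..<n}" "inj_on \<beta> {..<n}"
    using mono unfolding inj_on_def by (metis lessThan_iff nat_neq_iff order_less_irrefl)+
  have ne: "\<alpha> i \<noteq> \<beta> j" if "i < n" "j < n" for i j
    using il(1)[of i j] il(2)[of j i] that by (cases "i \<le> j") auto
  have disj: "\<alpha>`{..<n} \<inter> \<beta>`{..<n} = {}" using ne by fastforce
  have Teq: "T = \<alpha>`{..<n} \<union> \<beta>`{..<n}"
  proof -
    have "T = (\<lambda>i. xs ! i) ` {..<2 * n}" using xs(2,3) by (auto simp: set_conv_nth)
    also have "{..<2 * n} = (\<lambda>i. 2 * i) ` {..<n} \<union> (\<lambda>i. 2 * i + 1) ` {..<n}"
    proof (intro equalityI subsetI)
      fix i assume "i \<in> {..<2 * n}"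
      then show "i \<in> (\<lambda>i. 2 * i) ` {..<n} \<union> (\<lambda>i. 2 * i + 1) ` {..<n}"
        by (cases "even i") (auto elim!: evenE oddE)
    qed auto
    finally show ?thesis by (simp add: image_Un image_image \<alpha>_def \<beta>_def)
  qed
  have pa: "(\<Prod>s\<in>T-{\<alpha> i}. \<alpha> i - s) = (\<Prod>k\<in>{..<n}-{i}. \<alpha> i - \<alpha> k) * (\<Prod>j<n. \<alpha> i - \<beta> j)" if "i < n" for i
  proof -
    have "T - {\<alpha> i} = \<alpha>`({..<n}-{i}) \<union> \<beta>`{..<n}"
      using Teq that ne inj(1) by (auto simp: inj_on_def)
    moreover have "\<alpha>`({..<n}-{i}) \<inter> \<beta>`{..<n} = {}" using disj by auto
    moreover have "inj_on \<alpha> ({..<n}-{i})" using inj(1) by (rule inj_on_subset) auto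
    ultimately show ?thesis using inj by (simp add: prod.union_disjoint prod.reindex)
  qed
  have pb: "(\<Prod>s\<in>T-{\<beta> i}. \<beta> i - s) = (\<Prod>k\<in>{..<n}-{i}. \<beta> i - \<beta> k) * (\<Prod>j<n. \<beta> i - \<alpha> j)" if "i < n" for i
  proof -
    have "T - {\<beta> i} = \<alpha>`{..<n} \<union> \<beta>`({..<n}-{i})"
      using Teq that ne inj(2) by (fastforce simp: inj_on_def)
    moreover have "\<alpha>`{..<n} \<inter> \<beta>`({..<n}-{i}) = {}" using disj by auto
    moreover have "inj_on \<beta> ({..<n}-{i})" using inj(2) by (rule inj_on_subset) auto
    ultimately show ?thesis using inj by (simp add: prod.union_disjoint prod.reindex mult.commute)
  qed
  have "\<alpha> i \<in> I" "\<beta> i \<in> I" if "i < n" for i using T Teq that by auto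
  from form_monotone_interlacing[OF f il this p]
  have "0 \<le> (\<Sum>i<n. (poly p (\<alpha> i))\<^sup>2 * f (\<alpha> i) / (\<Prod>s\<in>T-{\<alpha> i}. \<alpha> i - s))
          + (\<Sum>j<n. (poly p (\<beta> j))\<^sup>2 * f (\<beta> j) / (\<Prod>s\<in>T-{\<beta> j}. \<beta> j - s))"
    by (simp add: pa pb cong: sum.cong_simp)
  also have "\<dots> = divided_diff T (\<lambda>t. (poly p t)\<^sup>2 * f t)"
  proof -
    have "sum G T = (\<Sum>i<n. G (\<alpha> i)) + (\<Sum>i<n. G (\<beta> i))" for G :: "real \<Rightarrow> real"
    proof -
      have "sum G T = sum G (\<alpha>`{..<n}) + sum G (\<beta>`{..<n})"
        unfolding Teq using disj by (intro sum.union_disjoint) auto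
      then show ?thesis using inj by (simp add: sum.reindex)
    qed
    then show ?thesis unfolding divided_diff_def by simp
  qed
  finally show ?thesis .
qed

text \<open>Applying the previous inequality with the additional node \<open>R\<close> and the polynomial
  \<open>(t - R) p\<close>, and letting \<open>R\<close> tend to infinity, expresses operator concavity.\<close>

lemma divided_diff_concave:
  fixes p :: "real poly"
  assumes f: "form_monotone {0..} f" and T: "finite T" "T \<subseteq> {0..}" "card T = 2 * n + 1" and p: "degree p < n"
  shows "divided_diff T (\<lambda>t. (poly p t)\<^sup>2 * f t) \<le> 0"
proof -
  define g where "g = (\<lambda>t. (poly p t)\<^sup>2 * f t / (\<Prod>s\<in>T-{t}. t - s))"
  have ineq: "0 \<le> (\<Sum>t\<in>T. (t - R) * g t)" if R: "R > Max (insert 0 T)" for R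
  proof -
    have RT: "R \<notin> T" "R \<ge> 0" "\<And>t. t \<in> T \<Longrightarrow> t < R" using R T by auto
    have "degree ([:-R,1:] * p) < n + 1"
      using p by (intro le_less_trans[OF degree_mult_le]) auto
    then have "0 \<le> divided_diff (insert R T) (\<lambda>t. (poly ([:-R,1:] * p) t)\<^sup>2 * f t)"
      using f T RT by (intro divided_diff_nonneg[OF f, of _ "n+1"]) auto
    also have "\<dots> = (\<Sum>t\<in>T. (t - R) * g t)"
      unfolding divided_diff_def sum.insert[OF T(1) RT(1)]
    proof (intro trans[OF arg_cong2[of _ 0 _ _ "(+)"] add_0] sum.cong refl)
      fix t assume t: "t \<in> T"
      have "insert R T - {t} = insert R (T - {t})" using t RT by auto
      then have "(\<Prod>s\<in>insert R T-{t}. t - s) = (t - R) * (\<Prod>s\<in>T-{t}. t - s)"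
        using T RT by (simp add: prod.insert)
      moreover have "t - R \<noteq> 0" using RT(3)[OF t] by simp
      moreover have "poly ([:-R,1:] * p) t = (t - R) * poly p t" by (simp add: algebra_simps)
      ultimately show "(poly ([:-R,1:] * p) t)\<^sup>2 * f t / (\<Prod>s\<in>insert R T-{t}. t - s) = (t - R) * g t"
        by (simp only: g_def) (simp add: power2_eq_square)
    qed simp
    finally show ?thesis .
  qed
  have "(\<Sum>t\<in>T. g t) \<le> 0"
  proof (rule ccontr)
    assume "\<not> (\<Sum>t\<in>T. g t) \<le> 0"
    then have pos: "(\<Sum>t\<in>T. g t) > 0" by simp
    \<comment> \<open>The sum in \<open>ineq\<close> is affine in R with slope minus the sum of
      \<open>g\<close>. If that sum were positive, the expression would be negative for every R
      beyond the quotient used here.\<close>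
    define R where "R = max (Max (insert 0 T)) ((\<Sum>t\<in>T. t * g t) / (\<Sum>t\<in>T. g t)) + 1"
    have "0 \<le> (\<Sum>t\<in>T. (t - R) * g t)" by (rule ineq) (auto simp: R_def)
    also have "\<dots> = (\<Sum>t\<in>T. t * g t) - R * (\<Sum>t\<in>T. g t)"
      by (simp add: left_diff_distrib sum_subtractf sum_distrib_left)
    finally have "R \<le> (\<Sum>t\<in>T. t * g t) / (\<Sum>t\<in>T. g t)" using pos by (simp add: field_simps)
    then show False by (simp add: R_def)
  qed
  then show ?thesis by (simp add: divided_diff_def g_def)
qed

lemma divided_diff_quotient_nonpos:
  fixes p :: "real poly"
  assumes f: "form_monotone {0..} f" and f0: "f 0 \<ge> 0"
    and T: "finite T" "T \<subseteq> {0<..}" "card T = 2 * n" and p: "degree p < n"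
  shows "divided_diff T (\<lambda>t. (poly p t)\<^sup>2 * (f t / t)) \<le> 0"
proof -
  have T0: "0 \<notin> T" using T by auto
  have "divided_diff (insert 0 T) (\<lambda>t. (poly p t)\<^sup>2 * f t) \<le> 0"
    using T T0 p by (intro divided_diff_concave[OF f, of _ n]) auto
  also have "divided_diff (insert 0 T) (\<lambda>t. (poly p t)\<^sup>2 * f t)
     = (poly p 0)\<^sup>2 * f 0 / (\<Prod>s\<in>T. 0 - s) + divided_diff T (\<lambda>t. (poly p t)\<^sup>2 * (f t / t))"
    unfolding divided_diff_def
  proof (subst sum.insert, use T in simp, use T0 in simp, intro arg_cong2[of _ _ _ _ "(+)"] sum.cong refl)
    show "(poly p 0)\<^sup>2 * f 0 / (\<Prod>s\<in>insert 0 T-{0}. 0 - s) = (poly p 0)\<^sup>2 * f 0 / (\<Prod>s\<in>T. 0 - s)"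
      using T0 by simp
    fix t assume t: "t \<in> T"
    have "insert 0 T - {t} = insert 0 (T - {t})" using t T0 by auto
    then have "(\<Prod>s\<in>insert 0 T-{t}. t - s) = t * (\<Prod>s\<in>T-{t}. t - s)"
      using T T0 by (simp add: prod.insert)
    then show "(poly p t)\<^sup>2 * f t / (\<Prod>s\<in>insert 0 T-{t}. t - s) = (poly p t)\<^sup>2 * (f t / t) / (\<Prod>s\<in>T-{t}. t - s)"
      by simp
  qed
  finally have le: "(poly p 0)\<^sup>2 * f 0 / (\<Prod>s\<in>T. 0 - s) + divided_diff T (\<lambda>t. (poly p t)\<^sup>2 * (f t / t)) \<le> 0" .
  have "(\<Prod>s\<in>T. 0 - s) = (\<Prod>s\<in>T. s)" using T(3) by (simp add: prod_uminus)
  moreover have "(\<Prod>s\<in>T. s) > 0" using T by (intro prod_pos) auto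
  ultimately have "(poly p 0)\<^sup>2 * f 0 / (\<Prod>s\<in>T. 0 - s) \<ge> 0" using f0 by simp
  then show ?thesis using le by linarith
qed

section \<open>Interpolation by Gauss quadrature\<close>

lemma real_diag_mult: "real_diag n a * real_diag n b = real_diag n (\<lambda>k. a k * b k)"
  by (simp add: real_diag_def mat_diag_diag)

abbreviation (input) quad :: "nat \<Rightarrow> (nat \<Rightarrow> nat \<Rightarrow> real) \<Rightarrow> (nat \<Rightarrow> real) \<Rightarrow> real" where
  "quad n H a \<equiv> (\<Sum>i<n. \<Sum>j<n. a i * H i j * a j)"

text \<open>For a real symmetric matrix the mixed terms of real and imaginary part cancel. This
  bridges the spectral theorem, which supplies complex eigenvectors, and sign hypotheses that
  concern real vectors.\<close>

lemma hermitian_form_real: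
  fixes H :: "nat \<Rightarrow> nat \<Rightarrow> real" and v :: "nat \<Rightarrow> complex"
  assumes "\<And>i j. i < n \<Longrightarrow> j < n \<Longrightarrow> H i j = H j i"
  shows "(\<Sum>i<n. \<Sum>j<n. cnj (v i) * of_real (H i j) * v j)
    = of_real (quad n H (\<lambda>i. Re (v i)) + quad n H (\<lambda>i. Im (v i)))"
proof (rule complex_eqI)
  show "Re (\<Sum>i<n. \<Sum>j<n. cnj (v i) * of_real (H i j) * v j) = Re (of_real
     (quad n H (\<lambda>i. Re (v i)) + quad n H (\<lambda>i. Im (v i))))"
    by (simp add: sum.distrib)
  have "Im (\<Sum>i<n. \<Sum>j<n. cnj (v i) * of_real (H i j) * v j)
     = (\<Sum>i<n. \<Sum>j<n. Re (v i) * H i j * Im (v j)) - (\<Sum>i<n. \<Sum>j<n. Im (v i) * H i j * Re (v j))"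
    by (simp add: sum_subtractf sum.distrib sum_negf)
  also have "(\<Sum>i<n. \<Sum>j<n. Im (v i) * H i j * Re (v j)) = (\<Sum>i<n. \<Sum>j<n. Re (v i) * H i j * Im (v j))"
    by (subst sum.swap) (use assms in \<open>auto intro!: sum.cong\<close>)
  finally show "Im (\<Sum>i<n. \<Sum>j<n. cnj (v i) * of_real (H i j) * v j) = Im (of_real
     (quad n H (\<lambda>i. Re (v i)) + quad n H (\<lambda>i. Im (v i))))"
    by simp
qed

lemma hermitian_form_factor:
  fixes H :: "nat \<Rightarrow> nat \<Rightarrow> real" and W :: "nat \<Rightarrow> nat \<Rightarrow> complex"
  assumes "\<And>i j. i < n \<Longrightarrow> j < n \<Longrightarrow> of_real (H i j) = (\<Sum>k<n. cnj (W k i) * of_real (x k) * W k j)"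
  shows "(\<Sum>i<n. \<Sum>j<n. cnj (v i) * of_real (H i j) * v j)
    = of_real (\<Sum>k<n. x k * (cmod (\<Sum>j<n. W k j * v j))\<^sup>2)"
proof -
  have "(\<Sum>i<n. \<Sum>j<n. cnj (v i) * of_real (H i j) * v j)
    = (\<Sum>i<n. \<Sum>j<n. \<Sum>k<n. cnj (v i) * (cnj (W k i) * of_real (x k) * W k j) * v j)"
    by (intro sum.cong refl) (simp add: assms sum_distrib_left sum_distrib_right)
  also have "\<dots> = (\<Sum>k<n. \<Sum>i<n. \<Sum>j<n. cnj (v i) * (cnj (W k i) * of_real (x k) * W k j) * v j)"
    by (rule trans[OF sum.cong[OF refl sum.swap] sum.swap])
  also have "\<dots> = (\<Sum>k<n. of_real (x k) * (cnj (\<Sum>i<n. W k i * v i) * (\<Sum>j<n. W k j * v j)))"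
    unfolding cnj_sum sum_product by (simp add: sum_distrib_left mult_ac)
  also have "\<dots> = of_real (\<Sum>k<n. x k * (cmod (\<Sum>j<n. W k j * v j))\<^sup>2)"
    unfolding mult.commute[of "cnj _"] complex_norm_square[symmetric] by simp
  finally show ?thesis .
qed

text \<open>A positive definite G is R^H R with R invertible. In the coordinates given by R it
  becomes the identity, which survives the further unitary change that diagonalizes H. The
  \<open>x k\<close> are the eigenvalues of H relative to G, so 0 \<le> H \<le> G puts them into
  [0, 1].\<close>

lemma simultaneous_diagonalization:
  fixes G H :: "nat \<Rightarrow> nat \<Rightarrow> real"
  assumes sym: "\<And>i j. i < n \<Longrightarrow> j < n \<Longrightarrow> G i j = G j i" "\<And>i j. i < n \<Longrightarrow> j < n \<Longrightarrow> H i j = H j i"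
    and H: "\<And>a. 0 \<le> quad n H a"
    and GH: "\<And>a. quad n H a \<le> quad n G a"
    and G: "\<And>a k. k < n \<Longrightarrow> a k \<noteq> 0 \<Longrightarrow> 0 < quad n G a"
  obtains W W' :: "nat \<Rightarrow> nat \<Rightarrow> complex" and x :: "nat \<Rightarrow> real"
  where "\<And>k. k < n \<Longrightarrow> 0 \<le> x k \<and> x k \<le> 1"
    "\<And>k l. k < n \<Longrightarrow> l < n \<Longrightarrow> (\<Sum>i<n. W k i * W' i l) = (if k = l then 1 else 0)"
    "\<And>i j. i < n \<Longrightarrow> j < n \<Longrightarrow> of_real (G i j) = (\<Sum>k<n. cnj (W k i) * W k j)"
    "\<And>i j. i < n \<Longrightarrow> j < n \<Longrightarrow> of_real (H i j) = (\<Sum>k<n. cnj (W k i) * of_real (x k) * W k j)"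
proof -
  define Gm where "Gm = mat n n (\<lambda>(i,j). complex_of_real (G i j))"
  define Hm where "Hm = mat n n (\<lambda>(i,j). complex_of_real (H i j))"
  have c1: "Gm \<in> carrier_mat n n" "Hm \<in> carrier_mat n n" by (auto simp: Gm_def Hm_def)
  have adjG: "mat_adjoint Gm = Gm" and adjH: "mat_adjoint Hm = Hm"
    by (rule eq_matI; auto simp: Gm_def Hm_def sym)+
  obtain U D where UD: "diagonalizes n U D Gm"
    using hermitian_diagonalizable[OF c1(1) adjG] by blast
  have Uc: "U \<in> carrier_mat n n" and U1: "mat_adjoint U * U = 1\<^sub>m n" and U2: "U * mat_adjoint U = 1\<^sub>m n"
    and GU: "Gm = U * real_diag n D * mat_adjoint U"
    using UD by (auto simp: diagonalizes_def unitary_mat_def)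
  have Dpos: "D k > 0" if k: "k < n" for k
  proof -
    define v where "v = (\<lambda>i. U $$ (i,k))"
    have e: "(\<Sum>j<n. cnj (U $$ (j,l)) * v j) = (if l = k then 1 else 0)" if "l < n" for l
      using index_adjoint_mult[OF Uc Uc that k] U1 that k by (simp add: v_def)
    have "(\<Sum>i<n. \<Sum>j<n. cnj (v i) * of_real (G i j) * v j)
       = of_real (\<Sum>l<n. D l * (cmod (\<Sum>j<n. cnj (U $$ (j,l)) * v j))\<^sup>2)"
    proof (rule hermitian_form_factor)
      fix i j assume "i < n" "j < n"
      then have "of_real (G i j) = Gm $$ (i,j)"
         "Gm $$ (i,j) = (\<Sum>l<n. U $$ (i,l) * of_real (D l) * cnj (U $$ (j,l)))"
        using index_diagonalized[OF Uc, of i j D] unfolding GU by (auto simp: GU[symmetric] Gm_def)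
      then show "of_real (G i j) = (\<Sum>l<n. cnj (cnj (U $$ (i,l))) * of_real (D l) * cnj (U $$ (j,l)))"
        by simp
    qed
    also have "(\<Sum>l<n. D l * (cmod (\<Sum>j<n. cnj (U $$ (j,l)) * v j))\<^sup>2) = (\<Sum>l<n. if l = k then D k else 0)"
      by (intro sum.cong refl) (simp add: e)
    also have "\<dots> = D k" using k by simp
    finally have e1: "(\<Sum>i<n. \<Sum>j<n. cnj (v i) * of_real (G i j) * v j) = of_real (D k)" .
    have "complex_of_real (D k) = of_real (quad n G (\<lambda>i. Re (v i)) + quad n G (\<lambda>i. Im (v i)))"
      unfolding e1[symmetric] by (rule hermitian_form_real) (rule sym(1))
    then have eq: "D k = quad n G (\<lambda>i. Re (v i)) + quad n G (\<lambda>i. Im (v i))"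
      unfolding of_real_eq_iff .
    have ge: "0 \<le> quad n G a" for a
      using H[of a] GH[of a] by simp
    obtain i where i: "i < n" "v i \<noteq> 0"
      using e[OF k] by (metis (no_types, lifting) lessThan_iff mult_zero_right sum.neutral zero_neq_one)
    then have "Re (v i) \<noteq> 0 \<or> Im (v i) \<noteq> 0" by (auto simp: complex_eq_iff)
    then show ?thesis unfolding eq
      using G[OF i(1), of "\<lambda>i. Re (v i)"] G[OF i(1), of "\<lambda>i. Im (v i)"] ge[of "\<lambda>i. Re (v i)"] ge[of "\<lambda>i. Im (v i)"]
      by linarith
  qed
  \<comment> \<open>\<open>R\<close> is a square root of G up to a unitary factor and
    \<open>S\<close> is its inverse; \<open>M\<close> below is H in the coordinates in which G is
    the identity.\<close>
  define R where "R = real_diag n (\<lambda>k. sqrt (D k)) * mat_adjoint U"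
  define S where "S = U * real_diag n (\<lambda>k. 1 / sqrt (D k))"
  have dc: "real_diag n a \<in> carrier_mat n n" for a by (rule real_diag_carrier)
  have ac: "mat_adjoint A \<in> carrier_mat n n" if "A \<in> carrier_mat n n" for A :: "complex mat"
    using that by (rule mat_adjoint_carrier)
  note as = assoc_mult_mat[of _ n n _ n _ n]
  note adj = mat_adjoint_mult[of _ n n _ n]
  have m: "X * Y \<in> carrier_mat n n" if "X \<in> carrier_mat n n" "Y \<in> carrier_mat n n" for X Y :: "complex mat"
    using that by simp
  have Rc: "R \<in> carrier_mat n n" and Sc: "S \<in> carrier_mat n n"
    unfolding R_def S_def using Uc dc ac by (auto intro: m)
  have d1: "real_diag n (\<lambda>k. sqrt (D k)) * real_diag n (\<lambda>k. 1 / sqrt (D k)) = 1\<^sub>m n"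
       "real_diag n (\<lambda>k. 1 / sqrt (D k)) * real_diag n (\<lambda>k. sqrt (D k)) = 1\<^sub>m n"
    unfolding real_diag_mult using Dpos
    by (intro eq_matI; auto simp: real_diag_def mat_diag_def order_less_imp_not_eq2)+
  have d2: "real_diag n (\<lambda>k. sqrt (D k)) * real_diag n (\<lambda>k. sqrt (D k)) = real_diag n D"
    unfolding real_diag_mult using Dpos
    by (intro eq_matI) (auto simp: real_diag_def mat_diag_def order_less_imp_le simp flip: of_real_mult)
  have SR: "S * R = 1\<^sub>m n"
  proof -
    have "S * R = U * ((real_diag n (\<lambda>k. 1 / sqrt (D k)) * real_diag n (\<lambda>k. sqrt (D k))) * mat_adjoint U)"
      unfolding R_def S_def using Uc dc ac by (simp add: as m)
    then show ?thesis using Uc ac by (simp add: d1 U2)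
  qed
  have RS: "R * S = 1\<^sub>m n"
    using mat_mult_left_right_inverse[OF Sc Rc SR] .
  have RR: "mat_adjoint R * R = Gm"
  proof -
    have "mat_adjoint R * R = U * ((real_diag n (\<lambda>k. sqrt (D k)) * real_diag n (\<lambda>k. sqrt (D k))) * mat_adjoint U)"
      unfolding R_def using Uc dc ac by (simp add: as m adj)
    then show ?thesis using Uc dc ac by (simp add: d2 GU as)
  qed
  define M where "M = mat_adjoint S * (Hm * S)"
  have Mc: "M \<in> carrier_mat n n" unfolding M_def using Sc c1 ac by (auto intro: m)
  have "mat_adjoint M = M"
    unfolding M_def using Sc c1 ac by (simp add: adj as m adjH)
  then obtain V x where Vx: "diagonalizes n V x M" using hermitian_diagonalizable[OF Mc] by blast
  have Vc: "V \<in> carrier_mat n n" and V1: "mat_adjoint V * V = 1\<^sub>m n" and V2: "V * mat_adjoint V = 1\<^sub>m n"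
    and MV: "M = V * real_diag n x * mat_adjoint V"
    using Vx by (auto simp: diagonalizes_def unitary_mat_def)
  have HR: "Hm = mat_adjoint R * (M * R)"
  proof -
    have "mat_adjoint R * (M * R) = (mat_adjoint R * mat_adjoint S) * (Hm * (S * R))"
      unfolding M_def using Sc Rc c1 ac by (simp add: as m)
    also have "mat_adjoint R * mat_adjoint S = mat_adjoint (S * R)" using Sc Rc by (simp add: adj)
    finally show ?thesis using c1 by (simp add: SR)
  qed
  define W where "W = mat_adjoint V * R"
  define W' where "W' = S * V"
  have Wc: "W \<in> carrier_mat n n" and W'c: "W' \<in> carrier_mat n n"
    unfolding W_def W'_def using Sc Rc Vc ac by (auto intro: m)
  have adjW: "mat_adjoint W = mat_adjoint R * V"
    unfolding W_def using Rc Vc ac by (simp add: adj)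
  have WW': "W * W' = 1\<^sub>m n"
  proof -
    have "W * W' = mat_adjoint V * ((R * S) * V)"
      unfolding W_def W'_def using Sc Rc Vc ac by (simp add: as m)
    then show ?thesis using Vc by (simp add: RS V1)
  qed
  have WW: "mat_adjoint W * W = Gm"
  proof -
    have "mat_adjoint W * W = mat_adjoint R * ((V * mat_adjoint V) * R)"
      unfolding adjW unfolding W_def using Rc Vc ac by (simp add: as m)
    then show ?thesis using Rc by (simp add: V2 RR)
  qed
  have WxW: "mat_adjoint W * real_diag n x * mat_adjoint (mat_adjoint W) = Hm"
  proof -
    have "mat_adjoint W * real_diag n x * mat_adjoint (mat_adjoint W) = mat_adjoint R * ((V * real_diag n x * mat_adjoint V) * R)"
      unfolding mat_adjoint_adjoint unfolding adjW unfolding W_def using Rc Vc ac dc by (simp add: as m)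
    then show ?thesis using HR MV by simp
  qed
  define w where "w = (\<lambda>k i. W $$ (k,i))"
  define w' where "w' = (\<lambda>k i. W' $$ (k,i))"
  have r1: "(\<Sum>i<n. w k i * w' i l) = (if k = l then 1 else 0)" if "k < n" "l < n" for k l
    using arg_cong[OF WW', of "\<lambda>M. M $$ (k,l)"] that Wc W'c
    by (auto simp: scalar_prod_def atLeast0LessThan w_def w'_def)
  have r2: "of_real (G i j) = (\<Sum>k<n. cnj (w k i) * w k j)" if "i < n" "j < n" for i j
    using index_adjoint_mult[OF Wc Wc that] WW that by (simp add: Gm_def w_def)
  have r3: "of_real (H i j) = (\<Sum>k<n. cnj (w k i) * of_real (x k) * w k j)" if "i < n" "j < n" for i j
  proof -
    have "Hm $$ (i,j) = (\<Sum>k<n. mat_adjoint W $$ (i,k) * of_real (x k) * cnj (mat_adjoint W $$ (j,k)))"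
      unfolding WxW[symmetric] by (rule index_diagonalized[OF ac[OF Wc] that])
    then show ?thesis using that Wc by (simp add: Hm_def w_def)
  qed
  have r4: "0 \<le> x k \<and> x k \<le> 1" if k: "k < n" for k
  proof -
    \<comment> \<open>Column k of \<open>W'\<close>, the inverse of \<open>W\<close>, is mapped by
      \<open>W\<close> to the k-th unit vector. There the form of H has the value \<open>x k\<close>
      and that of G the value 1.\<close>
    define v where "v = (\<lambda>i. w' i k)"
    have "(\<Sum>l<n. y l * (cmod (\<Sum>j<n. w l j * v j))\<^sup>2) = (\<Sum>l<n. if l = k then y l else 0)" for y
      by (intro sum.cong refl) (simp add: v_def r1 k)
    then have *: "(\<Sum>l<n. y l * (cmod (\<Sum>j<n. w l j * v j))\<^sup>2) = y k" for y
      using k by simp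
    have real: "quad n K (\<lambda>i. Re (v i)) + quad n K (\<lambda>i. Im (v i)) = y k"
      if K: "\<And>i j. i < n \<Longrightarrow> j < n \<Longrightarrow> K i j = K j i"
        "\<And>i j. i < n \<Longrightarrow> j < n \<Longrightarrow> of_real (K i j) = (\<Sum>k<n. cnj (w k i) * of_real (y k) * w k j)" for K y
    proof -
      have "complex_of_real (quad n K (\<lambda>i. Re (v i)) + quad n K (\<lambda>i. Im (v i)))
          = (\<Sum>i<n. \<Sum>j<n. cnj (v i) * of_real (K i j) * v j)"
        by (rule hermitian_form_real[symmetric]) (rule K(1))
      also have "\<dots> = of_real (y k)"
        unfolding *[symmetric] by (rule hermitian_form_factor) (rule K(2))
      finally show ?thesis unfolding of_real_eq_iff .
    qed
    have hx: "quad n H (\<lambda>i. Re (v i)) + quad n H (\<lambda>i. Im (v i)) = x k"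
      by (rule real[of H x, OF sym(2) r3])
    have gx: "quad n G (\<lambda>i. Re (v i)) + quad n G (\<lambda>i. Im (v i)) = 1"
      by (rule real[of G "\<lambda>_. 1", OF sym(1)]) (simp_all add: r2)
    show ?thesis
      using H[of "\<lambda>i. Re (v i)"] H[of "\<lambda>i. Im (v i)"] GH[of "\<lambda>i. Re (v i)"] GH[of "\<lambda>i. Im (v i)"] hx gx by linarith
  qed
  show ?thesis using that[of x w w'] r1 r2 r3 r4 by blast
qed


text \<open>The nodes are \<open>(x\<^sub>k - 1) / x\<^sub>k\<close>, kept in homogeneous form because \<open>x\<^sub>k = 0\<close> (a node at infinity) can occur.\<close>

lemma hankel_quadrature:
  fixes c :: "nat \<Rightarrow> real"
  assumes n: "n \<ge> 1"
    and H: "\<And>a. quad n (\<lambda>i j. c (i + j)) a \<le> 0"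
    and K: "\<And>a. 0 \<le> (\<Sum>i<n. \<Sum>j<n. a i * c (i + j + 1) * a j)"
    and G: "\<And>a k. k < n \<Longrightarrow> a k \<noteq> 0 \<Longrightarrow> 0 < (\<Sum>i<n. \<Sum>j<n. a i * (c (i + j + 1) - c (i + j)) * a j)"
  obtains x w :: "nat \<Rightarrow> real" where "\<And>k. k < n \<Longrightarrow> 0 \<le> x k \<and> x k \<le> 1" "\<And>k. w k \<ge> 0"
    "\<And>m. m \<le> 2 * n - 1 \<Longrightarrow> c m = - (\<Sum>k<n. w k * ((x k - 1) ^ m * x k ^ (2 * n - 1 - m)))"
proof -
  \<comment> \<open>With K the form of c(i + j + 1) one has \<open>?G\<close> = K +
    \<open>?H\<close>. So 0 \<le> \<open>?H\<close> \<le> \<open>?G\<close>, and relative to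
    \<open>?G\<close> the eigenvalues of K are 1 - x_k.\<close>
  let ?G = "\<lambda>i j. c (i + j + 1) - c (i + j)" and ?H = "\<lambda>i j. - c (i + j)"
  have GHK: "quad n ?G a
     = (\<Sum>i<n. \<Sum>j<n. a i * c (i + j + 1) * a j) + quad n ?H a" for a :: "nat \<Rightarrow> real"
    by (simp add: algebra_simps sum.distrib sum_subtractf sum_negf)
  have Hneg: "quad n ?H a = - quad n (\<lambda>i j. c (i + j)) a" for a :: "nat \<Rightarrow> real"
    by (simp add: sum_negf)
  obtain W W' :: "nat \<Rightarrow> nat \<Rightarrow> complex" and x where
    x: "\<And>k. k < n \<Longrightarrow> 0 \<le> x k \<and> x k \<le> 1"
    and WW': "\<And>k l. k < n \<Longrightarrow> l < n \<Longrightarrow> (\<Sum>i<n. W k i * W' i l) = (if k = l then 1 else 0)"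
    and WG: "\<And>i j. i < n \<Longrightarrow> j < n \<Longrightarrow> of_real (?G i j) = (\<Sum>k<n. cnj (W k i) * W k j)"
    and WH: "\<And>i j. i < n \<Longrightarrow> j < n \<Longrightarrow> of_real (?H i j) = (\<Sum>k<n. cnj (W k i) * of_real (x k) * W k j)"
  proof (rule simultaneous_diagonalization[of n ?G ?H])
    fix a :: "nat \<Rightarrow> real" and k
    show "0 \<le> quad n ?H a"
      using H[of a] unfolding Hneg by simp
    show "quad n ?H a \<le> quad n ?G a"
      using K[of a] unfolding GHK by simp
    show "k < n \<Longrightarrow> a k \<noteq> 0 \<Longrightarrow> 0 < quad n ?G a" by (rule G)
  qed (auto simp: add.commute)
  have WK: "of_real (c (i + j + 1)) = (\<Sum>k<n. cnj (W k i) * of_real (1 - x k) * W k j)" if "i < n" "j < n" for i j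
  proof -
    have "complex_of_real (c (i + j + 1)) = of_real (?G i j) - of_real (?H i j)" by simp
    also have "\<dots> = (\<Sum>k<n. cnj (W k i) * of_real (1 - x k) * W k j)"
      unfolding WG[OF that] WH[OF that] by (simp add: sum_subtractf[symmetric] algebra_simps)
    finally show ?thesis .
  qed
  have inj: "z l = 0" if z: "\<And>i. i < n \<Longrightarrow> (\<Sum>k<n. cnj (W k i) * z k) = 0" and l: "l < n" for z l
  proof -
    have "(\<Sum>i<n. cnj (W' i l) * (\<Sum>k<n. cnj (W k i) * z k)) = (\<Sum>i<n. \<Sum>k<n. cnj (W k i * W' i l) * z k)"
      by (simp add: sum_distrib_left mult_ac)
    also have "\<dots> = (\<Sum>k<n. cnj (\<Sum>i<n. W k i * W' i l) * z k)"
      by (subst sum.swap) (simp add: sum_distrib_right)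
    also have "\<dots> = (\<Sum>k<n. if k = l then z k else 0)"
      using l by (intro sum.cong refl) (auto simp: WW')
    also have "\<dots> = z l" using l by simp
    finally show ?thesis using z by simp
  qed
  \<comment> \<open>The Hankel structure: column i of K is minus column i + 1 of \<open>?H\<close>.
    Cancelling the invertible \<open>W\<close> leaves a two-term recursion, so each row of
    \<open>W\<close> is a geometric progression of ratio (x_k - 1) / x_k.\<close>
  have shift: "of_real (1 - x k) * W k i + of_real (x k) * W k (Suc i) = 0" if i: "Suc i < n" and k: "k < n" for i k
  proof (rule inj[OF _ k])
    fix j assume j: "j < n"
    have "(\<Sum>k<n. cnj (W k j) * (of_real (1 - x k) * W k i + of_real (x k) * W k (Suc i)))
       = (\<Sum>k<n. cnj (W k j) * of_real (1 - x k) * W k i) + (\<Sum>k<n. cnj (W k j) * of_real (x k) * W k (Suc i))"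
      by (simp add: algebra_simps sum.distrib sum_subtractf)
    also have "\<dots> = of_real (c (j + i + 1)) + of_real (- c (j + Suc i))"
      using i j by (simp only: WK WH Suc_lessD)
    finally show "(\<Sum>k<n. cnj (W k j) * (of_real (1 - x k) * W k i + of_real (x k) * W k (Suc i))) = 0"
      by simp
  qed
  \<comment> \<open>For x_k = 0 the recursion forces all entries of the row but the last to vanish;
    the sign compensates (x_k - 1)^(n - 1). Otherwise the row is determined by its first
    entry.\<close>
  define t where "t = (\<lambda>k. if x k = 0 then (-1) ^ (n - 1) * W k (n - 1) else W k 0 / of_real (x k) ^ (n - 1))"
  have Wt: "W k i = of_real ((x k - 1) ^ i * x k ^ (n - 1 - i)) * t k" if "k < n" "i < n" for k i
  proof (cases "x k = 0")
    case True
    show ?thesis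
    proof (cases "i = n - 1")
      case True
      then show ?thesis using \<open>x k = 0\<close> by (simp add: t_def flip: mult.assoc power_mult_distrib)
    next
      case False
      then have i: "Suc i < n" using that n by auto
      from shift[OF i \<open>k < n\<close>] show ?thesis using True False that i by simp
    qed
  next
    case False
    show ?thesis using \<open>i < n\<close>
    proof (induction i)
      case 0
      then show ?case using False by (simp add: t_def)
    next
      case (Suc i)
      have e: "n - 1 - i = Suc (n - 1 - Suc i)" using Suc.prems by auto
      have "of_real (x k) * W k (Suc i) = of_real (x k - 1) * W k i"
        using shift[OF Suc.prems \<open>k < n\<close>] by (simp add: algebra_simps add_eq_0_iff2)
      also have "\<dots> = of_real (x k) * (of_real ((x k - 1) ^ Suc i * x k ^ (n - 1 - Suc i)) * t k)"
        using Suc unfolding e by simp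
      finally show ?case using False by simp
    qed
  qed
  define w where "w = (\<lambda>k. (cmod (t k))\<^sup>2)"
  have tt: "cnj (t k) * t k = of_real (w k)" for k
    unfolding w_def complex_norm_square by simp
  have "c m = - (\<Sum>k<n. w k * ((x k - 1) ^ m * x k ^ (2 * n - 1 - m)))" if m: "m \<le> 2 * n - 1" for m
  \<comment> \<open>The matrix \<open>?H\<close> contains the moments up to 2 n - 2 only, so the
    last one is read off the corner of K. The extra factor, x_k from \<open>?H\<close> or 1 - x_k
    from K, makes the total degree 2 n - 1 in both cases.\<close>
  proof (cases "m = 2 * n - 1")
    case True
    have e: "n - 1 + (n - 1) + 1 = m" using True n by auto
    have "complex_of_real (c m) = (\<Sum>k<n. cnj (W k (n - 1)) * of_real (1 - x k) * W k (n - 1))"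
      using WK[of "n - 1" "n - 1"] n unfolding e by simp
    also have "\<dots> = (\<Sum>k<n. of_real (- (w k * ((x k - 1) ^ m * x k ^ (2 * n - 1 - m)))))"
    proof (intro sum.cong refl)
      fix k assume "k \<in> {..<n}"
      then have "cnj (W k (n - 1)) * of_real (1 - x k) * W k (n - 1)
        = of_real ((x k - 1) ^ (n - 1) * (x k - 1) ^ (n - 1) * (1 - x k)) * (cnj (t k) * t k)"
        using n Wt[of k "n - 1"] by (simp add: mult_ac)
      also have "(x k - 1) ^ (n - 1) * (x k - 1) ^ (n - 1) * (1 - x k) = - ((x k - 1) ^ m * x k ^ (2 * n - 1 - m))"
        using True unfolding e[symmetric] power_add by (simp add: algebra_simps)
      finally show "cnj (W k (n - 1)) * of_real (1 - x k) * W k (n - 1)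
          = of_real (- (w k * ((x k - 1) ^ m * x k ^ (2 * n - 1 - m))))"
        unfolding tt by (simp add: mult_ac)
    qed
    also have "\<dots> = of_real (- (\<Sum>k<n. w k * ((x k - 1) ^ m * x k ^ (2 * n - 1 - m))))"
      by (simp only: of_real_sum sum_negf[symmetric])
    finally show ?thesis unfolding of_real_eq_iff .
  next
    case False
    define i where "i = min m (n - 1)"
    define j where "j = m - i"
    have ij: "i < n" "j < n" "i + j = m" using False m n by (auto simp: i_def j_def)
    have "complex_of_real (- c m) = (\<Sum>k<n. cnj (W k i) * of_real (x k) * W k j)"
      using WH[OF ij(1,2)] unfolding ij(3) .
    also have "\<dots> = (\<Sum>k<n. of_real (w k * ((x k - 1) ^ m * x k ^ (2 * n - 1 - m))))"
    proof (intro sum.cong refl)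
      fix k assume "k \<in> {..<n}"
      then have "cnj (W k i) * of_real (x k) * W k j
        = of_real (((x k - 1) ^ i * (x k - 1) ^ j) * (x k ^ (n - 1 - i) * x k ^ (n - 1 - j) * x k)) * (cnj (t k) * t k)"
        using ij Wt[of k i] Wt[of k j] by (simp add: mult_ac)
      also have "((x k - 1) ^ i * (x k - 1) ^ j) = (x k - 1) ^ m"
        unfolding ij(3)[symmetric] power_add ..
      also have "x k ^ (n - 1 - i) * x k ^ (n - 1 - j) * x k = x k ^ (n - 1 - i + (n - 1 - j) + 1)"
        by (simp only: power_add power_one_right)
      also have "n - 1 - i + (n - 1 - j) + 1 = 2 * n - 1 - m" using ij n by auto
      finally show "cnj (W k i) * of_real (x k) * W k j = of_real (w k * ((x k - 1) ^ m * x k ^ (2 * n - 1 - m)))"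
        unfolding tt by (simp add: mult_ac)
    qed
    also have "\<dots> = of_real (\<Sum>k<n. w k * ((x k - 1) ^ m * x k ^ (2 * n - 1 - m)))"
      by (simp only: of_real_sum)
    finally have "- c m = (\<Sum>k<n. w k * ((x k - 1) ^ m * x k ^ (2 * n - 1 - m)))" unfolding of_real_eq_iff .
    then show ?thesis by simp
  qed
  then show ?thesis using that[of x w] x by (simp add: w_def)
qed


section \<open>From moments to interpolation\<close>

lemma hankel_form_discrete:
  fixes u y :: "'a \<Rightarrow> real"
  shows "(\<Sum>i<n. \<Sum>j<n. a i * (\<Sum>s\<in>S. u s * y s ^ (i + j)) * a j) = (\<Sum>s\<in>S. u s * (\<Sum>i<n. a i * y s ^ i)\<^sup>2)"
    "(\<Sum>i<n. \<Sum>j<n. a i * (\<Sum>s\<in>S. u s * y s ^ (i + j + 1)) * a j) = (\<Sum>s\<in>S. u s * y s * (\<Sum>i<n. a i * y s ^ i)\<^sup>2)"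
proof -
  have *: "(\<Sum>i<n. \<Sum>j<n. a i * (\<Sum>s\<in>S. v s * y s ^ (i + j)) * a j) = (\<Sum>s\<in>S. v s * (\<Sum>i<n. a i * y s ^ i)\<^sup>2)" for v
  proof -
    have "(\<Sum>i<n. \<Sum>j<n. a i * (\<Sum>s\<in>S. v s * y s ^ (i + j)) * a j)
       = (\<Sum>i<n. \<Sum>j<n. \<Sum>s\<in>S. v s * ((a i * y s ^ i) * (a j * y s ^ j)))"
      by (intro sum.cong refl) (simp add: sum_distrib_left sum_distrib_right power_add mult_ac)
    also have "\<dots> = (\<Sum>s\<in>S. \<Sum>i<n. \<Sum>j<n. v s * ((a i * y s ^ i) * (a j * y s ^ j)))"
      by (rule trans[OF sum.cong[OF refl sum.swap] sum.swap])
    also have "\<dots> = (\<Sum>s\<in>S. v s * (\<Sum>i<n. a i * y s ^ i)\<^sup>2)"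
      unfolding power2_eq_square sum_product by (simp add: sum_distrib_left)
    finally show ?thesis .
  qed
  show "(\<Sum>i<n. \<Sum>j<n. a i * (\<Sum>s\<in>S. u s * y s ^ (i + j)) * a j) = (\<Sum>s\<in>S. u s * (\<Sum>i<n. a i * y s ^ i)\<^sup>2)"
    by (rule *)
  show "(\<Sum>i<n. \<Sum>j<n. a i * (\<Sum>s\<in>S. u s * y s ^ (i + j + 1)) * a j) = (\<Sum>s\<in>S. u s * y s * (\<Sum>i<n. a i * y s ^ i)\<^sup>2)"
    using *[of "\<lambda>s. u s * y s"] by (simp add: mult_ac)
qed

text \<open>For b \<noteq> 0 both sides are b^(card S) times the value of the node polynomial at a /
  b; for b = 0 only the leading term survives. The second case evaluates the polynomial at a
  quadrature node at infinity.\<close>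

lemma homogenized_linear_factors:
  fixes a b :: real
  assumes S: "finite S"
  shows "(\<Sum>m\<le>card S. poly.coeff (\<Prod>s\<in>S. [:-s, 1:]) m * (a ^ m * b ^ (card S - m))) = (\<Prod>s\<in>S. a - s * b)"
proof -
  let ?R = "\<Prod>s\<in>S. [:-s, 1:]"
  have deg: "degree ?R = card S" using S by (subst degree_prod_eq_sum_degree) auto
  have lead: "poly.coeff ?R (card S) = 1"
    using lead_coeff_prod[of "\<lambda>s. [:-s, 1:]" S] unfolding deg by simp
  show ?thesis
  proof (cases "b = 0")
    case True
    have "(\<Sum>m\<le>card S. poly.coeff ?R m * (a ^ m * b ^ (card S - m))) = (\<Sum>m\<le>card S. if m = card S then a ^ card S else 0)"
      using True lead by (intro sum.cong refl) auto
    then show ?thesis using True by simp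
  next
    case False
    have "(\<Sum>m\<le>card S. poly.coeff ?R m * (a ^ m * b ^ (card S - m))) = (\<Sum>m\<le>card S. b ^ card S * (poly.coeff ?R m * (a / b) ^ m))"
      using False by (intro sum.cong refl) (simp add: power_diff power_divide)
    also have "\<dots> = b ^ card S * poly ?R (a / b)"
      by (simp add: poly_altdef deg sum_distrib_left)
    also have "\<dots> = (\<Prod>s\<in>S. b * (a / b - s))"
      by (simp add: poly_prod prod.distrib)
    also have "\<dots> = (\<Prod>s\<in>S. a - s * b)"
      using False by (intro prod.cong refl) (simp add: field_simps)
    finally show ?thesis .
  qed
qed

lemma prod_neg_odd:
  fixes g :: "'a \<Rightarrow> real"
  assumes "odd (card S)"
  shows "(\<Prod>s\<in>S. - g s) = - (\<Prod>s\<in>S. g s)"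
  using assms by (simp add: prod_uminus)

text \<open>The moments are perturbed by point masses at \<open>-1, \<dots>, -n\<close> to make the Hankel form definite.\<close>

lemma operator_monotone_cone_approximation:
  assumes f: "form_monotone {0..} f" and f0: "f 0 \<ge> 0"
    and T: "finite T" "T \<subseteq> {0<..}" "card T = 2 * n" and n: "n \<ge> 1" and \<epsilon>: "\<epsilon> > 0"
  obtains x m :: "nat \<Rightarrow> real" where "\<And>k. k < n \<Longrightarrow> 0 \<le> x k \<and> x k \<le> 1" "\<And>k. k < n \<Longrightarrow> m k \<ge> 0"
    "\<And>t. t \<in> T \<Longrightarrow> \<bar>f t - (\<Sum>k<n. m k * (t / (1 - x k + x k * t)))\<bar> < \<epsilon>"
proof -
  \<comment> \<open>These are the divided-difference weights of f(t) / t. The Hankel form of their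
    moments is a divided difference of p^2 f(t) / t, hence non-positive; shifted by one it is a
    divided difference of p^2 f, hence non-negative.\<close>
  define u where "u = (\<lambda>t. f t / t / (\<Prod>s\<in>T-{t}. t - s))"
  define \<eta> where "\<eta> = (\<lambda>t. \<Sum>k\<in>{1..n}. \<Prod>s\<in>T-{t}. real k + s)"
  have \<eta>0: "0 \<le> \<eta> t" for t
    unfolding \<eta>_def using T by (intro sum_nonneg prod_nonneg) (auto intro!: add_nonneg_nonneg less_imp_le)
  \<comment> \<open>\<open>\<eta> t\<close> measures how much the point masses disturb the
    interpolated value at t; \<delta> is so small that every disturbance t \<delta> \<eta>(t) stays
    below \<epsilon>.\<close>
  define \<delta> where "\<delta> = \<epsilon> / (1 + (\<Sum>t\<in>T. t * \<eta> t))"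
  have s0: "0 \<le> (\<Sum>t\<in>T. t * \<eta> t)" using T \<eta>0 by (intro sum_nonneg mult_nonneg_nonneg) auto
  have \<delta>: "\<delta> > 0" using \<epsilon> s0 by (simp add: \<delta>_def)
  have \<delta>\<eta>: "t * (\<delta> * \<eta> t) < \<epsilon>" if "t \<in> T" for t
  proof -
    have "t * \<eta> t \<le> (\<Sum>t\<in>T. t * \<eta> t)" using T that \<eta>0 by (intro member_le_sum) auto
    then have "\<epsilon> * (t * \<eta> t) < \<epsilon> * (1 + (\<Sum>t\<in>T. t * \<eta> t))" using \<epsilon> by simp
    then show ?thesis using s0 by (simp add: \<delta>_def field_simps)
  qed
  \<comment> \<open>Subtracting a positive mass at a negative point lowers the form of the moments
    and raises the shifted form, so both signs persist.\<close>
  define c where "c = (\<lambda>m. (\<Sum>t\<in>T. u t * t ^ m) - (\<Sum>k\<in>{1..n}. \<delta> * (- real k) ^ m))"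
  define q where "q = (\<lambda>a t. \<Sum>i<n. a i * t ^ i :: real)"
  define p where "p = (\<lambda>a. \<Sum>i<n. Polynomial.monom (a i) i :: real poly)"
  have pq: "poly (p a) t = q a t" for a t
    by (simp add: p_def q_def poly_sum poly_monom)
  have dp: "degree (p a) < n" for a
    unfolding p_def using n by (intro degree_sum_less) (auto intro: le_less_trans[OF degree_monom_le])
  have C0: "quad n (\<lambda>i j. c (i + j)) a = (\<Sum>t\<in>T. u t * (q a t)\<^sup>2) - (\<Sum>k\<in>{1..n}. \<delta> * (q a (- real k))\<^sup>2)" for a
    unfolding c_def q_def hankel_form_discrete(1)[symmetric]
    by (simp add: right_diff_distrib left_diff_distrib sum_subtractf)
  have C1: "(\<Sum>i<n. \<Sum>j<n. a i * c (i + j + 1) * a j) = (\<Sum>t\<in>T. u t * t * (q a t)\<^sup>2) - (\<Sum>k\<in>{1..n}. \<delta> * (- real k) * (q a (- real k))\<^sup>2)" for a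
    unfolding c_def q_def hankel_form_discrete(2)[symmetric]
    by (simp only: right_diff_distrib left_diff_distrib sum_subtractf)
  have U0: "(\<Sum>t\<in>T. u t * (q a t)\<^sup>2) \<le> 0" for a
    using divided_diff_quotient_nonpos[OF f f0 T dp[of a]] by (simp add: divided_diff_def u_def pq mult_ac)
  have U1: "0 \<le> (\<Sum>t\<in>T. u t * t * (q a t)\<^sup>2)" for a
  proof -
    have "0 \<le> divided_diff T (\<lambda>t. (poly (p a) t)\<^sup>2 * f t)"
      using T by (intro divided_diff_nonneg[OF f _ _ _ dp]) auto
    also have "\<dots> = (\<Sum>t\<in>T. u t * t * (q a t)\<^sup>2)"
      unfolding divided_diff_def using T by (intro sum.cong refl) (auto simp: u_def pq)
    finally show ?thesis .
  qed
  have N0: "0 \<le> (\<Sum>k\<in>{1..n}. \<delta> * (q a (- real k))\<^sup>2)" for a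
    using \<delta> by (intro sum_nonneg) auto
  have N1: "(\<Sum>k\<in>{1..n}. \<delta> * (- real k) * (q a (- real k))\<^sup>2) \<le> 0" for a
    using \<delta> by (intro sum_nonpos) auto
  obtain x w where x: "\<And>k. k < n \<Longrightarrow> 0 \<le> x k \<and> x k \<le> 1" and w: "\<And>k. w k \<ge> 0"
    and cx: "\<And>m. m \<le> 2 * n - 1 \<Longrightarrow> c m = - (\<Sum>k<n. w k * ((x k - 1) ^ m * x k ^ (2 * n - 1 - m)))"
  proof (rule hankel_quadrature[OF n, of c])
    fix a :: "nat \<Rightarrow> real" and k
    show "quad n (\<lambda>i j. c (i + j)) a \<le> 0" unfolding C0 using U0[of a] N0[of a] by simp
    show "0 \<le> (\<Sum>i<n. \<Sum>j<n. a i * c (i + j + 1) * a j)" unfolding C1 using U1[of a] N1[of a] by simp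
    assume k: "k < n" "a k \<noteq> 0"
    \<comment> \<open>Definiteness: a polynomial of degree below n that vanishes at the n points -1,
      ..., -n is zero.\<close>
    have "0 < (\<Sum>k\<in>{1..n}. \<delta> * (q a (- real k))\<^sup>2)"
    proof (rule ccontr)
      assume "\<not> ?thesis"
      then have "(\<Sum>k\<in>{1..n}. \<delta> * (q a (- real k))\<^sup>2) = 0" using N0[of a] by simp
      then have z: "q a (- real k) = 0" if "k \<in> {1..n}" for k
        using \<delta> that by (subst (asm) sum_nonneg_eq_0_iff) auto
      have inj: "inj_on (\<lambda>k. - real k) {1..n}" by (auto simp: inj_on_def)
      have "p a = 0"
      proof (rule poly_eqI_degree[of "(\<lambda>k. - real k) ` {1..n}"])
        fix t assume "t \<in> (\<lambda>k. - real k) ` {1..n}"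
        then show "poly (p a) t = poly 0 t" using z by (auto simp: pq)
      qed (use dp[of a] n card_image[OF inj] in auto)
      then have "poly.coeff (p a) k = 0" by simp
      then show False using k by (simp add: p_def coeff_sum)
    qed
    then show "0 < (\<Sum>i<n. \<Sum>j<n. a i * (c (i + j + 1) - c (i + j)) * a j)"
      using U0[of a] U1[of a] N1[of a] C0[of a] C1[of a]
      by (simp only: right_diff_distrib left_diff_distrib sum_subtractf)
  qed blast
  \<comment> \<open>The factor over all of \<open>T\<close> is cancelled below except for its part
    at t, which leaves the denominator 1 - x_k + x_k t.\<close>
  define m where "m = (\<lambda>k. w k * (\<Prod>s\<in>T. 1 - x k + x k * s))"
  have pos: "1 - x k + x k * s > 0" if "k < n" "s > 0" for k s
  proof (cases "x k = 1")
    case False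
    then have "1 - x k > 0" "x k * s \<ge> 0" using x[of k] that by auto
    then show ?thesis by linarith
  qed (use that in auto)
  have "m k \<ge> 0" if "k < n" for k
    unfolding m_def using w[of k] T pos[OF that] by (intro mult_nonneg_nonneg prod_nonneg) (auto intro!: less_imp_le)
  moreover have "\<bar>f t - (\<Sum>k<n. m k * (t / (1 - x k + x k * t)))\<bar> < \<epsilon>" if t: "t \<in> T" for t
  proof -
    \<comment> \<open>Pair the moments with the node polynomial \<open>?R\<close> of the other
      points and compute twice. Through the weights \<open>u\<close> only the node t survives and
      gives f(t) / t, plus the disturbance; through the quadrature one gets products of 1 - x_k +
      x_k s over s \<noteq> t. The odd degree of \<open>?R\<close> accounts for the signs.\<close>
    define S where "S = T - {t}"
    have S: "finite S" "card S = 2 * n - 1" using T t by (auto simp: S_def)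
    let ?R = "\<Prod>s\<in>S. [:-s, 1:]"
    have R: "poly ?R z = (\<Sum>m\<le>2 * n - 1. poly.coeff ?R m * z ^ m)" for z
    proof -
      have "degree ?R = 2 * n - 1" using S by (subst degree_prod_eq_sum_degree) auto
      then show ?thesis by (simp add: poly_altdef)
    qed
    have odd: "odd (card S)" using S n by simp
    have tpos: "t > 0" using T t by auto
    have "(\<Sum>m\<le>2 * n - 1. poly.coeff ?R m * c m) = (\<Sum>s\<in>T. u s * poly ?R s) - (\<Sum>k\<in>{1..n}. \<delta> * poly ?R (- real k))"
    proof -
      have "(\<Sum>m\<le>2 * n - 1. poly.coeff ?R m * c m)
        = (\<Sum>m\<le>2 * n - 1. \<Sum>s\<in>T. u s * (poly.coeff ?R m * s ^ m)) - (\<Sum>m\<le>2 * n - 1. \<Sum>k\<in>{1..n}. \<delta> * (poly.coeff ?R m * (- real k) ^ m))"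
        unfolding c_def right_diff_distrib sum_subtractf sum_distrib_left by (simp add: mult_ac)
      also have "\<dots> = (\<Sum>s\<in>T. u s * poly ?R s) - (\<Sum>k\<in>{1..n}. \<delta> * poly ?R (- real k))"
        unfolding R sum_distrib_left by (simp only: sum.swap[of _ "{..2 * n - 1}"])
      finally show ?thesis .
    qed
    also have "(\<Sum>s\<in>T. u s * poly ?R s) = (\<Sum>s\<in>T. if s = t then f t / t else 0)"
    proof (intro sum.cong refl)
      fix s assume s: "s \<in> T"
      show "u s * poly ?R s = (if s = t then f t / t else 0)"
      proof (cases "s = t")
        case True
        have "(\<Prod>s\<in>T-{t}. t - s) \<noteq> 0" using T by auto
        then show ?thesis using True by (simp add: u_def poly_prod S_def)
      next
        case False
        then have "(\<Prod>r\<in>S. s - r) = 0" using s S by (intro prod_zero) (auto simp: S_def)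
        then show ?thesis using False by (simp add: poly_prod)
      qed
    qed
    also have "\<dots> = f t / t" using T t by simp
    also have "(\<Sum>k\<in>{1..n}. \<delta> * poly ?R (- real k)) = - (\<delta> * \<eta> t)"
    proof -
      have "poly ?R (- real k) = - (\<Prod>s\<in>S. real k + s)" for k
        using prod_neg_odd[OF odd, of "\<lambda>s. s + real k"] by (simp add: poly_prod add.commute)
      then show ?thesis by (simp add: \<eta>_def S_def sum_negf sum_distrib_left)
    qed
    finally have lhs: "(\<Sum>m\<le>2 * n - 1. poly.coeff ?R m * c m) = f t / t + \<delta> * \<eta> t" by simp
    have "(\<Sum>m\<le>2 * n - 1. poly.coeff ?R m * c m)
       = (\<Sum>m\<le>2 * n - 1. \<Sum>k<n. - (w k * (poly.coeff ?R m * ((x k - 1) ^ m * x k ^ (2 * n - 1 - m)))))"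
    proof (intro sum.cong refl)
      fix m assume "m \<in> {..2 * n - 1}"
      then have m: "m \<le> 2 * n - 1" by simp
      show "poly.coeff ?R m * c m = (\<Sum>k<n. - (w k * (poly.coeff ?R m * ((x k - 1) ^ m * x k ^ (2 * n - 1 - m)))))"
        unfolding cx[OF m] by (simp only: sum_negf sum_distrib_left mult_minus_right mult_ac)
    qed
    also have "\<dots> = - (\<Sum>k<n. w k * (\<Sum>m\<le>2 * n - 1. poly.coeff ?R m * ((x k - 1) ^ m * x k ^ (2 * n - 1 - m))))"
      by (subst sum.swap) (simp only: sum_negf sum_distrib_left)
    also have "\<dots> = - (\<Sum>k<n. w k * (\<Prod>s\<in>S. x k - 1 - s * x k))"
      using homogenized_linear_factors[OF S(1)] unfolding S(2) by simp
    also have "\<dots> = (\<Sum>k<n. w k * (\<Prod>s\<in>S. 1 - x k + x k * s))"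
    proof -
      have "(\<Prod>s\<in>S. x k - 1 - s * x k) = - (\<Prod>s\<in>S. 1 - x k + x k * s)" for k
        using prod_neg_odd[OF odd, of "\<lambda>s. 1 - x k + x k * s"] by (simp add: algebra_simps)
      then show ?thesis by (simp add: sum_negf)
    qed
    also have "\<dots> = (\<Sum>k<n. m k / (1 - x k + x k * t))"
    proof (intro sum.cong refl)
      fix k assume "k \<in> {..<n}"
      then have "1 - x k + x k * t > 0" using pos[of k t] tpos by simp
      then show "w k * (\<Prod>s\<in>S. 1 - x k + x k * s) = m k / (1 - x k + x k * t)"
        using T t unfolding m_def S_def by (simp add: prod.remove[of T t])
    qed
    finally have "f t / t + \<delta> * \<eta> t = (\<Sum>k<n. m k / (1 - x k + x k * t))" using lhs by simp
    then have "t * (f t / t + \<delta> * \<eta> t) = t * (\<Sum>k<n. m k / (1 - x k + x k * t))" by simp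
    then have "f t + t * (\<delta> * \<eta> t) = (\<Sum>k<n. m k * (t / (1 - x k + x k * t)))"
      using tpos by (simp add: distrib_left sum_distrib_left mult_ac)
    moreover have "0 \<le> t * (\<delta> * \<eta> t)" using tpos \<delta> \<eta>0[of t] by simp
    ultimately show ?thesis using \<delta>\<eta>[OF t] by linarith
  qed
  ultimately show ?thesis using that[of x m] x by blast
qed

section \<open>The holomorphic extension\<close>

abbreviation slit :: "complex set" where "slit \<equiv> - \<real>\<^sub>\<le>\<^sub>0"

section \<open>The slit plane\<close>

lemma open_slit: "open slit"
  by (simp add: open_Compl)

lemma of_real_in_slit [simp]: "t > 0 \<Longrightarrow> complex_of_real t \<in> slit"
  by (simp add: complex_nonpos_Reals_iff)

lemma Im_pos_in_slit: "Im z > 0 \<Longrightarrow> z \<in> slit"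
  by (auto simp: complex_nonpos_Reals_iff)

lemma starlike_slit_segment:
  assumes "z \<in> slit"
  shows "closed_segment 1 z \<subseteq> slit"
proof
  fix w assume "w \<in> closed_segment 1 z"
  then obtain u where u: "0 \<le> u" "u \<le> 1" "w = (1 - u) *\<^sub>R 1 + u *\<^sub>R z" by (auto simp: in_segment)
  show "w \<in> slit"
  proof (rule ccontr)
    assume "w \<notin> slit"
    then have "1 - u + u * Re z \<le> 0" "u * Im z = 0" using u by (auto simp: complex_nonpos_Reals_iff)
    then have "u \<noteq> 0" "Im z = 0" by auto
    moreover have "Re z > 0" using assms \<open>Im z = 0\<close> by (auto simp: complex_nonpos_Reals_iff not_le)
    ultimately have "1 - u \<ge> 0" "u * Re z > 0" using u by auto
    then show False using \<open>1 - u + u * Re z \<le> 0\<close> by linarith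
  qed
qed

lemma connected_slit: "connected slit"
proof -
  have "starlike slit"
    unfolding starlike_def using starlike_slit_segment
    by (intro bexI[of _ 1]) (auto simp: complex_nonpos_Reals_iff)
  then show ?thesis by (rule starlike_imp_connected)
qed

text \<open>A zero would have to be the non-positive number (x - 1) / x, which lies on the
  slit.\<close>

lemma pencil_nonzero:
  assumes "z \<in> slit" "0 \<le> x" "x \<le> 1"
  shows "1 - complex_of_real x + of_real x * z \<noteq> 0"
proof
  assume eq: "1 - complex_of_real x + of_real x * z = 0"
  then have "1 - x + x * Re z = 0" "x * Im z = 0" by (auto simp: complex_eq_iff)
  then have "x \<noteq> 0" "Im z = 0" by auto
  moreover have "Re z > 0" using assms \<open>Im z = 0\<close> by (auto simp: complex_nonpos_Reals_iff not_le)
  ultimately have "x * Re z > 0" using assms by auto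
  then show False using \<open>1 - x + x * Re z = 0\<close> assms by linarith
qed

section \<open>Finite positive combinations of z / (1 - x + x z)\<close>

definition cone_fun :: "nat \<Rightarrow> (nat \<Rightarrow> real) \<Rightarrow> (nat \<Rightarrow> real) \<Rightarrow> complex \<Rightarrow> complex" where
  "cone_fun n m x z = (\<Sum>k<n. of_real (m k) * (z / (1 - of_real (x k) + of_real (x k) * z)))"

locale cone_data =
  fixes n :: nat and m x :: "nat \<Rightarrow> real"
  assumes x: "\<And>k. k < n \<Longrightarrow> 0 \<le> x k \<and> x k \<le> 1" and m: "\<And>k. k < n \<Longrightarrow> 0 \<le> m k"
begin

lemma holomorphic_cone_fun: "cone_fun n m x holomorphic_on slit"
  unfolding cone_fun_def using pencil_nonzero x by (intro holomorphic_intros) auto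

lemma cone_fun_of_real:
  "cone_fun n m x (of_real t) = of_real (\<Sum>k<n. m k * (t / (1 - x k + x k * t)))"
  unfolding cone_fun_def by simp

lemma cone_fun_cnj: "cone_fun n m x (cnj z) = cnj (cone_fun n m x z)"
  unfolding cone_fun_def by simp

lemma cone_fun_bound:
  assumes "\<And>y. 0 \<le> y \<Longrightarrow> y \<le> 1 \<Longrightarrow> cmod (z / (1 - of_real y + of_real y * z)) \<le> B"
  shows "cmod (cone_fun n m x z) \<le> (\<Sum>k<n. m k) * B"
proof -
  have "cmod (cone_fun n m x z) \<le> (\<Sum>k<n. m k * B)"
    unfolding cone_fun_def
  proof (intro sum_norm_le)
    fix k assume "k \<in> {..<n}"
    then show "cmod (of_real (m k) * (z / (1 - of_real (x k) + of_real (x k) * z))) \<le> m k * B"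
      unfolding norm_mult using assms[of "x k"] x[of k] m[of k] by (auto intro!: mult_mono)
  qed
  then show ?thesis by (simp add: sum_distrib_right)
qed

lemma pencil_pos: "k < n \<Longrightarrow> t > 0 \<Longrightarrow> 1 - x k + x k * t > 0"
proof (cases "x k = 1")
  case False
  assume *: "k < n" "t > 0"
  then have "1 - x k > 0" "x k * t \<ge> 0" using x[of k] False by auto
  then show ?thesis by linarith
qed auto

lemma cone_fun_quotient:
  assumes z: "z \<in> slit" and a: "a > 0" and "z \<noteq> of_real a"
  shows "(cone_fun n m x z - cone_fun n m x (of_real a)) / (z - of_real a)
    = (\<Sum>k<n. of_real (m k * (1 - x k) / (1 - x k + x k * a)) / (1 - of_real (x k) + of_real (x k) * z))"
  unfolding cone_fun_def sum_subtractf[symmetric] sum_divide_distrib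
proof (intro sum.cong refl)
  fix k assume k: "k \<in> {..<n}"
  define D where "D = 1 - complex_of_real (x k) + of_real (x k) * z"
  define d where "d = 1 - x k + x k * a"
  have D: "D \<noteq> 0" using pencil_nonzero[OF z] x k by (auto simp: D_def)
  have d: "complex_of_real d \<noteq> 0" using pencil_pos[of k a] k a unfolding d_def by (simp only: of_real_eq_0_iff) auto
  have e: "1 - complex_of_real (x k) + of_real (x k) * of_real a = of_real d" by (simp add: d_def)
  have "z * of_real d - of_real a * D = (z - of_real a) * of_real (1 - x k)"
    by (simp add: D_def d_def algebra_simps)
  then have "z / D - of_real a / of_real d = (z - of_real a) * of_real (1 - x k) / (D * of_real d)"
    using D d by (simp add: diff_frac_eq)
  then have "(of_real (m k) * (z / D) - of_real (m k) * (of_real a / of_real d)) / (z - of_real a)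
     = of_real (m k) * ((z - of_real a) * of_real (1 - x k) / (D * of_real d)) / (z - of_real a)"
    by (simp only: right_diff_distrib[symmetric])
  also have "\<dots> = of_real (m k * (1 - x k) / d) / D"
    using assms(3) by simp
  finally show "(of_real (m k) * (z / (1 - of_real (x k) + of_real (x k) * z)) -
      of_real (m k) * (of_real a / (1 - of_real (x k) + of_real (x k) * of_real a))) / (z - of_real a)
    = of_real (m k * (1 - x k) / (1 - x k + x k * a)) / (1 - of_real (x k) + of_real (x k) * z)"
    unfolding e by (simp add: D_def d_def)
qed

text \<open>The denominators of the partial fractions of u have non-negative imaginary part, which
  gives the first bound. The second is Cauchy-Schwarz; with C the combination it says Im (z u cnj (C
  z)) \<ge> 0, that is arg C \<le> arg z + arg u, in a form that passes to limits.\<close>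

lemma cone_fun_quotient_Im:
  assumes z: "Im z > 0" and a: "a > 0"
  defines "u \<equiv> (cone_fun n m x z - cone_fun n m x (of_real a)) / (z - of_real a)"
  shows "Im u \<le> 0" "a * (cmod u)\<^sup>2 * Im z \<le> Re (cone_fun n m x (of_real a)) * Im (z * u)"
proof -
  define D where "D = (\<lambda>k. 1 - complex_of_real (x k) + of_real (x k) * z)"
  define d where "d = (\<lambda>k. 1 - x k + x k * a)"
  define c where "c = (\<lambda>k. m k * (1 - x k) / d k)"
  have D: "D k \<noteq> 0" and d: "d k > 0" and c: "c k \<ge> 0" if "k < n" for k
    using pencil_nonzero[OF Im_pos_in_slit[OF z]] pencil_pos[OF that a] x[OF that] m[OF that]
    by (auto simp: D_def d_def c_def)
  have "z \<noteq> of_real a" using z by auto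
  then have u: "u = (\<Sum>k<n. of_real (c k) / D k)"
    unfolding u_def by (subst cone_fun_quotient[OF Im_pos_in_slit[OF z] a]) (auto simp: c_def d_def D_def)
  have ImD: "Im (D k) = x k * Im z" for k by (simp add: D_def)
  show "Im u \<le> 0"
    unfolding u Im_sum
  proof (intro sum_nonpos)
    fix k assume "k \<in> {..<n}"
    then show "Im (of_real (c k) / D k) \<le> 0"
      using c[of k] x[of k] z by (auto simp: Im_divide ImD intro!: divide_nonpos_nonneg mult_nonneg_nonneg)
  qed
  have ImzD: "Im (z / D k) = (1 - x k) * Im z / (cmod (D k))\<^sup>2" for k
    by (simp add: Im_divide cmod_power2 D_def algebra_simps)
  have Imzu: "Im (z * u) = Im z * (\<Sum>k<n. m k * (1 - x k)\<^sup>2 / (d k * (cmod (D k))\<^sup>2))"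
  proof -
    have "z * u = (\<Sum>k<n. of_real (c k) * (z / D k))"
      unfolding u sum_distrib_left by (intro sum.cong refl) simp
    then have "Im (z * u) = (\<Sum>k<n. c k * Im (z / D k))"
      by (simp only: Im_sum times_complex.sel Re_complex_of_real Im_complex_of_real mult_zero_left add_0_right)
    also have "\<dots> = (\<Sum>k<n. Im z * (m k * (1 - x k)\<^sup>2 / (d k * (cmod (D k))\<^sup>2)))"
      unfolding ImzD by (intro sum.cong refl) (simp add: c_def power2_eq_square)
    finally show ?thesis by (simp add: sum_distrib_left)
  qed
  have Ca: "Re (cone_fun n m x (of_real a)) = a * (\<Sum>k<n. m k / d k)"
    unfolding cone_fun_of_real by (simp add: d_def sum_distrib_left mult_ac)
  \<comment> \<open>The terms are split so that the two Cauchy-Schwarz factors become C(a) / a and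
    Im (z u) / Im z.\<close>
  have "cmod u \<le> (\<Sum>k<n. sqrt (m k / d k) * (sqrt (m k / d k) * (1 - x k) / cmod (D k)))"
    unfolding u
  proof (intro sum_norm_le)
    fix k assume k: "k \<in> {..<n}"
    have "m k \<ge> 0" "d k > 0" using k m d[of k] by auto
    then have "sqrt (m k / d k) * (sqrt (m k / d k) * (1 - x k) / cmod (D k)) = m k / d k * (1 - x k) / cmod (D k)"
      by (simp flip: mult.assoc)
    also have "\<dots> = c k / cmod (D k)" by (simp add: c_def)
    finally have e: "sqrt (m k / d k) * (sqrt (m k / d k) * (1 - x k) / cmod (D k)) = c k / cmod (D k)" .
    show "cmod (of_real (c k) / D k) \<le> sqrt (m k / d k) * (sqrt (m k / d k) * (1 - x k) / cmod (D k))"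
      unfolding e using c[of k] k by (simp add: norm_divide)
  qed
  then have "(cmod u)\<^sup>2 \<le> (\<Sum>k<n. sqrt (m k / d k) * (sqrt (m k / d k) * (1 - x k) / cmod (D k)))\<^sup>2"
    by (intro power_mono) auto
  also have "\<dots> \<le> (\<Sum>k<n. (sqrt (m k / d k))\<^sup>2) * (\<Sum>k<n. (sqrt (m k / d k) * (1 - x k) / cmod (D k))\<^sup>2)"
    by (rule Cauchy_Schwarz_ineq_sum)
  also have "\<dots> = (\<Sum>k<n. m k / d k) * (\<Sum>k<n. m k * (1 - x k)\<^sup>2 / (d k * (cmod (D k))\<^sup>2))"
  proof -
    have "(sqrt (m k / d k))\<^sup>2 = m k / d k" if "k < n" for k
      using m[OF that] d[OF that] by (intro real_sqrt_pow2) auto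
    then show ?thesis by (simp add: power_divide power_mult_distrib)
  qed
  finally have "a * Im z * (cmod u)\<^sup>2 \<le> a * Im z * ((\<Sum>k<n. m k / d k) * (\<Sum>k<n. m k * (1 - x k)\<^sup>2 / (d k * (cmod (D k))\<^sup>2)))"
    using a z by (intro mult_left_mono) auto
  then show "a * (cmod u)\<^sup>2 * Im z \<le> Re (cone_fun n m x (of_real a)) * Im (z * u)"
    unfolding Ca Imzu by (simp add: mult_ac)
qed

text \<open>Each summand of the quotient is a non-negative constant over an increasing denominator.
  In the limit this concavity ensures that the derivative of the extension does not vanish on the
  positive axis.\<close>

lemma cone_fun_quotient_antimono:
  assumes "0 < s" "s \<le> t" "0 < a" "s \<noteq> a" "t \<noteq> a"
  shows "Re ((cone_fun n m x (of_real t) - cone_fun n m x (of_real a)) / (of_real t - of_real a))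
       \<le> Re ((cone_fun n m x (of_real s) - cone_fun n m x (of_real a)) / (of_real s - of_real a))"
proof -
  have *: "Re ((cone_fun n m x (of_real t) - cone_fun n m x (of_real a)) / (of_real t - of_real a))
     = (\<Sum>k<n. m k * (1 - x k) / (1 - x k + x k * a) / (1 - x k + x k * t))" if "0 < t" "t \<noteq> a" for t
  proof -
    have "(cone_fun n m x (of_real t) - cone_fun n m x (of_real a)) / (of_real t - of_real a)
      = of_real (\<Sum>k<n. m k * (1 - x k) / (1 - x k + x k * a) / (1 - x k + x k * t))"
      using that assms by (subst cone_fun_quotient) auto
    then show ?thesis by (simp only: Re_complex_of_real)
  qed
  show ?thesis
    unfolding *[OF assms(1,4)] *[OF less_le_trans[OF assms(1,2)] assms(5)]
  proof (intro sum_mono)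
    fix k assume "k \<in> {..<n}"
    then have k: "k < n" by simp
    show "m k * (1 - x k) / (1 - x k + x k * a) / (1 - x k + x k * t)
        \<le> m k * (1 - x k) / (1 - x k + x k * a) / (1 - x k + x k * s)"
      using pencil_pos[OF k \<open>0 < a\<close>] pencil_pos[OF k \<open>0 < s\<close>] x[OF k] m[OF k] assms
      by (intro divide_left_mono mult_pos_pos pencil_pos[OF k]) (auto intro!: mult_left_mono)
  qed
qed

end

text \<open>The parameter y ranges over the compact interval [0, 1] even when the node goes to
  infinity, so the bound on \<open>K\<close> is uniform in the node. Montel's theorem will use
  this.\<close>

lemma pencil_bounded:
  assumes K: "compact K" "K \<subseteq> slit"
  shows "\<exists>B. \<forall>z\<in>K. \<forall>y. 0 \<le> y \<and> y \<le> 1 \<longrightarrow> cmod (z / (1 - of_real y + of_real y * z)) \<le> B"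
proof -
  have "continuous_on ({0..1::real} \<times> K) (\<lambda>p. snd p / (1 - of_real (fst p) + of_real (fst p) * snd p))"
    using K pencil_nonzero by (intro continuous_intros) (auto simp: subset_iff)
  then have "compact ((\<lambda>p. snd p / (1 - of_real (fst p) + of_real (fst p) * snd p)) ` ({0..1::real} \<times> K))"
    by (rule compact_continuous_image) (simp add: compact_Times K)
  from compact_imp_bounded[OF this]
  obtain B where B: "\<forall>w\<in>(\<lambda>p. snd p / (1 - of_real (fst p) + of_real (fst p) * snd p)) ` ({0..1::real} \<times> K). cmod w \<le> B"
    unfolding bounded_iff ..
  have "cmod (z / (1 - of_real y + of_real y * z)) \<le> B" if "z \<in> K" "0 \<le> y" "y \<le> 1" for z y
    using that by (intro B[rule_format] image_eqI[of _ _ "(y, z)"]) auto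
  then show ?thesis by blast
qed

lemma dyadic_approximation:
  assumes "s > 0"
  obtains k :: "nat \<Rightarrow> nat" where "(\<lambda>i. real (k i + 1) / 2 ^ i) \<longlonglongrightarrow> s"
proof
  define k where "k = (\<lambda>i::nat. nat \<lfloor>s * 2 ^ i\<rfloor>)"
  have "\<bar>real (k i + 1) / 2 ^ i - s\<bar> \<le> (1/2) ^ i" for i
  proof -
    have "real (k i) = of_int \<lfloor>s * 2 ^ i\<rfloor>" using assms by (simp add: k_def)
    then have "\<bar>real (k i + 1) - s * 2 ^ i\<bar> \<le> 1" by linarith
    then have "\<bar>real (k i + 1) - s * 2 ^ i\<bar> / 2 ^ i \<le> 1 / 2 ^ i" by (intro divide_right_mono) auto
    moreover have "\<bar>real (k i + 1) - s * 2 ^ i\<bar> / 2 ^ i = \<bar>real (k i + 1) / 2 ^ i - s\<bar>"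
    proof -
      have "\<bar>real (k i + 1) - s * 2 ^ i\<bar> / 2 ^ i = \<bar>(real (k i + 1) - s * 2 ^ i) / 2 ^ i\<bar>" by simp
      then show ?thesis by (simp add: diff_divide_distrib)
    qed
    ultimately show ?thesis by (simp add: power_divide)
  qed
  then have "(\<lambda>i. real (k i + 1) / 2 ^ i - s) \<longlonglongrightarrow> 0"
    by (intro Lim_null_comparison[OF _ LIMSEQ_power_zero[of "1/2::real"]]) auto
  then show "(\<lambda>i. real (k i + 1) / 2 ^ i) \<longlonglongrightarrow> s" by (simp add: LIM_zero_iff)
qed

abbreviation (input) diff_quot :: "(complex \<Rightarrow> complex) \<Rightarrow> (real \<Rightarrow> real) \<Rightarrow> real \<Rightarrow> complex \<Rightarrow> complex" where
  "diff_quot F f a z \<equiv> (F z - of_real (f a)) / (z - of_real a)"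

text \<open>A normal-family limit of interpolants on ever finer grids. The inequalities for
  difference quotients are recorded along with the extension: they are closed conditions, so they
  pass from the interpolants to the limit, and later they stand in for an integral representation of
  f.\<close>

theorem operator_monotone_extension:
  assumes f: "operator_monotone_on {0..} f" and f0: "f 0 \<ge> 0"
  obtains F where "F holomorphic_on slit" "\<And>t. t > 0 \<Longrightarrow> F (of_real t) = of_real (f t)"
    "\<And>z. z \<in> slit \<Longrightarrow> F (cnj z) = cnj (F z)"
    "\<And>z a. Im z > 0 \<Longrightarrow> a > 0 \<Longrightarrow> Im (diff_quot F f a z) \<le> 0"
    "\<And>z a. Im z > 0 \<Longrightarrow> a > 0 \<Longrightarrow> a * (cmod (diff_quot F f a z))\<^sup>2 * Im z
       \<le> f a * Im (z * (diff_quot F f a z))"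
    "\<And>s t a. 0 < s \<Longrightarrow> s \<le> t \<Longrightarrow> 0 < a \<Longrightarrow> s \<noteq> a \<Longrightarrow> t \<noteq> a \<Longrightarrow> (f t - f a) / (t - a) \<le> (f s - f a) / (s - a)"
proof -
  have fm: "form_monotone {0..} f" and cont: "continuous_on {0..} f"
    using f by (auto simp: operator_monotone_on_iff_form)
  \<comment> \<open>The grid \<open>T j\<close> has mesh 2^(-j) and reaches up to 2^(j + 1), so
    every positive dyadic number belongs to it from some j on.\<close>
  define N where "N = (\<lambda>j::nat. 4 ^ j :: nat)"
  define T where "T = (\<lambda>j. (\<lambda>k. real (k + 1) / 2 ^ j) ` {..<2 * N j})"
  define P where "P = (\<lambda>j x m. (\<forall>k<N j. 0 \<le> x k \<and> x k \<le> 1) \<and> (\<forall>k<N j. m k \<ge> 0) \<and>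
     (\<forall>t\<in>T j. \<bar>f t - (\<Sum>k<N j. m k * (t / (1 - x k + x k * t)))\<bar> < 1 / real (j + 1)))"
  have "\<exists>x m. P j x m" for j
  proof -
    have card: "card (T j) = 2 * N j" unfolding T_def by (subst card_image) (auto simp: inj_on_def)
    have T: "finite (T j)" "T j \<subseteq> {0<..}" and N: "N j \<ge> 1" and \<epsilon>: "1 / real (j + 1) > 0"
      by (auto simp: T_def N_def)
    show ?thesis
    proof (rule operator_monotone_cone_approximation[OF fm f0 T card N \<epsilon>])
      fix x m :: "nat \<Rightarrow> real"
      assume "\<And>k. k < N j \<Longrightarrow> 0 \<le> x k \<and> x k \<le> 1" "\<And>k. k < N j \<Longrightarrow> 0 \<le> m k"
        "\<And>t. t \<in> T j \<Longrightarrow> \<bar>f t - (\<Sum>k<N j. m k * (t / (1 - x k + x k * t)))\<bar> < 1 / real (j + 1)"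
      then show ?thesis by (intro exI[of _ x] exI[of _ m]) (simp add: P_def)
    qed
  qed
  then obtain x m where P: "\<And>j. P j (x j) (m j)" by metis
  have xm: "\<And>j k. k < N j \<Longrightarrow> 0 \<le> x j k \<and> x j k \<le> 1" "\<And>j k. k < N j \<Longrightarrow> m j k \<ge> 0"
    using P by (auto simp: P_def)
  have approx: "t \<in> T j \<Longrightarrow> \<bar>f t - (\<Sum>k<N j. m j k * (t / (1 - x j k + x j k * t)))\<bar> < 1 / real (j + 1)" for j t
    using P[of j] by (auto simp: P_def)
  define C where "C = (\<lambda>j. cone_fun (N j) (m j) (x j))"
  have cd: "cone_data (N j) (m j) (x j)" for j
    using xm by unfold_locales auto
  \<comment> \<open>At t = 1 each function t / (1 - x + x t) equals 1, so the total mass is the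
    value of the interpolant at the grid point 1.\<close>
  have mass: "(\<Sum>k<N j. m j k) \<le> f 1 + 1" for j
  proof -
    have "(1::real) \<in> T j"
      unfolding T_def
    proof (rule image_eqI)
      show "(1::real) = real ((2 ^ j - 1) + 1) / 2 ^ j" by (simp add: of_nat_diff)
      have "(2::nat) ^ j \<le> 4 ^ j" by (intro power_mono) auto
      moreover have "(0::nat) < 4 ^ j" by simp
      ultimately have "2 ^ j - 1 < 2 * (4::nat) ^ j" by linarith
      then show "2 ^ j - 1 \<in> {..<2 * N j}" by (simp add: N_def)
    qed
    from approx[OF this] have "\<bar>f 1 - (\<Sum>k<N j. m j k)\<bar> < 1 / real (j + 1)" by simp
    moreover have "1 / real (j + 1) \<le> 1" by simp
    ultimately show ?thesis by linarith
  qed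
  have mass0: "0 \<le> (\<Sum>k<N j. m j k)" for j using xm by (intro sum_nonneg) auto
  obtain F r where F: "F holomorphic_on slit" and r: "strict_mono r"
    and lim: "\<And>z. z \<in> slit \<Longrightarrow> (\<lambda>j. C (r j) z) \<longlonglongrightarrow> F z"
  proof (rule Montel[of slit "range C" C])
    show "open slit" by (rule open_slit)
    show "h holomorphic_on slit" if "h \<in> range C" for h
      using that cone_data.holomorphic_cone_fun[OF cd] by (auto simp: C_def)
    fix K :: "complex set" assume K: "compact K" "K \<subseteq> slit"
    obtain B where B: "\<forall>z\<in>K. \<forall>y. 0 \<le> y \<and> y \<le> 1 \<longrightarrow> cmod (z / (1 - of_real y + of_real y * z)) \<le> B"
      using pencil_bounded[OF K] by blast
    have "cmod (C j z) \<le> (f 1 + 1) * max B 0" if "z \<in> K" for j z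
    proof -
      have "cmod (C j z) \<le> (\<Sum>k<N j. m j k) * max B 0"
        unfolding C_def using B that by (intro cone_data.cone_fun_bound[OF cd]) fastforce
      also have "\<dots> \<le> (f 1 + 1) * max B 0" using mass[of j] by (intro mult_right_mono) auto
      finally show ?thesis .
    qed
    then show "\<exists>B. \<forall>h\<in>range C. \<forall>z\<in>K. cmod (h z) \<le> B" by blast
  qed (auto intro: that)
  have dyadic: "F (of_real t) = of_real (f t)" if t: "t = real (p + 1) / 2 ^ i" for t p i
  proof -
    have tp: "t > 0" unfolding t by simp
    have inT: "t \<in> T j" if "j \<ge> i + p" for j
      unfolding T_def
    proof (rule image_eqI)
      have ij: "(2::real) ^ j = 2 ^ (j - i) * 2 ^ i" using that by (simp flip: power_add)
      have "0 < (p + 1) * (2::nat) ^ (j - i)" by (intro mult_pos_pos) auto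
      then have 1: "(p + 1) * (2::nat) ^ (j - i) \<ge> 1" by linarith
      then have "(p + 1) * (2::nat) ^ (j - i) - 1 + 1 = (p + 1) * 2 ^ (j - i)" by (rule le_add_diff_inverse2)
      then show "t = real (((p + 1) * 2 ^ (j - i) - 1) + 1) / 2 ^ j"
        unfolding t ij by (simp only: of_nat_mult of_nat_power) simp
      have "p < 2 ^ p" by (rule less_exp)
      also have "(2::nat) ^ p \<le> 2 ^ j" using that by (intro power_increasing) auto
      finally have "p + 1 \<le> 2 ^ j" by simp
      moreover have "(2::nat) ^ (j - i) \<le> 2 ^ j" by (intro power_increasing) auto
      ultimately have "(p + 1) * 2 ^ (j - i) \<le> 2 ^ j * 2 ^ j" by (rule mult_le_mono)
      also have "(2::nat) ^ j * 2 ^ j = 4 ^ j" by (simp flip: power_mult_distrib)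
      finally have "(p + 1) * 2 ^ (j - i) \<le> N j" unfolding N_def .
      then have "(p + 1) * 2 ^ (j - i) - 1 < 2 * N j" using 1 by linarith
      then show "(p + 1) * 2 ^ (j - i) - 1 \<in> {..<2 * N j}" by (rule lessThan_iff[THEN iffD2])
    qed
    have "(\<lambda>j. C j (of_real t) - of_real (f t)) \<longlonglongrightarrow> 0"
    proof (rule Lim_null_comparison)
      show "\<forall>\<^sub>F j in sequentially. cmod (C j (of_real t) - of_real (f t)) \<le> 1 / real (j + 1)"
        unfolding eventually_sequentially
      proof (intro exI allI impI)
        fix j assume "i + p \<le> j"
        from approx[OF inT[OF this]]
        show "cmod (C j (of_real t) - of_real (f t)) \<le> 1 / real (j + 1)"
          unfolding C_def cone_data.cone_fun_of_real[OF cd] of_real_diff[symmetric] norm_of_real by linarith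
      qed
      show "(\<lambda>j. 1 / real (j + 1)) \<longlonglongrightarrow> 0" using LIMSEQ_inverse_real_of_nat by (simp add: inverse_eq_divide)
    qed
    then have "(\<lambda>j. C j (of_real t)) \<longlonglongrightarrow> of_real (f t)" by (simp add: LIM_zero_iff)
    from LIMSEQ_subseq_LIMSEQ[OF this r] have "(\<lambda>j. C (r j) (of_real t)) \<longlonglongrightarrow> of_real (f t)"
      by (simp add: o_def)
    then show ?thesis using lim[of "of_real t"] tp LIMSEQ_unique by fastforce
  qed
  have Ff: "F (of_real t) = of_real (f t)" if t: "t > 0" for t
  proof -
    obtain k where k: "(\<lambda>i. real (k i + 1) / 2 ^ i) \<longlonglongrightarrow> t" using dyadic_approximation[OF t] .
    have "(\<lambda>i. f (real (k i + 1) / 2 ^ i)) \<longlonglongrightarrow> f t"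
      using continuous_on_tendsto_compose[OF cont k] t by auto
    then have "(\<lambda>i. complex_of_real (f (real (k i + 1) / 2 ^ i))) \<longlonglongrightarrow> of_real (f t)"
      by (rule tendsto_of_real)
    moreover have "(\<lambda>i. F (of_real (real (k i + 1) / 2 ^ i))) \<longlonglongrightarrow> F (of_real t)"
    proof (rule continuous_on_tendsto_compose[OF holomorphic_on_imp_continuous_on[OF F]])
      show "(\<lambda>i. complex_of_real (real (k i + 1) / 2 ^ i)) \<longlonglongrightarrow> of_real t" using k by (rule tendsto_of_real)
      show "\<forall>\<^sub>F i in sequentially. complex_of_real (real (k i + 1) / 2 ^ i) \<in> slit"
        by (intro always_eventually allI of_real_in_slit) auto
    qed (use t in auto)
    moreover have "F (of_real (real (k i + 1) / 2 ^ i)) = of_real (f (real (k i + 1) / 2 ^ i))" for i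
      by (rule dyadic) simp
    ultimately show ?thesis by (simp only: LIMSEQ_unique)
  qed
  let ?q = "\<lambda>j z a. (C (r j) z - C (r j) (complex_of_real a)) / (z - of_real a)"
  have quot: "(\<lambda>j. ?q j z a) \<longlonglongrightarrow> diff_quot F f a z"
    if "z \<in> slit" "a > 0" "z \<noteq> of_real a" for z a
    using that lim[of z] lim[of "of_real a"] by (intro tendsto_intros) (auto simp: Ff)
  show ?thesis
  proof (rule that[OF F])
    show "F (of_real t) = of_real (f t)" if "t > 0" for t using Ff[OF that] .
    show "F (cnj z) = cnj (F z)" if "z \<in> slit" for z
    proof -
      have "cnj z \<in> slit" using that by (auto simp: complex_nonpos_Reals_iff)
      from lim[OF this] have "(\<lambda>j. cnj (C (r j) z)) \<longlonglongrightarrow> F (cnj z)"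
        unfolding C_def cone_data.cone_fun_cnj[OF cd] .
      then show ?thesis using tendsto_cnj[OF lim[OF that]] LIMSEQ_unique by blast
    qed
    fix z :: complex and a :: real assume za: "Im z > 0" "a > 0"
    then have "z \<noteq> of_real a" by auto
    note q = quot[OF Im_pos_in_slit[OF za(1)] za(2) this]
    show "Im (diff_quot F f a z) \<le> 0"
      by (rule tendsto_upperbound[OF tendsto_Im[OF q]])
         (auto simp: C_def intro!: always_eventually cone_data.cone_fun_quotient_Im[OF cd] za)
    have "(\<lambda>j. Re (C (r j) (of_real a)) * Im (z * (?q j z a))
        - a * (cmod (?q j z a))\<^sup>2 * Im z)
      \<longlonglongrightarrow> Re (F (of_real a)) * Im (z * (diff_quot F f a z))
        - a * (cmod (diff_quot F f a z))\<^sup>2 * Im z"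
      using lim[of "of_real a"] za(2) by (intro tendsto_intros q) auto
    then have "0 \<le> Re (F (of_real a)) * Im (z * (diff_quot F f a z))
        - a * (cmod (diff_quot F f a z))\<^sup>2 * Im z"
    proof (rule tendsto_lowerbound)
      show "\<forall>\<^sub>F j in sequentially. 0 \<le> Re (C (r j) (of_real a)) * Im (z * (?q j z a))
        - a * (cmod (?q j z a))\<^sup>2 * Im z"
        unfolding C_def using cone_data.cone_fun_quotient_Im(2)[OF cd za] by (intro always_eventually allI) simp
    qed auto
    then show "a * (cmod (diff_quot F f a z))\<^sup>2 * Im z
       \<le> f a * Im (z * (diff_quot F f a z))"
      using Ff[OF za(2)] by simp
  next
    fix s t a :: real assume *: "0 < s" "s \<le> t" "0 < a" "s \<noteq> a" "t \<noteq> a"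
    have conv: "(\<lambda>j. Re (?q j (of_real t) a)) \<longlonglongrightarrow> (f t - f a) / (t - a)"
      if "0 < t" "t \<noteq> a" for t
    proof -
      have "(F (of_real t) - of_real (f a)) / (of_real t - of_real a) = of_real ((f t - f a) / (t - a))"
        using Ff[OF that(1)] by simp
      then show ?thesis
        using tendsto_Re[OF quot[of "of_real t" a]] that *(3) by (simp del: of_real_divide of_real_diff)
    qed
    show "(f t - f a) / (t - a) \<le> (f s - f a) / (s - a)"
    proof (rule tendsto_le[OF _ conv conv])
      show "\<forall>\<^sub>F j in sequentially. Re (?q j (of_real t) a)
          \<le> Re (?q j (of_real s) a)"
        unfolding C_def by (intro always_eventually allI cone_data.cone_fun_quotient_antimono[OF cd] *)
    qed (use * in auto)
  qed
qed

section \<open>Positive real functions\<close>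

definition coord :: "nat \<Rightarrow> complex mat \<Rightarrow> complex vec \<Rightarrow> nat \<Rightarrow> complex" where
  "coord n U v k = (\<Sum>i<n. cnj (U $$ (i,k)) * v $ i)"

lemma spectral_form_coord:
  "spectral_form n U d v = (\<Sum>k<n. d k * (cmod (coord n U v k))\<^sup>2)"
  by (simp add: spectral_form_def coord_def)

lemma unitary_parseval:
  assumes U: "U \<in> carrier_mat n n" "unitary_mat U"
  shows "(\<Sum>k<n. cnj (coord n U w k) * coord n U v k) = (\<Sum>i<n. cnj (w $ i) * v $ i)"
proof -
  have UU: "(\<Sum>k<n. U $$ (i,k) * cnj (U $$ (j,k))) = (if i = j then 1 else 0)" if "i < n" "j < n" for i j
  proof -
    have "(U * mat_adjoint U) $$ (i,j) = (\<Sum>k<n. U $$ (i,k) * cnj (U $$ (j,k)))"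
      using U that by (auto simp: scalar_prod_def atLeast0LessThan intro!: sum.cong)
    moreover have "U * mat_adjoint U = 1\<^sub>m n" using U by (auto simp: unitary_mat_def)
    ultimately have "(\<Sum>k<n. U $$ (i,k) * cnj (U $$ (j,k))) = 1\<^sub>m n $$ (i,j)" by (simp only:)
    then show ?thesis using that by simp
  qed
  have "(\<Sum>k<n. cnj (coord n U w k) * coord n U v k)
     = (\<Sum>k<n. \<Sum>i<n. \<Sum>j<n. (U $$ (i,k) * cnj (U $$ (j,k))) * (cnj (w $ i) * v $ j))"
    unfolding coord_def cnj_sum sum_product by (simp add: mult_ac)
  also have "\<dots> = (\<Sum>i<n. \<Sum>j<n. \<Sum>k<n. (U $$ (i,k) * cnj (U $$ (j,k))) * (cnj (w $ i) * v $ j))"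
    by (rule trans[OF sum.swap sum.cong[OF refl sum.swap]])
  also have "\<dots> = (\<Sum>i<n. \<Sum>j<n. if j = i then cnj (w $ i) * v $ j else 0)"
    unfolding sum_distrib_right[symmetric] by (intro sum.cong refl) (auto simp: UU)
  finally show ?thesis by simp
qed

lemma coord_surj:
  assumes U: "U \<in> carrier_mat n n" "unitary_mat U"
  obtains w where "w \<in> carrier_vec n" "\<And>k. k < n \<Longrightarrow> coord n U w k = c k"
proof
  define w where "w = vec n (\<lambda>i. \<Sum>l<n. U $$ (i,l) * c l)"
  show "w \<in> carrier_vec n" by (simp add: w_def)
  have UU: "(\<Sum>i<n. cnj (U $$ (i,k)) * U $$ (i,l)) = (if k = l then 1 else 0)" if "k < n" "l < n" for k l
  proof -
    have "mat_adjoint U * U = 1\<^sub>m n" using U by (auto simp: unitary_mat_def)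
    with index_adjoint_mult[OF U(1) U(1) that]
    have "(\<Sum>i<n. cnj (U $$ (i,k)) * U $$ (i,l)) = 1\<^sub>m n $$ (k,l)" by (simp only:)
    then show ?thesis using that by simp
  qed
  fix k assume k: "k < n"
  have "coord n U w k = (\<Sum>i<n. \<Sum>l<n. (cnj (U $$ (i,k)) * U $$ (i,l)) * c l)"
    unfolding coord_def by (intro sum.cong refl) (simp add: w_def sum_distrib_left mult_ac)
  also have "\<dots> = (\<Sum>l<n. (\<Sum>i<n. cnj (U $$ (i,k)) * U $$ (i,l)) * c l)"
    by (subst sum.swap) (simp add: sum_distrib_right)
  also have "\<dots> = (\<Sum>l<n. if l = k then c l else 0)"
    using k by (intro sum.cong refl) (auto simp: UU)
  finally show "coord n U w k = c k" using k by simp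
qed

lemma form_monotone_tendsto:
  assumes lim: "\<And>t. t \<in> I \<Longrightarrow> (\<lambda>j. g j t) \<longlonglongrightarrow> h t" and g: "\<And>j. form_monotone I (g j)"
  shows "form_monotone I h"
proof (rule form_monotoneI)
  fix n U d V e and v :: "complex vec"
  assume le: "form_le I n U d V e" and v: "v \<in> carrier_vec n"
  then have I: "d k \<in> I" "e k \<in> I" if "k < n" for k using that by (auto simp: form_le_def)
  have 1: "(\<lambda>j. spectral_form n U (g j \<circ> d) v) \<longlonglongrightarrow> spectral_form n U (h \<circ> d) v"
    unfolding spectral_form_def o_def using I by (intro tendsto_intros lim) auto
  have 2: "(\<lambda>j. spectral_form n V (g j \<circ> e) v) \<longlonglongrightarrow> spectral_form n V (h \<circ> e) v"
    unfolding spectral_form_def o_def using I by (intro tendsto_intros lim) auto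
  show "spectral_form n U (h \<circ> d) v \<le> spectral_form n V (h \<circ> e) v"
  proof (rule LIMSEQ_le[OF 1 2], intro exI allI impI)
    fix j show "spectral_form n U (g j \<circ> d) v \<le> spectral_form n V (g j \<circ> e) v"
      by (rule form_monotoneD[OF g le v])
  qed
qed

lemma form_monotone_integral:
  fixes k :: "real \<Rightarrow> real \<Rightarrow> real"
  assumes int: "\<And>t. t \<in> I \<Longrightarrow> ((\<lambda>\<theta>. k \<theta> t) has_integral h t) S"
    and k: "\<And>\<theta>. \<theta> \<in> S \<Longrightarrow> form_monotone I (k \<theta>)"
  shows "form_monotone I h"
proof (rule form_monotoneI)
  fix n U d V e and v :: "complex vec"
  assume le: "form_le I n U d V e" and v: "v \<in> carrier_vec n"
  then have I: "d k \<in> I" "e k \<in> I" if "k < n" for k using that by (auto simp: form_le_def)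
  have 1: "((\<lambda>\<theta>. spectral_form n U (k \<theta> \<circ> d) v) has_integral spectral_form n U (h \<circ> d) v) S"
    unfolding spectral_form_def o_def using I by (intro has_integral_sum has_integral_mult_left int) auto
  have 2: "((\<lambda>\<theta>. spectral_form n V (k \<theta> \<circ> e) v) has_integral spectral_form n V (h \<circ> e) v) S"
    unfolding spectral_form_def o_def using I by (intro has_integral_sum has_integral_mult_left int) auto
  show "spectral_form n U (h \<circ> d) v \<le> spectral_form n V (h \<circ> e) v"
    by (rule has_integral_le[OF 1 2]) (rule form_monotoneD[OF k le v])
qed

lemma form_monotone_scale:
  assumes f: "form_monotone I f" and c: "c \<ge> 0"
  shows "form_monotone I (\<lambda>t. c * f t)"
proof (rule form_monotoneI)
  fix n U d V e and v :: "complex vec"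
  assume "form_le I n U d V e" "v \<in> carrier_vec n"
  from form_monotoneD[OF f this]
  have "c * spectral_form n U (f \<circ> d) v \<le> c * spectral_form n V (f \<circ> e) v" using c by (rule mult_left_mono)
  then show "spectral_form n U ((\<lambda>t. c * f t) \<circ> d) v \<le> spectral_form n V ((\<lambda>t. c * f t) \<circ> e) v"
    by (simp add: spectral_form_def sum_distrib_left mult_ac)
qed

text \<open>For \<beta> > 0 the function is 1/\<beta> - (\<alpha>/\<beta>) / q(t) with q(t) =
  \<alpha> + \<beta> t, so inversion has to reverse the order. If q(A) \<le> q(B) and w = q(B)^-1 v,
  then 2 Re <v, w> - <q(A) w, w> is at least <q(B)^-1 v, v> and, by completing the square, at most
  <q(A)^-1 v, v>. The point 0 is left out because \<alpha> may vanish.\<close>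

lemma form_monotone_pencil:
  assumes \<alpha>: "\<alpha> \<ge> 0" and \<beta>: "\<beta> \<ge> 0" and "\<alpha> + \<beta> > 0"
  shows "form_monotone {0<..} (\<lambda>t. t / (\<alpha> + \<beta> * t))"
proof (cases "\<beta> = 0")
  case True
  have "form_monotone {0<..} (\<lambda>t::real. t)"
    by (rule form_monotoneI) (simp add: form_le_def o_def)
  from form_monotone_scale[OF this, of "1 / \<alpha>"] show ?thesis using True \<alpha> by simp
next
  case False
  then have \<beta>: "\<beta> > 0" using \<beta> by simp
  show ?thesis
  proof (rule form_monotoneI)
    fix n U d V e and v :: "complex vec"
    assume "form_le {0<..} n U d V e" and v: "v \<in> carrier_vec n"
    then have U: "U \<in> carrier_mat n n" and V: "V \<in> carrier_mat n n" and uU: "unitary_mat U" and uV: "unitary_mat V"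
      and de: "\<forall>k<n. d k > 0 \<and> e k > 0"
      by (auto simp: form_le_def)
    have le: "spectral_form n U d w \<le> spectral_form n V e w" if "w \<in> carrier_vec n" for w
      using \<open>form_le {0<..} n U d V e\<close> that by (simp add: form_le_def)
    define q where "q = (\<lambda>t. \<alpha> + \<beta> * t)"
    have q: "q (d k) > 0" "q (e k) > 0" if "k < n" for k
      using de that \<alpha> \<beta> by (auto simp: q_def intro!: add_nonneg_pos)
    define a where "a = coord n U v"
    define b where "b = coord n V v"
    \<comment> \<open>This is w = q(B)^-1 v, prescribed through its coordinates in the eigenbasis of
      B.\<close>
    obtain w where w: "w \<in> carrier_vec n" and Vw: "\<And>k. k < n \<Longrightarrow> coord n V w k = b k / of_real (q (e k))"
      using coord_surj[OF V uV, of "\<lambda>k. b k / of_real (q (e k))"] by blast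
    define y where "y = coord n U w"
    have norm_eq: "(\<Sum>k<n. (cmod (coord n U z k))\<^sup>2) = (\<Sum>k<n. (cmod (coord n V z k))\<^sup>2)" for z
    proof -
      have "complex_of_real (\<Sum>k<n. (cmod (coord n W z k))\<^sup>2) = (\<Sum>i<n. cnj (z $ i) * z $ i)"
        if "W \<in> carrier_mat n n" "unitary_mat W" for W
        unfolding unitary_parseval[OF that, symmetric] of_real_sum complex_norm_square
        by (simp add: mult.commute)
      from trans[OF this[OF U uU] this[OF V uV, symmetric]] show ?thesis unfolding of_real_eq_iff .
    qed
    have cross: "(\<Sum>k<n. cnj (y k) * a k) = of_real (\<Sum>k<n. (cmod (b k))\<^sup>2 / q (e k))"
    proof -
      have "(\<Sum>k<n. cnj (y k) * a k) = (\<Sum>k<n. cnj (coord n V w k) * coord n V v k)"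
        unfolding y_def a_def unitary_parseval[OF U uU] unitary_parseval[OF V uV] ..
      also have "\<dots> = (\<Sum>k<n. of_real ((cmod (b k))\<^sup>2 / q (e k)))"
        by (intro sum.cong refl) (simp add: Vw b_def[symmetric] complex_norm_square mult.commute del: of_real_power)
      finally show ?thesis by simp
    qed
    have "(\<Sum>k<n. q (d k) * (cmod (y k))\<^sup>2) \<le> (\<Sum>k<n. q (e k) * (cmod (coord n V w k))\<^sup>2)"
    proof -
      have "\<beta> * spectral_form n U d w \<le> \<beta> * spectral_form n V e w" using le[OF w] \<beta> by simp
      then have "\<alpha> * (\<Sum>k<n. (cmod (coord n U w k))\<^sup>2) + \<beta> * spectral_form n U d w
        \<le> \<alpha> * (\<Sum>k<n. (cmod (coord n V w k))\<^sup>2) + \<beta> * spectral_form n V e w"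
        unfolding norm_eq by simp
      then show ?thesis
        unfolding spectral_form_coord y_def q_def by (simp add: sum_distrib_left sum.distrib distrib_right mult.assoc)
    qed
    also have "\<dots> = (\<Sum>k<n. (cmod (b k))\<^sup>2 / q (e k))"
      using q by (intro sum.cong refl) (auto simp: Vw norm_divide power_divide power2_eq_square)
    finally have 1: "(\<Sum>k<n. q (d k) * (cmod (y k))\<^sup>2) \<le> (\<Sum>k<n. (cmod (b k))\<^sup>2 / q (e k))" .
    have "2 * (\<Sum>k<n. Re (cnj (y k) * a k)) - (\<Sum>k<n. q (d k) * (cmod (y k))\<^sup>2)
       = (\<Sum>k<n. 2 * Re (cnj (y k) * a k) - q (d k) * (cmod (y k))\<^sup>2)"
      by (simp add: sum_subtractf sum_distrib_left)
    also have "\<dots> \<le> (\<Sum>k<n. (cmod (a k))\<^sup>2 / q (d k))"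
    proof (intro sum_mono)
      fix k assume "k \<in> {..<n}"
      then have k: "q (d k) > 0" using q by simp
      have "Re (cnj (y k) * a k) \<le> cmod (y k) * cmod (a k)"
        using complex_Re_le_cmod[of "cnj (y k) * a k"] by (simp add: norm_mult)
      moreover have "2 * (cmod (y k) * cmod (a k)) \<le> q (d k) * (cmod (y k))\<^sup>2 + (cmod (a k))\<^sup>2 / q (d k)"
      proof -
        have "0 \<le> (q (d k) * cmod (y k) - cmod (a k))\<^sup>2 / q (d k)" using k by simp
        also have "\<dots> = q (d k) * (cmod (y k))\<^sup>2 + (cmod (a k))\<^sup>2 / q (d k) - 2 * (cmod (y k) * cmod (a k))"
          using k by (simp add: field_simps power2_eq_square)
        finally show ?thesis by simp
      qed
      ultimately show "2 * Re (cnj (y k) * a k) - q (d k) * (cmod (y k))\<^sup>2 \<le> (cmod (a k))\<^sup>2 / q (d k)" by linarith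
    qed
    finally have "2 * Re (\<Sum>k<n. cnj (y k) * a k) - (\<Sum>k<n. q (d k) * (cmod (y k))\<^sup>2) \<le> (\<Sum>k<n. (cmod (a k))\<^sup>2 / q (d k))"
      by (simp only: Re_sum)
    then have inv: "(\<Sum>k<n. (cmod (b k))\<^sup>2 / q (e k)) \<le> (\<Sum>k<n. (cmod (a k))\<^sup>2 / q (d k))"
      using 1 unfolding cross Re_complex_of_real by linarith
    have split: "(\<Sum>k<n. (c k / (\<alpha> + \<beta> * c k)) * s k) = (1 / \<beta>) * (\<Sum>k<n. s k) - (\<alpha> / \<beta>) * (\<Sum>k<n. s k / q (c k))"
      if "\<And>k. k < n \<Longrightarrow> q (c k) > 0" for c s :: "nat \<Rightarrow> real"
      unfolding sum_distrib_left sum_subtractf[symmetric]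
    proof (intro sum.cong refl)
      fix k assume "k \<in> {..<n}"
      then have "\<alpha> + \<beta> * c k \<noteq> 0" using that[of k] by (simp add: q_def)
      then show "(c k / (\<alpha> + \<beta> * c k)) * s k = 1 / \<beta> * s k - \<alpha> / \<beta> * (s k / q (c k))"
        unfolding q_def using \<beta> by (simp add: divide_simps) (simp add: algebra_simps)
    qed
    have "(\<alpha> / \<beta>) * (\<Sum>k<n. (cmod (b k))\<^sup>2 / q (e k)) \<le> (\<alpha> / \<beta>) * (\<Sum>k<n. (cmod (a k))\<^sup>2 / q (d k))"
      using inv \<alpha> \<beta> by (intro mult_left_mono) auto
    moreover have "spectral_form n U ((\<lambda>t. t / (\<alpha> + \<beta> * t)) \<circ> d) v
        = (1 / \<beta>) * (\<Sum>k<n. (cmod (a k))\<^sup>2) - (\<alpha> / \<beta>) * (\<Sum>k<n. (cmod (a k))\<^sup>2 / q (d k))"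
      unfolding spectral_form_coord o_def a_def by (rule split[OF q(1)])
    moreover have "spectral_form n V ((\<lambda>t. t / (\<alpha> + \<beta> * t)) \<circ> e) v
        = (1 / \<beta>) * (\<Sum>k<n. (cmod (b k))\<^sup>2) - (\<alpha> / \<beta>) * (\<Sum>k<n. (cmod (b k))\<^sup>2 / q (e k))"
      unfolding spectral_form_coord o_def b_def by (rule split[OF q(2)])
    moreover have "(\<Sum>k<n. (cmod (a k))\<^sup>2) = (\<Sum>k<n. (cmod (b k))\<^sup>2)"
      unfolding a_def b_def by (rule norm_eq)
    ultimately show "spectral_form n U ((\<lambda>t. t / (\<alpha> + \<beta> * t)) \<circ> d) v \<le> spectral_form n V ((\<lambda>t. t / (\<alpha> + \<beta> * t)) \<circ> e) v"
      by simp
  qed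
qed

text \<open>Cauchy's formula at w for G(\<rho> \<zeta>) (1 - w^2) / (1 - w \<zeta>). The extra
  factor is 1 at \<zeta> = w, and on the unit circle it turns the Cauchy kernel into the real
  Poisson kernel, so real parts can be taken under the integral.\<close>

lemma poisson_real_axis:
  assumes G: "G holomorphic_on ball 0 1" and w: "\<bar>w\<bar> < 1" and \<rho>: "0 < \<rho>" "\<rho> < 1"
  shows "((\<lambda>\<theta>. Re (G (of_real \<rho> * cis \<theta>)) * ((1 - w\<^sup>2) / (1 - 2 * w * cos \<theta> + w\<^sup>2)) / (2 * pi))
     has_integral Re (G (of_real (\<rho> * w)))) {0..2 * pi}"
proof -
  have w2: "1 - w\<^sup>2 > 0" using w by (simp add: abs_square_less_1)
  define \<phi> where "\<phi> = (\<lambda>\<zeta>. G (of_real \<rho> * \<zeta>) * of_real (1 - w\<^sup>2) / (1 - of_real w * \<zeta>))"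
  have nz: "1 - of_real w * \<zeta> \<noteq> 0" if "cmod \<zeta> \<le> 1" for \<zeta> :: complex
  proof
    assume "1 - of_real w * \<zeta> = 0"
    then have "cmod (of_real w * \<zeta>) = 1" by (metis eq_iff_diff_eq_0 norm_one)
    moreover have "cmod (of_real w * \<zeta>) \<le> \<bar>w\<bar> * 1" unfolding norm_mult norm_of_real using that by (intro mult_left_mono) auto
    ultimately show False using w by simp
  qed
  have in_ball: "of_real \<rho> * \<zeta> \<in> ball 0 1" if "cmod \<zeta> \<le> 1" for \<zeta> :: complex
  proof -
    have "\<rho> * cmod \<zeta> \<le> \<rho> * 1" using that \<rho> by (intro mult_left_mono) auto
    then have "\<rho> * cmod \<zeta> < 1" using \<rho> by linarith
    then show ?thesis using \<rho> by (simp add: norm_mult)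
  qed
  have "\<phi> holomorphic_on cball 0 1"
  proof -
    have "(\<lambda>\<zeta>. G (of_real \<rho> * \<zeta>)) holomorphic_on cball 0 1"
      by (rule holomorphic_on_compose_gen[OF _ G, of "\<lambda>\<zeta>. of_real \<rho> * \<zeta>", unfolded o_def])
         (auto intro!: holomorphic_intros in_ball[unfolded mem_ball dist_0_norm] simp del: norm_mult)
    then show ?thesis unfolding \<phi>_def using nz by (intro holomorphic_intros) auto
  qed
  from Cauchy_integral_circlepath_simple[OF this, of "of_real w"]
  have "((\<lambda>u. \<phi> u / (u - of_real w)) has_contour_integral (2 * of_real pi * \<i> * \<phi> (of_real w))) (part_circlepath 0 1 0 (2 * pi))"
    using w by (simp add: circlepath_def)
  then have 1: "((\<lambda>\<theta>. \<phi> (0 + of_real 1 * cis \<theta>) / (0 + of_real 1 * cis \<theta> - of_real w) * of_real 1 * \<i> * cis \<theta>)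
      has_integral (2 * of_real pi * \<i> * \<phi> (of_real w))) {0..2 * pi}"
    by (subst (asm) has_contour_integral_part_circlepath_iff) auto
  have "((\<lambda>\<theta>. \<phi> (0 + of_real 1 * cis \<theta>) / (0 + of_real 1 * cis \<theta> - of_real w) * of_real 1 * \<i> * cis \<theta> * (1 / (2 * of_real pi * \<i>)))
      has_integral (2 * of_real pi * \<i> * \<phi> (of_real w) * (1 / (2 * of_real pi * \<i>)))) {0..2 * pi}"
    by (rule has_integral_mult_left[OF 1])
  also have "2 * of_real pi * \<i> * \<phi> (of_real w) * (1 / (2 * of_real pi * \<i>)) = G (of_real (\<rho> * w))"
  proof -
    have "1 - complex_of_real w * of_real w = of_real (1 - w\<^sup>2)" by (simp add: power2_eq_square)
    moreover have "complex_of_real (1 - w\<^sup>2) \<noteq> 0" using w2 by (simp only: of_real_eq_0_iff)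
    ultimately show ?thesis by (simp add: \<phi>_def)
  qed
  finally have 2: "((\<lambda>\<theta>. \<phi> (0 + of_real 1 * cis \<theta>) / (0 + of_real 1 * cis \<theta> - of_real w) * of_real 1 * \<i> * cis \<theta> * (1 / (2 * of_real pi * \<i>)))
      has_integral G (of_real (\<rho> * w))) {0..2 * pi}" .
  have eq: "\<phi> (0 + of_real 1 * cis \<theta>) / (0 + of_real 1 * cis \<theta> - of_real w) * of_real 1 * \<i> * cis \<theta> * (1 / (2 * of_real pi * \<i>))
     = G (of_real \<rho> * cis \<theta>) * of_real ((1 - w\<^sup>2) / (1 - 2 * w * cos \<theta> + w\<^sup>2) / (2 * pi))" for \<theta>
  proof -
    define \<zeta> where "\<zeta> = cis \<theta>"
    have \<zeta>: "\<zeta> \<noteq> 0" "1 - of_real w * \<zeta> \<noteq> 0" "1 - of_real w * cnj \<zeta> \<noteq> 0" "cnj \<zeta> * \<zeta> = 1"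
      using nz[of \<zeta>] nz[of "cnj \<zeta>"] by (auto simp: \<zeta>_def cis_cnj cis_mult)
    have den: "(1 - of_real w * \<zeta>) * (1 - of_real w * cnj \<zeta>) = of_real (1 - 2 * w * cos \<theta> + w\<^sup>2)"
      by (simp add: complex_eq_iff \<zeta>_def algebra_simps power2_eq_square)
         (metis (no_types, opaque_lifting) mult.left_commute cos_squared_eq power2_eq_square sin_cos_squared_add3 distrib_left mult.right_neutral)
    have "\<zeta> - of_real w = \<zeta> * (1 - of_real w * cnj \<zeta>)" using \<zeta>(4) by (simp add: algebra_simps)
    then have "\<phi> \<zeta> / (\<zeta> - of_real w) * \<zeta> = G (of_real \<rho> * \<zeta>) * of_real (1 - w\<^sup>2) / ((1 - of_real w * \<zeta>) * (1 - of_real w * cnj \<zeta>))"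
      using \<zeta> by (simp add: \<phi>_def)
    then have "\<phi> \<zeta> / (\<zeta> - of_real w) * \<zeta> * (1 / (2 * of_real pi)) = G (of_real \<rho> * \<zeta>) * of_real ((1 - w\<^sup>2) / (1 - 2 * w * cos \<theta> + w\<^sup>2) / (2 * pi))"
      unfolding den by simp
    then show ?thesis by (simp add: \<zeta>_def)
  qed
  have "((\<lambda>\<theta>. Re (G (of_real \<rho> * cis \<theta>) * of_real ((1 - w\<^sup>2) / (1 - 2 * w * cos \<theta> + w\<^sup>2) / (2 * pi)))) has_integral Re (G (of_real (\<rho> * w)))) {0..2 * pi}"
    using has_integral_linear[OF 2 bounded_linear_Re] unfolding o_def eq .
  then show ?thesis by (simp del: of_real_divide add: mult.assoc)
qed

text \<open>The Cayley map sends the real point \<open>w t\<close> of the disc to sqrt t. Multiplied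
  by sqrt t, the Poisson kernel at angle \<theta> becomes a multiple of t / ((1 + cos \<theta>) + (1
  - cos \<theta>) t), which is operator monotone; the weight Re G is non-negative.\<close>

theorem positive_real_form_monotone:
  assumes H: "H holomorphic_on {z. 0 < Re z}" and pos: "\<And>z. 0 < Re z \<Longrightarrow> 0 \<le> Re (H z)"
  shows "form_monotone {0<..} (\<lambda>t. sqrt t * Re (H (of_real (sqrt t))))"
proof -
  define G where "G = (\<lambda>w. H ((1 + w) / (1 - w)))"
  have cayley: "0 < Re ((1 + w) / (1 - w))" if "cmod w < 1" for w
  proof -
    have "Re ((1 + w) * cnj (1 - w)) = 1 - (cmod w)\<^sup>2"
      unfolding cmod_power2 by (simp add: algebra_simps power2_eq_square)
    moreover have "(cmod w)\<^sup>2 < 1" using that by (simp add: abs_square_less_1)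
    moreover have "w \<noteq> 1" using that by auto
    ultimately show ?thesis by (simp add: complex_div_cnj[of "1 + w"] flip: of_real_power)
  qed
  have Gh: "G holomorphic_on ball 0 1"
    unfolding G_def
    by (rule holomorphic_on_compose_gen[OF _ H, of "\<lambda>w. (1 + w) / (1 - w)", unfolded o_def])
       (auto intro!: holomorphic_intros cayley)
  have Gpos: "0 \<le> Re (G w)" if "cmod w < 1" for w
    unfolding G_def by (rule pos[OF cayley[OF that]])
  define w where "w = (\<lambda>t::real. (sqrt t - 1) / (sqrt t + 1))"
  have w1: "\<bar>w t\<bar> < 1" if "t > 0" for t
  proof -
    have "\<bar>sqrt t - 1\<bar> < sqrt t + 1" using that by (simp add: abs_less_iff)
    moreover have "\<bar>sqrt t + 1\<bar> = sqrt t + 1" using that by (simp add: add_nonneg_nonneg)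
    ultimately show ?thesis using that by (simp add: w_def abs_divide add_pos_pos)
  qed
  have kernel: "sqrt t * ((1 - (w t)\<^sup>2) / (1 - 2 * w t * c + (w t)\<^sup>2)) = 2 * (t / ((1 + c) + (1 - c) * t))"
    if t: "t > 0" for t c
  proof -
    define s where "s = sqrt t"
    have s: "s > 0" "t = s * s" using t by (auto simp: s_def)
    have w: "w t = (s - 1) / (s + 1)" by (simp add: w_def s_def)
    have "s + 1 \<noteq> 0" using s by simp
    then have "1 - (w t)\<^sup>2 = 4 * s / (s + 1)\<^sup>2"
       "1 - 2 * w t * c + (w t)\<^sup>2 = 2 * ((1 + c) + (1 - c) * (s * s)) / (s + 1)\<^sup>2"
      unfolding w by (simp_all add: divide_simps) (simp_all add: algebra_simps power2_eq_square)
    then have e: "1 - (w t)\<^sup>2 = 4 * s / (s + 1)\<^sup>2"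
       "1 - 2 * w t * c + (w t)\<^sup>2 = 2 * ((1 + c) + (1 - c) * t) / (s + 1)\<^sup>2"
      unfolding s(2)[symmetric] by auto
    have cancel: "s * (4 * s / Y / (2 * X / Y)) = 2 * (s * s / X)" if "Y \<noteq> 0" for X Y :: real
      using that by (cases "X = 0") (auto simp: field_simps)
    have "(s + 1)\<^sup>2 \<noteq> 0" using \<open>s + 1 \<noteq> 0\<close> by simp
    then show ?thesis unfolding s_def[symmetric] e by (rule cancel[unfolded s(2)[symmetric]])
  qed
  have step: "form_monotone {0<..} (\<lambda>t. sqrt t * Re (G (of_real (\<rho> * w t))))" if \<rho>: "0 < \<rho>" "\<rho> < 1" for \<rho>
  proof (rule form_monotone_integral)
    fix t :: real assume "t \<in> {0<..}"
    then have t: "t > 0" by simp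
    have "((\<lambda>\<theta>. sqrt t * (Re (G (of_real \<rho> * cis \<theta>)) * ((1 - (w t)\<^sup>2) / (1 - 2 * w t * cos \<theta> + (w t)\<^sup>2)) / (2 * pi)))
       has_integral sqrt t * Re (G (of_real (\<rho> * w t)))) {0..2 * pi}"
      by (intro has_integral_mult_right poisson_real_axis Gh w1 t \<rho>)
    moreover have "sqrt t * (Re (G (of_real \<rho> * cis \<theta>)) * ((1 - (w t)\<^sup>2) / (1 - 2 * w t * cos \<theta> + (w t)\<^sup>2)) / (2 * pi))
       = (Re (G (of_real \<rho> * cis \<theta>)) / pi) * (t / ((1 + cos \<theta>) + (1 - cos \<theta>) * t))" for \<theta>
    proof -
      have "sqrt t * (Re (G (of_real \<rho> * cis \<theta>)) * ((1 - (w t)\<^sup>2) / (1 - 2 * w t * cos \<theta> + (w t)\<^sup>2)) / (2 * pi))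
        = Re (G (of_real \<rho> * cis \<theta>)) / (2 * pi) * (sqrt t * ((1 - (w t)\<^sup>2) / (1 - 2 * w t * cos \<theta> + (w t)\<^sup>2)))"
        by (simp add: mult_ac)
      then show ?thesis unfolding kernel[OF t] by simp
    qed
    ultimately show "((\<lambda>\<theta>. (Re (G (of_real \<rho> * cis \<theta>)) / pi) * (t / ((1 + cos \<theta>) + (1 - cos \<theta>) * t)))
       has_integral sqrt t * Re (G (of_real (\<rho> * w t)))) {0..2 * pi}" by simp
  next
    fix \<theta> :: real
    have "cmod (of_real \<rho> * cis \<theta>) < 1" using \<rho> by (simp add: norm_mult)
    moreover have "0 \<le> 1 + cos \<theta>" "0 \<le> 1 - cos \<theta>"
      using cos_ge_minus_one[of \<theta>] cos_le_one[of \<theta>] by linarith+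
    ultimately show "form_monotone {0<..} (\<lambda>t. (Re (G (of_real \<rho> * cis \<theta>)) / pi) * (t / ((1 + cos \<theta>) + (1 - cos \<theta>) * t)))"
      by (intro form_monotone_scale form_monotone_pencil divide_nonneg_pos Gpos) auto
  qed
  show ?thesis
  proof (rule form_monotone_tendsto)
    \<comment> \<open>\<open>G\<close> need not extend to the unit circle, so the formula is used on
      radii below 1 that tend to 1. The double \<open>Suc\<close> keeps the first radius
      positive.\<close>
    define \<rho> where "\<rho> = (\<lambda>j::nat. 1 - inverse (real (Suc (Suc j))))"
    have \<rho>: "0 < \<rho> j \<and> \<rho> j < 1" for j by (auto simp: \<rho>_def inverse_eq_divide field_simps)
    show "form_monotone {0<..} (\<lambda>t. sqrt t * Re (G (of_real (\<rho> j * w t))))" for j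
      using step \<rho> by blast
    fix t :: real assume "t \<in> {0<..}"
    then have t: "t > 0" by simp
    have "\<rho> \<longlonglongrightarrow> 1 - 0"
      unfolding \<rho>_def by (intro tendsto_intros LIMSEQ_Suc[OF LIMSEQ_inverse_real_of_nat])
    then have "(\<lambda>j. complex_of_real (\<rho> j * w t)) \<longlonglongrightarrow> of_real (1 * w t)"
      by (intro tendsto_intros) auto
    then have "(\<lambda>j. G (of_real (\<rho> j * w t))) \<longlonglongrightarrow> G (of_real (1 * w t))"
    proof (rule continuous_on_tendsto_compose[OF holomorphic_on_imp_continuous_on[OF Gh]])
      show "\<forall>\<^sub>F j in sequentially. complex_of_real (\<rho> j * w t) \<in> ball 0 1"
      proof (intro always_eventually allI)
        fix j
        have "\<rho> j * \<bar>w t\<bar> \<le> 1 * \<bar>w t\<bar>" using \<rho>[of j] by (intro mult_right_mono) auto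
        then show "complex_of_real (\<rho> j * w t) \<in> ball 0 1"
          using w1[OF t] \<rho>[of j] by (simp add: norm_mult abs_mult)
      qed
    qed (use w1[OF t] in simp)
    moreover have "G (of_real (1 * w t)) = H (of_real (sqrt t))"
    proof -
      have "(1 + w t) / (1 - w t) = sqrt t"
      proof -
        have "sqrt t > 0" using t by simp
        then have "sqrt t + 1 \<noteq> 0" by linarith
        then show ?thesis by (simp add: w_def field_simps)
      qed
      then have "(1 + complex_of_real (w t)) / (1 - of_real (w t)) = of_real (sqrt t)"
        by (metis of_real_1 of_real_add of_real_diff of_real_divide)
      then show ?thesis by (simp add: G_def)
    qed
    ultimately show "(\<lambda>j. sqrt t * Re (G (of_real (\<rho> j * w t)))) \<longlonglongrightarrow> sqrt t * Re (H (of_real (sqrt t)))"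
      by (intro tendsto_intros) auto
  qed
qed

section \<open>Arguments in the upper half-plane\<close>

lemma slit_identity:
  assumes F: "F holomorphic_on slit" and G: "G holomorphic_on slit" and sr: "0 < s" "s < r"
    and eq: "\<And>t. s < t \<Longrightarrow> t < r \<Longrightarrow> F (of_real t) = G (of_real t)" and w: "w \<in> slit"
  shows "F w = G w"
proof -
  define \<xi> where "\<xi> = (s + r) / 2"
  have \<xi>: "s < \<xi>" "\<xi> < r" using sr by (auto simp: \<xi>_def)
  have "complex_of_real \<xi> islimpt complex_of_real ` {s<..<r}"
    unfolding islimpt_approachable
  proof (intro allI impI)
    fix e :: real assume e: "e > 0"
    define t where "t = \<xi> + min (e / 2) ((r - \<xi>) / 2)"
    have "s < t" "t < r" "t \<noteq> \<xi>" "\<bar>t - \<xi>\<bar> < e" using e \<xi> by (auto simp: t_def min_def field_simps)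
    then show "\<exists>x'\<in>complex_of_real ` {s<..<r}. x' \<noteq> of_real \<xi> \<and> dist x' (of_real \<xi>) < e"
      by (intro bexI[of _ "of_real t"]) (auto simp: dist_norm simp flip: of_real_diff)
  qed
  then have "F w - G w = 0"
  proof (rule analytic_continuation[where f = "\<lambda>z. F z - G z" and S = slit, rotated 5])
    show "(\<lambda>z. F z - G z) holomorphic_on slit" using F G by (intro holomorphic_intros)
    show "complex_of_real ` {s<..<r} \<subseteq> slit" using sr by (auto intro!: of_real_in_slit simp del: ComplI)
    show "complex_of_real \<xi> \<in> slit" using \<xi> sr by (intro of_real_in_slit) auto
    show "F z - G z = 0" if "z \<in> complex_of_real ` {s<..<r}" for z using that eq by auto
  qed (use open_slit connected_slit w in auto)
  then show ?thesis by simp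
qed

lemma Im_mult_cnj_Arg:
  "Im (a * b * cnj c) = cmod a * cmod b * cmod c * sin (Arg a + Arg b - Arg c)"
proof -
  have "a * b * cnj c = rcis (cmod a) (Arg a) * rcis (cmod b) (Arg b) * cnj (rcis (cmod c) (Arg c))"
    by (simp add: rcis_cmod_Arg)
  also have "\<dots> = rcis (cmod a * cmod b * cmod c) (Arg a + Arg b - Arg c)"
  proof -
    have "cis (Arg a + Arg b - Arg c) = cis (Arg a) * cis (Arg b) * cis (- Arg c)" by (simp add: cis_mult)
    then show ?thesis unfolding rcis_def by (simp add: cis_cnj mult_ac)
  qed
  finally show ?thesis by simp
qed

lemma sin_nonneg_imp_nonneg:
  assumes "- pi < s" "s < pi" "0 \<le> sin s"
  shows "0 \<le> s"
proof (rule ccontr)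
  assume "\<not> 0 \<le> s"
  then have "0 < sin (- s)" using assms by (intro sin_gt_zero) auto
  then show False using assms by simp
qed

text \<open>\<open>Arg\<close> is additive only modulo 2 pi. Once the combination is known to lie
  strictly between -pi and pi, the sign of its sine decides its own sign.\<close>

lemma Arg_sum_nonneg:
  assumes "0 \<le> Im (a * b * cnj c)" "a \<noteq> 0" "b \<noteq> 0" "c \<noteq> 0"
    "- pi < Arg a + Arg b - Arg c" "Arg a + Arg b - Arg c < pi"
  shows "0 \<le> Arg a + Arg b - Arg c"
proof (rule sin_nonneg_imp_nonneg)
  have "0 < cmod a * cmod b * cmod c" using assms by simp
  then show "0 \<le> sin (Arg a + Arg b - Arg c)"
    using assms(1) unfolding Im_mult_cnj_Arg by (simp only: zero_le_mult_iff) auto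
qed (use assms in auto)

lemma Arg_one [simp]: "Arg 1 = 0"
  using Arg_of_real[of 1] by simp

lemma form_monotone_imp_mono:
  assumes f: "form_monotone I f" and st: "s \<in> I" "t \<in> I" "s \<le> t"
  shows "f s \<le> f t"
proof (cases "s = t")
  case False
  then have "s < t" using st by simp
  have "0 \<le> divided_diff {s, t} (\<lambda>t. (poly 1 t)\<^sup>2 * f t)"
    using st False by (intro divided_diff_nonneg[OF f, of _ 1]) auto
  also have "\<dots> = f s / (s - t) + f t / (t - s)"
    using False by (simp add: divided_diff_def insert_Diff_if)
  also have "\<dots> = (f t - f s) / (t - s)"
    using False by (simp add: diff_divide_distrib minus_divide_right[symmetric]) (metis minus_diff_eq minus_divide_right)
  finally show ?thesis using \<open>s < t\<close> by (simp add: zero_le_divide_iff)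
qed simp

text \<open>Reflection settles the lower half-plane, so only the upper half-plane and the positive
  axis remain to be checked. Values in the slit plane are what makes \<open>Ln\<close> of such a
  function holomorphic.\<close>

lemma slit_valued:
  assumes z: "z \<in> slit" and cnj: "g (cnj z) = cnj (g z)"
    and up: "\<And>w. Im w > 0 \<Longrightarrow> g w \<in> slit" and pos: "\<And>t. t > 0 \<Longrightarrow> \<exists>r>0. g (of_real t) = of_real r"
  shows "g z \<in> slit"
proof -
  consider "Im z > 0" | "Im z < 0" | "Im z = 0" by linarith
  then show ?thesis
  proof cases
    case 2
    then have "cnj (g z) \<in> slit" using up[of "cnj z"] cnj by simp
    then show ?thesis by (auto simp: complex_nonpos_Reals_iff)
  next
    case 3
    then have "Re z > 0" "z = of_real (Re z)" using z by (auto simp: complex_nonpos_Reals_iff complex_eq_iff not_le)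
    then show ?thesis using pos[of "Re z"] by auto
  qed (rule up)
qed

locale pick_extension =
  fixes f :: "real \<Rightarrow> real" and F :: "complex \<Rightarrow> complex"
  assumes holo: "F holomorphic_on slit" and F_real: "\<And>t. t > 0 \<Longrightarrow> F (of_real t) = of_real (f t)"
    and F_cnj: "\<And>z. z \<in> slit \<Longrightarrow> F (cnj z) = cnj (F z)"
    and quot1: "\<And>z a. Im z > 0 \<Longrightarrow> a > 0 \<Longrightarrow> Im (diff_quot F f a z) \<le> 0"
    and quot2: "\<And>z a. Im z > 0 \<Longrightarrow> a > 0 \<Longrightarrow> a * (cmod (diff_quot F f a z))\<^sup>2 * Im z
       \<le> f a * Im (z * (diff_quot F f a z))"
    and antimono: "\<And>s t a. 0 < s \<Longrightarrow> s \<le> t \<Longrightarrow> 0 < a \<Longrightarrow> s \<noteq> a \<Longrightarrow> t \<noteq> a \<Longrightarrow> (f t - f a) / (t - a) \<le> (f s - f a) / (s - a)"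
    and cont: "continuous_on {0..} f" and f_mono: "\<And>s t. 0 \<le> s \<Longrightarrow> s \<le> t \<Longrightarrow> f s \<le> f t" and f0: "f 0 \<ge> 0"

lemma pick_extension_exists:
  assumes f: "operator_monotone_on {0..} f" and f0: "f 0 \<ge> 0"
  obtains F where "pick_extension f F"
proof -
  have "form_monotone {0..} f" "continuous_on {0..} f"
    using f by (auto simp: operator_monotone_on_iff_form)
  note fm = this
  have mono: "f s \<le> f t" if "0 \<le> s" "s \<le> t" for s t
    using form_monotone_imp_mono[OF fm(1), of s t] that by simp
  show ?thesis
  proof (rule operator_monotone_extension[OF f f0], goal_cases)
    case (1 F)
    have "pick_extension f F"
      by (rule pick_extension.intro) (fact 1 fm(2) f0 mono)+
    then show ?case by (rule that)
  qed
qed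

context pick_extension
begin

text \<open>Approach a from the right and use the continuity of f. This reaches a = 0, a point of
  the slit, where \<open>F\<close> carries no information.\<close>

lemma quot_Im:
  assumes z: "Im z > 0" and a: "a \<ge> 0"
  shows "Im (diff_quot F f a z) \<le> 0"
    "a * (cmod (diff_quot F f a z))\<^sup>2 * Im z \<le> f a * Im (z * (diff_quot F f a z))"
proof -
  define s where "s = (\<lambda>j. a + inverse (real (Suc j)))"
  have s: "s j > 0" for j using a by (auto simp: s_def intro: add_nonneg_pos)
  have "s \<longlonglongrightarrow> a + 0" unfolding s_def by (intro tendsto_intros LIMSEQ_inverse_real_of_nat)
  then have lim: "s \<longlonglongrightarrow> a" by simp
  have "(\<lambda>j. f (s j)) \<longlonglongrightarrow> f a"
    by (rule continuous_on_tendsto_compose[OF cont lim]) (use a s in \<open>auto intro!: always_eventually less_imp_le\<close>)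
  then have flim: "(\<lambda>j. complex_of_real (f (s j))) \<longlonglongrightarrow> of_real (f a)" by (rule tendsto_of_real)
  have "z - of_real a \<noteq> 0" using z by (auto simp: complex_eq_iff)
  then have q: "(\<lambda>j. diff_quot F f (s j) z) \<longlonglongrightarrow> diff_quot F f a z"
    by (intro tendsto_intros flim lim)
  show "Im (diff_quot F f a z) \<le> 0"
    by (rule tendsto_upperbound[OF tendsto_Im[OF q]]) (intro always_eventually allI quot1 z s, simp)
  show "a * (cmod (diff_quot F f a z))\<^sup>2 * Im z \<le> f a * Im (z * (diff_quot F f a z))"
  proof (rule LIMSEQ_le)
    show "(\<lambda>j. s j * (cmod (diff_quot F f (s j) z))\<^sup>2 * Im z)
       \<longlonglongrightarrow> a * (cmod (diff_quot F f a z))\<^sup>2 * Im z"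
      by (intro tendsto_intros q lim)
    show "(\<lambda>j. f (s j) * Im (z * (diff_quot F f (s j) z)))
       \<longlonglongrightarrow> f a * Im (z * (diff_quot F f a z))"
      by (intro tendsto_intros q \<open>(\<lambda>j. f (s j)) \<longlonglongrightarrow> f a\<close>)
  qed (use quot2[OF z s] in blast)
qed

text \<open>Write F = f(1) + z u - u with u the difference quotient at 1; the two inequalities give
  Im (z u) \<ge> 0 and Im u \<le> 0.\<close>

lemma Im_nonneg:
  assumes z: "Im z > 0" and f1: "f 1 > 0"
  shows "Im (F z) \<ge> 0"
proof -
  define u where "u = (F z - of_real (f 1)) / (z - of_real 1)"
  have "z - of_real 1 \<noteq> 0" using z by (auto simp: complex_eq_iff)
  then have F: "F z = of_real (f 1) + z * u - u"
  proof -
    have "u * (z - of_real 1) = F z - of_real (f 1)" using \<open>z - of_real 1 \<noteq> 0\<close> by (simp add: u_def)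
    then show ?thesis by (simp add: algebra_simps)
  qed
  have "0 \<le> 1 * (cmod u)\<^sup>2 * Im z" using z by simp
  also have "\<dots> \<le> f 1 * Im (z * u)" unfolding u_def by (rule quot_Im(2)[OF z]) simp
  finally have "0 \<le> Im (z * u)" using f1 by (simp add: zero_le_mult_iff)
  moreover have "Im u \<le> 0" unfolding u_def by (rule quot_Im(1)[OF z]) simp
  ultimately show ?thesis unfolding F by simp
qed

end

locale pick_function = pick_extension +
  assumes nonconst: "\<not> f constant_on {0..}"
begin

text \<open>Equal values at two points make the monotone f constant between them, hence
  \<open>F\<close> constant by the identity theorem, and finally f constant on the whole half-line
  by continuity at 0.\<close>

lemma f_strict_mono:
  assumes "0 \<le> s" "s < t"
  shows "f s < f t"
proof -
  have *: "f s < f t" if st: "0 < s" "s < t" for s t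
  proof (rule ccontr)
    assume "\<not> f s < f t"
    then have "f t = f s" using f_mono[of s t] st by simp
    then have eq: "f x = f s" if "s < x" "x < t" for x
      using f_mono[of s x] f_mono[of x t] st that by simp
    have F: "F w = of_real (f s)" if "w \<in> slit" for w
      by (rule slit_identity[OF holo _ st _ that, of "\<lambda>_. of_real (f s)"])
         (use eq st in \<open>auto simp: F_real intro: holomorphic_on_const\<close>)
    have pos: "f x = f s" if "x > 0" for x
      using F[of "of_real x"] F_real[OF that] that by simp
    have "(\<lambda>j. f (inverse (real (Suc j)))) \<longlonglongrightarrow> f 0"
      by (rule continuous_on_tendsto_compose[OF cont LIMSEQ_inverse_real_of_nat]) (auto intro!: always_eventually)
    then have "(\<lambda>j::nat. f s) \<longlonglongrightarrow> f 0" using pos by simp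
    then have "f 0 = f s" by (simp add: LIMSEQ_const_iff)
    then have "f x = f s" if "x \<ge> 0" for x using pos[of x] that by (cases "x = 0") auto
    then show False using nonconst by (auto simp: constant_on_def)
  qed
  \<comment> \<open>The claim above is for s > 0; passing through the midpoint covers s = 0.\<close>
  show ?thesis
    using assms *[of "(s + t) / 2" t] f_mono[of s "(s + t) / 2"] by simp
qed

lemma f_pos: "t > 0 \<Longrightarrow> f t > 0"
  using f_strict_mono[of 0 t] f0 by simp

text \<open>The image of the upper half-plane is open and lies in the closed upper half-plane, so it
  cannot touch the real axis.\<close>

lemma F_Im_pos:
  assumes z: "Im z > 0"
  shows "Im (F z) > 0"
proof (rule ccontr)
  assume "\<not> Im (F z) > 0"
  then have Fz: "Im (F z) = 0" using Im_nonneg[OF z f_pos] by simp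
  have "\<not> F constant_on slit"
  proof
    assume "F constant_on slit"
    then obtain c where c: "\<And>z. z \<in> slit \<Longrightarrow> F z = c" unfolding constant_on_def by blast
    have "F (of_real 1) = F (of_real 2)"
      using c[OF of_real_in_slit[of 1]] c[OF of_real_in_slit[of 2]] by simp
    then have "f 1 = f 2" using F_real[of 1] F_real[of 2] by simp
    then show False using f_strict_mono[of 1 2] by simp
  qed
  then have "open (F ` {z. 0 < Im z})"
    by (intro open_mapping_thm[OF holo open_slit connected_slit])
       (auto simp: open_halfspace_Im_gt complex_nonpos_Reals_iff)
  moreover have "F z \<in> F ` {z. 0 < Im z}" using z by simp
  ultimately obtain e where e: "e > 0" "ball (F z) e \<subseteq> F ` {z. 0 < Im z}"
    unfolding open_contains_ball by blast
  have "F z - \<i> * of_real (e / 2) \<in> ball (F z) e"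
    using e by (simp add: dist_norm norm_mult)
  then have "F z - \<i> * of_real (e / 2) \<in> F ` {z. 0 < Im z}" using e(2) by (rule subsetD[rotated])
  then obtain w where "0 < Im w" "F w = F z - \<i> * of_real (e / 2)" by (auto simp: image_iff)
  then have "0 \<le> Im (F z - \<i> * of_real (e / 2))" using Im_nonneg[OF _ f_pos, of w] by simp
  then show False using Fz e by simp
qed

text \<open>The quotient u_a with its removable singularity filled. For a = 0 the first branch is
  never met on the slit plane.\<close>

definition u :: "real \<Rightarrow> complex \<Rightarrow> complex" where
  "u a z = (if z = of_real a then deriv F (of_real a) else diff_quot F f a z)"

lemma u_real:
  assumes "t > 0" "t \<noteq> a"
  shows "u a (of_real t) = of_real ((f t - f a) / (t - a))"
  using assms by (simp add: u_def F_real)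

lemma u_holomorphic:
  assumes a: "a \<ge> 0"
  shows "u a holomorphic_on slit"
proof (cases "a = 0")
  case True
  have "(\<lambda>z. (F z - of_real (f 0)) / (z - of_real 0)) holomorphic_on slit"
    using holo by (intro holomorphic_intros) auto
  then show ?thesis
    by (rule holomorphic_transform) (auto simp: True u_def)
next
  case False
  then have a: "a > 0" using a by simp
  have "(\<lambda>z. if z = of_real a then deriv F (of_real a) else (F z - F (of_real a)) / (z - of_real a)) holomorphic_on slit"
    by (rule pole_lemma[OF holo]) (use a of_real_in_slit in \<open>simp only: interior_open[OF open_slit]\<close>)
  then show ?thesis using a by (simp add: u_def[abs_def] F_real cong: if_cong)
qed

lemma u_real_pos:
  assumes t: "t > 0" and a: "a \<ge> 0"
  shows "\<exists>r>0. u a (of_real t) = of_real r"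
proof (cases "t = a")
  case False
  have "(f t - f a) / (t - a) > 0"
    using False f_strict_mono[of t a] f_strict_mono[of a t] t a
    by (cases "t < a") (auto intro: divide_neg_neg divide_pos_pos)
  then show ?thesis using u_real[OF t False] by blast
next
  case True
  \<comment> \<open>The slope from t to 2 t. Slopes at t decrease with the other endpoint, so
    \<open>c\<close> is a lower bound for the slopes to the nearer points \<open>s j\<close>, and
    hence for the derivative.\<close>
  define c where "c = (f (2 * t) - f t) / (2 * t - t)"
  have c: "c > 0" using f_strict_mono[of t "2 * t"] t by (simp add: c_def)
  define s where "s = (\<lambda>j. t + t * inverse (real (Suc (Suc j))))"
  have s: "t < s j" "s j \<le> 2 * t" for j using t by (auto simp: s_def field_simps)
  have "s \<longlonglongrightarrow> t + t * 0" unfolding s_def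
    by (intro tendsto_intros LIMSEQ_Suc[OF LIMSEQ_inverse_real_of_nat])
  then have "(\<lambda>j. complex_of_real (s j)) \<longlonglongrightarrow> of_real t" by (intro tendsto_of_real) simp
  then have lim: "(\<lambda>j. u a (of_real (s j))) \<longlonglongrightarrow> u a (of_real t)"
  proof (rule continuous_on_tendsto_compose[OF holomorphic_on_imp_continuous_on[OF u_holomorphic[OF a]]])
    show "\<forall>\<^sub>F j in sequentially. complex_of_real (s j) \<in> slit"
      by (intro always_eventually allI of_real_in_slit less_trans[OF t s(1)])
  qed (use t in simp)
  have val: "u a (of_real (s j)) = of_real ((f (s j) - f t) / (s j - t))" for j
    using u_real[of "s j" a] s(1)[of j] t True by auto
  have "c \<le> Re (u a (of_real (s j)))" for j
    unfolding val Re_complex_of_real c_def using s[of j] t by (intro antimono) auto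
  then have "c \<le> Re (u a (of_real t))"
    by (intro tendsto_lowerbound[OF tendsto_Re[OF lim]]) (auto intro: always_eventually)
  moreover have "Im (u a (of_real t)) = 0"
    using tendsto_Im[OF lim] unfolding val by (simp add: LIMSEQ_const_iff)
  ultimately show ?thesis using c
    by (intro exI[of _ "Re (u a (of_real t))"]) (auto simp: complex_eq_iff)
qed

lemma u_cnj:
  assumes z: "z \<in> slit" and a: "a \<ge> 0"
  shows "u a (cnj z) = cnj (u a z)"
proof (cases "z = of_real a")
  case True
  then have "a \<noteq> 0" using z by auto
  then obtain r where "u a (of_real a) = of_real r" using u_real_pos[of a a] a by auto
  then show ?thesis using True by simp
next
  case False
  then have "cnj z \<noteq> of_real a" by (metis complex_cnj_cnj complex_cnj_complex_of_real)
  then show ?thesis using False z by (simp add: u_def F_cnj)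
qed

lemma u_upper:
  assumes z: "Im z > 0" and a: "a \<ge> 0"
  shows "Im (u a z) \<le> 0" "a * (cmod (u a z))\<^sup>2 * Im z \<le> f a * Im (z * u a z)"
    "F z = of_real (f a) + (z - of_real a) * u a z" "u a z \<noteq> 0" "Im (z * u a z) > 0"
proof -
  have ne: "z \<noteq> of_real a" using z by auto
  then have u: "u a z = diff_quot F f a z" by (simp add: u_def)
  show 1: "Im (u a z) \<le> 0" and 2: "a * (cmod (u a z))\<^sup>2 * Im z \<le> f a * Im (z * u a z)"
    unfolding u using quot_Im[OF z a] by auto
  show 3: "F z = of_real (f a) + (z - of_real a) * u a z" using ne by (simp add: u)
  show 4: "u a z \<noteq> 0" using 3 F_Im_pos[OF z] by auto
  \<comment> \<open>For a = 0 the left side of the quadratic inequality vanishes, but then z u is F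
    - f(0).\<close>
  show "Im (z * u a z) > 0"
  proof (cases "a = 0")
    case True
    then show ?thesis using 3 F_Im_pos[OF z] by simp
  next
    case False
    then have "0 < a * (cmod (u a z))\<^sup>2 * Im z" using a z 4 by simp
    then have "0 < f a * Im (z * u a z)" using 2 by linarith
    then show ?thesis using f_pos[of a] a False by (simp add: zero_less_mult_iff)
  qed
qed

text \<open>If u were real and non-positive at a point of the upper half-plane, the imaginary part
  of z u could not be positive.\<close>

lemma u_slit:
  assumes z: "z \<in> slit" and a: "a \<ge> 0"
  shows "u a z \<in> slit"
proof -
  have up: "u a z \<in> slit" if "Im z > 0" for z
  proof
    assume "u a z \<in> \<real>\<^sub>\<le>\<^sub>0"
    then have "Im (u a z) = 0" "Re (u a z) \<le> 0" by (auto simp: complex_nonpos_Reals_iff)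
    moreover have "0 < Re z * Im (u a z) + Im z * Re (u a z)" using u_upper(5)[OF that a] by simp
    ultimately have "0 < Im z * Re (u a z)" by simp
    then show False using that \<open>Re (u a z) \<le> 0\<close> by (simp add: zero_less_mult_iff)
  qed
  show ?thesis by (rule slit_valued[OF z u_cnj[OF z a] up u_real_pos[OF _ a]])
qed

lemma F_slit: "z \<in> slit \<Longrightarrow> F z \<in> slit"
proof (rule slit_valued[where g = F, OF _ F_cnj])
  show "F w \<in> slit" if "Im w > 0" for w by (rule Im_pos_in_slit[OF F_Im_pos[OF that]])
  show "\<exists>r>0. F (of_real t) = of_real r" if "t > 0" for t using f_pos[OF that] F_real[OF that] by blast
qed

text \<open>This is (z F(z) - b f(b)) / (z - b), the denominator of a factor in (2), written so that
  the singularity at b is already removed. It also equals f(b) + z u_b(z), which shows that its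
  imaginary part is positive in the upper half-plane.\<close>

definition D :: "real \<Rightarrow> complex \<Rightarrow> complex" where
  "D b z = F z + of_real b * u b z"

lemma D_upper:
  assumes z: "Im z > 0" and b: "b \<ge> 0"
  shows "Im (D b z) > 0"
proof -
  have "D b z = of_real (f b) + z * u b z"
    unfolding D_def u_upper(3)[OF assms] by (simp add: algebra_simps)
  then show ?thesis using u_upper(5)[OF assms] by simp
qed

lemma D_cnj: "z \<in> slit \<Longrightarrow> b \<ge> 0 \<Longrightarrow> D b (cnj z) = cnj (D b z)"
  by (simp add: D_def F_cnj u_cnj)

lemma D_slit:
  assumes z: "z \<in> slit" and b: "b \<ge> 0"
  shows "D b z \<in> slit"
proof (rule slit_valued[OF z D_cnj[OF z b]])
  show "D b w \<in> slit" if "Im w > 0" for w using D_upper[OF that b] by (rule Im_pos_in_slit)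
  fix t :: real assume t: "t > 0"
  obtain r where r: "r > 0" "u b (of_real t) = of_real r" using u_real_pos[OF t b] by auto
  then have "D b (of_real t) = of_real (f t + b * r)" using t by (simp add: D_def F_real)
  moreover have "f t + b * r > 0" using f_pos[OF t] r b by (simp add: add_pos_nonneg)
  ultimately show "\<exists>r>0. D b (of_real t) = of_real r" by blast
qed

lemma D_holomorphic: "b \<ge> 0 \<Longrightarrow> D b holomorphic_on slit"
  unfolding D_def[abs_def] by (intro holomorphic_intros holo u_holomorphic)

text \<open>Substituting F = f(a) + (z - a) u gives Im (z u cnj F) = f(a) Im (z u) - a |u|^2 Im z,
  so the quadratic inequality is precisely the second bound.\<close>

lemma Arg_u:
  assumes z: "Im z > 0" and a: "a \<ge> 0"
  shows "Arg (u a z) \<le> 0" "Arg (F z) \<le> Arg (u a z) + Arg z"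
proof -
  note u = u_upper[OF z a]
  have z0: "z \<noteq> 0" and F0: "F z \<noteq> 0" using z F_Im_pos[OF z] by auto
  have Az: "0 < Arg z" "Arg z < pi" using z Arg_lt_pi by blast+
  have AF: "0 < Arg (F z)" "Arg (F z) < pi" using F_Im_pos[OF z] Arg_lt_pi by blast+
  have upi: "- pi < Arg (u a z)" "Arg (u a z) < pi"
  proof -
    have "u a z \<in> slit" using u_slit[OF Im_pos_in_slit[OF z] a] .
    then have "Arg (u a z) \<noteq> pi" by (metis ComplD Arg_eq_pi complex_nonpos_Reals_iff less_imp_le)
    then show "- pi < Arg (u a z)" "Arg (u a z) < pi" using Arg_bounded[of "u a z"] by auto
  qed
  \<comment> \<open>Trivial factors 1 reduce the three-term lemma to the sign of a single
    argument.\<close>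
  have "0 \<le> Arg 1 + Arg 1 - Arg (u a z)"
    by (rule Arg_sum_nonneg) (use u upi in auto)
  then show 1: "Arg (u a z) \<le> 0" by simp
  have "0 \<le> Arg z + Arg (u a z) - Arg 1"
    by (rule Arg_sum_nonneg) (use u upi Az 1 z0 in auto)
  then have 2: "0 \<le> Arg z + Arg (u a z)" by simp
  have "0 \<le> Arg z + Arg (u a z) - Arg (F z)"
  proof (rule Arg_sum_nonneg)
    have "z * u a z * cnj (F z) = of_real (f a) * (z * u a z) + of_real ((cmod (u a z))\<^sup>2) * (z * (cnj z - of_real a))"
      unfolding u(3) complex_norm_square by (simp add: algebra_simps)
    also have "z * (cnj z - of_real a) = of_real ((cmod z)\<^sup>2) - of_real a * z"
      unfolding complex_norm_square by (simp add: algebra_simps)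
    finally have "Im (z * u a z * cnj (F z)) = f a * Im (z * u a z) - a * (cmod (u a z))\<^sup>2 * Im z"
      by (simp del: of_real_power)
    then show "0 \<le> Im (z * u a z * cnj (F z))" using u(2) by simp
  qed (use u z0 F0 upi Az AF 1 2 in auto)
  then show "Arg (F z) \<le> Arg (u a z) + Arg z" by simp
qed

lemma Arg_F_le:
  assumes z: "Im z > 0"
  shows "Arg (F z) \<le> Arg z"
  using Arg_u[OF z, of 0] by simp

text \<open>Expanding with F = f(b) + (z - b) u yields Im (F cnj D) = b (|u|^2 Im z - f(b) Im u),
  where both terms are non-negative because Im u \<le> 0.\<close>

lemma Arg_D:
  assumes z: "Im z > 0" and b: "b \<ge> 0"
  shows "0 \<le> Arg (D b z)" "Arg (D b z) \<le> Arg (F z)"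
proof -
  have AD: "0 < Arg (D b z)" "Arg (D b z) < pi" using D_upper[OF z b] Arg_lt_pi by blast+
  have AF: "0 < Arg (F z)" "Arg (F z) < pi" using F_Im_pos[OF z] Arg_lt_pi by blast+
  show "0 \<le> Arg (D b z)" using AD by simp
  note u = u_upper[OF z b]
  have "0 \<le> Arg (F z) + Arg 1 - Arg (D b z)"
  proof (rule Arg_sum_nonneg)
    have "F z * cnj (D b z) = F z * cnj (F z) + of_real b * (F z * cnj (u b z))"
      by (simp add: D_def algebra_simps)
    moreover have "F z * cnj (u b z) = of_real (f b) * cnj (u b z) + (z - of_real b) * of_real ((cmod (u b z))\<^sup>2)"
      unfolding u(3) complex_norm_square by (simp add: algebra_simps)
    moreover have "F z * cnj (F z) = of_real ((cmod (F z))\<^sup>2)" by (rule complex_norm_square[symmetric])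
    ultimately have "Im (F z * 1 * cnj (D b z)) = b * (Im z * (cmod (u b z))\<^sup>2 - f b * Im (u b z))"
      by (simp del: of_real_power)
    moreover have "0 \<le> f b" using f_mono[of 0 b] f0 b by simp
    moreover have "0 \<le> Im z * (cmod (u b z))\<^sup>2" using z by simp
    moreover have "f b * Im (u b z) \<le> 0" using u(1) \<open>0 \<le> f b\<close> by (simp add: mult_nonneg_nonpos)
    ultimately show "0 \<le> Im (F z * 1 * cnj (D b z))" using b by simp
  qed (use AD AF D_upper[OF z b] F_Im_pos[OF z] in auto)
  then show "Arg (D b z) \<le> Arg (F z)" by simp
qed

end

section \<open>From bounds on a logarithm to operator monotonicity\<close>

lemma Ln_power2_half_plane:
  assumes "Re z > 0"
  shows "Ln (z\<^sup>2) = 2 * Ln z"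
proof (rule Ln_unique)
  have "z \<noteq> 0" using assms by auto
  then show "exp (2 * Ln z) = z\<^sup>2" by (simp add: exp_double)
  show "- pi < Im (2 * Ln z)" "Im (2 * Ln z) \<le> pi"
    using Re_Ln_pos_lt_imp[OF assms] by (auto simp: abs_less_iff)
qed

text \<open>The bounds on \<open>Im \<phi>\<close> say that \<open>exp (\<phi>(z\<^sup>2)) / z\<close> has non-negative real part on the right half-plane.\<close>

lemma exp_form_monotone:
  assumes \<phi>: "\<phi> holomorphic_on slit" and \<phi>_cnj: "\<And>z. z \<in> slit \<Longrightarrow> \<phi> (cnj z) = cnj (\<phi> z)"
    and \<phi>_Im: "\<And>z. Im z > 0 \<Longrightarrow> 0 \<le> Im (\<phi> z) \<and> Im (\<phi> z) \<le> Arg z"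
  shows "form_monotone {0<..} (\<lambda>t. exp (Re (\<phi> (of_real t))))"
proof -
  have \<phi>_real: "Im (\<phi> (of_real t)) = 0" if "t > 0" for t
    using arg_cong[OF \<phi>_cnj[of "of_real t"], of Im] that by simp
  define H where "H = (\<lambda>z. exp (\<phi> (z\<^sup>2) - Ln z))"
  have sq_slit: "z\<^sup>2 \<in> slit" if "Re z > 0" for z
  proof
    assume "z\<^sup>2 \<in> \<real>\<^sub>\<le>\<^sub>0"
    then have "Re z * Im z = 0" "(Re z)\<^sup>2 - (Im z)\<^sup>2 \<le> 0" 
      by (auto simp: complex_nonpos_Reals_iff power2_eq_square)
    then show False using that by simp
  qed
  have half_slit: "z \<in> slit" if "Re z > 0" for z using that by (auto simp: complex_nonpos_Reals_iff)
  have Hh: "H holomorphic_on {z. 0 < Re z}"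
  proof -
    have "(\<lambda>z. \<phi> (z\<^sup>2)) holomorphic_on {z. 0 < Re z}"
      by (rule holomorphic_on_compose_gen[OF _ \<phi>, of "\<lambda>z. z\<^sup>2", unfolded o_def])
         (use sq_slit in \<open>auto intro!: holomorphic_intros\<close>)
    then show ?thesis unfolding H_def by (intro holomorphic_intros) (use half_slit in auto)
  qed
  have pos_up: "0 \<le> Re (H z)" if z: "Re z > 0" "Im z \<ge> 0" for z
  proof -
    have z0: "z \<noteq> 0" using z by auto
    have b: "\<bar>Arg z\<bar> < pi / 2" using Re_Ln_pos_lt_imp[OF z(1)] z0 by (simp add: Arg_eq_Im_Ln)
    \<comment> \<open>In the open first quadrant Im \<phi>(z^2) lies between 0 and arg z^2 = 2 arg
      z, so after subtracting arg z the absolute value is at most arg z < pi / 2.\<close>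
    have "\<bar>Im (\<phi> (z\<^sup>2) - Ln z)\<bar> \<le> pi / 2"
    proof (cases "Im z = 0")
      case True
      then have zr: "z = of_real (Re z)" by (simp add: complex_eq_iff)
      have "Im (\<phi> (z\<^sup>2)) = 0" using \<phi>_real[of "(Re z)\<^sup>2"] z(1) by (subst zr) simp
      then show ?thesis using b z0 by (simp add: Arg_eq_Im_Ln)
    next
      case False
      then have im: "Im (z\<^sup>2) > 0" using z by (simp add: power2_eq_square)
      have "Arg (z\<^sup>2) = 2 * Arg z"
        using Ln_power2_half_plane[OF z(1)] z0 by (simp add: Arg_eq_Im_Ln)
      with \<phi>_Im[OF im] have "0 \<le> Im (\<phi> (z\<^sup>2))" "Im (\<phi> (z\<^sup>2)) \<le> 2 * Arg z" by simp_all
      moreover have "Im (\<phi> (z\<^sup>2) - Ln z) = Im (\<phi> (z\<^sup>2)) - Arg z" using z0 by (simp add: Arg_eq_Im_Ln)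
      ultimately show ?thesis using b by linarith
    qed
    then have "- (pi / 2) \<le> Im (\<phi> (z\<^sup>2) - Ln z)" "Im (\<phi> (z\<^sup>2) - Ln z) \<le> pi / 2" by linarith+
    then have "0 \<le> cos (Im (\<phi> (z\<^sup>2) - Ln z))" by (rule cos_ge_zero)
    then show ?thesis unfolding H_def Re_exp by simp
  qed
  have "0 \<le> Re (H z)" if z: "Re z > 0" for z
  proof (cases "Im z \<ge> 0")
    case True
    then show ?thesis using pos_up z by blast
  next
    case False
    have "H (cnj z) = cnj (H z)"
      using \<phi>_cnj[OF sq_slit[OF z]] cnj_Ln[of z] half_slit[OF z] by (simp add: H_def exp_cnj)
    moreover have "0 \<le> Re (H (cnj z))" using False z by (intro pos_up) auto
    ultimately show ?thesis by simp
  qed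
  from positive_real_form_monotone[OF Hh this]
  have fm: "form_monotone {0<..} (\<lambda>t. sqrt t * Re (H (of_real (sqrt t))))" by simp
  show ?thesis
  \<comment> \<open>The limit lemma is applied to a constant sequence: it replaces a function by
    another one that agrees with it on the half-line.\<close>
  proof (rule form_monotone_tendsto[OF _ fm])
    fix t :: real assume "t \<in> {0<..}"
    then have t: "t > 0" by simp
    have "H (of_real (sqrt t)) = exp (\<phi> (of_real t)) / of_real (sqrt t)"
    proof -
      have sq: "(complex_of_real (sqrt t))\<^sup>2 = of_real t" using t by (simp flip: of_real_power)
      have nz: "complex_of_real (sqrt t) \<noteq> 0" using t by simp
      show ?thesis unfolding H_def exp_diff exp_Ln[OF nz] sq ..
    qed
    then have "sqrt t * Re (H (of_real (sqrt t))) = Re (exp (\<phi> (of_real t)))"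
      using t by (simp add: Re_divide_of_real)
    also have "\<dots> = exp (Re (\<phi> (of_real t)))" using \<phi>_real[OF t] by (simp add: Re_exp)
    finally show "(\<lambda>j::nat. sqrt t * Re (H (of_real (sqrt t)))) \<longlonglongrightarrow> exp (Re (\<phi> (of_real t)))" by simp
  qed
qed

lemma form_monotone_shift:
  assumes f: "form_monotone I f" and c: "\<And>t. t \<in> J \<Longrightarrow> t + c \<in> I"
  shows "form_monotone J (\<lambda>t. f (t + c))"
proof (rule form_monotoneI)
  fix n U d V e and v :: "complex vec"
  assume de: "form_le J n U d V e" and v: "v \<in> carrier_vec n"
  then have U: "U \<in> carrier_mat n n" and V: "V \<in> carrier_mat n n" and uU: "unitary_mat U" and uV: "unitary_mat V"
    by (auto simp: form_le_def)
  have shift: "complex_of_real (spectral_form n W (\<lambda>k. g k + c) w) = of_real (spectral_form n W g w) + of_real c * (\<Sum>i<n. cnj (w $ i) * w $ i)"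
    if "W \<in> carrier_mat n n" "unitary_mat W" for W g w
  proof -
    have "spectral_form n W (\<lambda>k. g k + c) w = spectral_form n W g w + c * (\<Sum>k<n. (cmod (coord n W w k))\<^sup>2)"
      by (simp add: spectral_form_coord distrib_right sum.distrib sum_distrib_left)
    moreover have "complex_of_real (\<Sum>k<n. (cmod (coord n W w k))\<^sup>2) = (\<Sum>i<n. cnj (w $ i) * w $ i)"
      unfolding unitary_parseval[OF that, symmetric] of_real_sum complex_norm_square by (simp add: mult.commute)
    ultimately show ?thesis by (simp only: of_real_add of_real_mult)
  qed
  have "spectral_form n U (\<lambda>k. d k + c) w \<le> spectral_form n V (\<lambda>k. e k + c) w" if w: "w \<in> carrier_vec n" for w
  proof -
    have "complex_of_real (spectral_form n V (\<lambda>k. e k + c) w - spectral_form n U (\<lambda>k. d k + c) w)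
       = of_real (spectral_form n V e w - spectral_form n U d w)"
      unfolding of_real_diff shift[OF U uU] shift[OF V uV] by simp
    then have "spectral_form n V (\<lambda>k. e k + c) w - spectral_form n U (\<lambda>k. d k + c) w
       = spectral_form n V e w - spectral_form n U d w" unfolding of_real_eq_iff .
    then show ?thesis using de w by (fastforce simp: form_le_def)
  qed
  then have "form_le I n U (\<lambda>k. d k + c) V (\<lambda>k. e k + c)"
    using de c by (simp add: form_le_def)
  from form_monotoneD[OF f this v]
  show "spectral_form n U ((\<lambda>t. f (t + c)) \<circ> d) v \<le> spectral_form n V ((\<lambda>t. f (t + c)) \<circ> e) v"
    by (simp add: o_def)
qed

text \<open>A monotone function bounded below has its infimum as limit at 0. The extension is the
  pointwise limit of the shifts h(t + 1/j), and a shift moves the closed half-line into the open one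
  while preserving the order of matrices.\<close>

lemma operator_monotone_extend_zero:
  assumes h: "form_monotone {0<..} h" and cont: "continuous_on {0<..} h" and pos: "\<And>t. t > 0 \<Longrightarrow> h t \<ge> 0"
  obtains l where "(h \<longlongrightarrow> l) (at_right 0)" "operator_monotone_on {0..} (\<lambda>t. if t = 0 then l else h t)"
proof -
  have mono: "h s \<le> h t" if "0 < s" "s \<le> t" for s t
    using form_monotone_imp_mono[OF h, of s t] that by simp
  define l where "l = Inf (h ` {0<..})"
  have bdd: "bdd_below (h ` {0<..})" using pos by (intro bdd_belowI[of _ 0]) auto
  have l_le: "l \<le> h t" if "t > 0" for t
    unfolding l_def using that by (intro cInf_lower bdd) auto
  have lim: "(h \<longlongrightarrow> l) (at_right 0)"
  proof (rule order_tendstoI)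
    fix a assume "a < l"
    then show "\<forall>\<^sub>F t in at_right 0. a < h t"
      using l_le by (intro eventually_at_rightI[of 0 1]) (auto intro: less_le_trans)
  next
    fix a assume "l < a"
    then obtain t where t: "t > 0" "h t < a"
      unfolding l_def using cInf_lessD[of "h ` {0<..}" a] by auto
    show "\<forall>\<^sub>F s in at_right 0. h s < a"
    proof (rule eventually_at_rightI[of 0 t])
      fix s assume "s \<in> {0<..<t}"
      then show "h s < a" using mono[of s t] t by simp
    qed (use t in simp)
  qed
  define k where "k = (\<lambda>t. if t = 0 then l else h t)"
  have "continuous_on {0..} k"
    unfolding continuous_on_def
  proof
    fix t :: real assume "t \<in> {0..}"
    then consider "t = 0" | "t > 0" by fastforce
    then show "(k \<longlongrightarrow> k t) (at t within {0..})"
    proof cases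
      case 1
      have "(k \<longlongrightarrow> l) (at_right 0)"
        by (rule Lim_transform_eventually[OF lim]) (auto simp: eventually_at_filter k_def)
      then show ?thesis using 1 by (simp add: k_def at_within_Ici_at_right)
    next
      case 2
      have "isCont h t" using cont 2 by (simp add: continuous_on_eq_continuous_at open_greaterThan)
      then have "(h \<longlongrightarrow> h t) (at t)" by (simp add: isCont_def)
      moreover have "\<forall>\<^sub>F s in at t. h s = k s"
        using order_tendstoD(1)[OF tendsto_ident_at 2, of UNIV] by eventually_elim (auto simp: k_def)
      ultimately have "(k \<longlongrightarrow> h t) (at t)" by (rule Lim_transform_eventually)
      then show ?thesis using 2 tendsto_within_subset[OF _ subset_UNIV] by (simp add: k_def)
    qed
  qed
  moreover have "form_monotone {0..} k"
  proof (rule form_monotone_tendsto)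
    show "form_monotone {0..} (\<lambda>t. h (t + inverse (real (Suc j))))" for j
      by (rule form_monotone_shift[OF h]) (auto intro: add_nonneg_pos)
    fix t :: real assume t: "t \<in> {0..}"
    have "(\<lambda>j. k (t + inverse (real (Suc j)))) \<longlonglongrightarrow> k t"
    proof (rule continuous_on_tendsto_compose[OF \<open>continuous_on {0..} k\<close>])
      have "(\<lambda>j. t + inverse (real (Suc j))) \<longlonglongrightarrow> t + 0"
        by (intro tendsto_intros LIMSEQ_inverse_real_of_nat)
      then show "(\<lambda>j. t + inverse (real (Suc j))) \<longlonglongrightarrow> t" by simp
    qed (use t in \<open>auto intro!: always_eventually\<close>)
    moreover have "k (t + inverse (real (Suc j))) = h (t + inverse (real (Suc j)))" for j
    proof -
      have "t + inverse (real (Suc j)) > 0" using t by (intro add_nonneg_pos) auto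
      then show ?thesis by (simp add: k_def del: of_nat_Suc)
    qed
    ultimately show "(\<lambda>j. h (t + inverse (real (Suc j)))) \<longlonglongrightarrow> k t" by simp
  qed
  ultimately have "operator_monotone_on {0..} k" by (simp add: operator_monotone_on_iff_form)
  then show ?thesis using that[OF lim] by (simp add: k_def)
qed

text \<open>On t > 0 the values are given; the point 0 is the only delicate one. If 0 is not in
  \<open>S\<close>, the extension has to agree with \<open>g\<close> there as well, and the premise
  \<open>zero\<close> provides this through uniqueness of the limit.\<close>

lemma exp_extends_operator_monotone:
  assumes \<phi>: "\<phi> holomorphic_on slit" "\<And>z. z \<in> slit \<Longrightarrow> \<phi> (cnj z) = cnj (\<phi> z)"
     "\<And>z. Im z > 0 \<Longrightarrow> 0 \<le> Im (\<phi> z) \<and> Im (\<phi> z) \<le> Arg z"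
    and S: "finite S"
    and eq: "\<And>t. t > 0 \<Longrightarrow> t \<notin> S \<Longrightarrow> exp (Re (\<phi> (of_real t))) = g t"
    and zero: "0 \<notin> S \<Longrightarrow> (g \<longlongrightarrow> g 0) (at_right 0)"
  shows "extends_operator_monotone_on {0..} S g"
proof -
  define h where "h = (\<lambda>t. exp (Re (\<phi> (complex_of_real t))))"
  have h: "form_monotone {0<..} h" unfolding h_def by (rule exp_form_monotone[OF \<phi>])
  have "continuous_on {0<..} h"
    unfolding h_def
    by (intro continuous_intros continuous_on_compose2[OF holomorphic_on_imp_continuous_on[OF \<phi>(1)]])
       (auto intro!: of_real_in_slit simp del: ComplI)
  then obtain l where l: "(h \<longlongrightarrow> l) (at_right 0)" "operator_monotone_on {0..} (\<lambda>t. if t = 0 then l else h t)"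
    by (rule operator_monotone_extend_zero[OF h]) (auto simp: h_def)
  have "(if t = 0 then l else h t) = g t" if t: "t \<in> {0..} - S" for t
  proof (cases "t = 0")
    case True
    then have S0: "0 \<notin> S" using t by simp
    have "\<forall>\<^sub>F s in at_right 0. s \<notin> S"
    proof -
      have "open (- S)" using S by (intro open_Compl finite_imp_closed)
      then have "\<forall>\<^sub>F s in nhds 0. s \<in> - S" using S0 by (intro eventually_nhds_in_open) auto
      then show ?thesis by (auto simp: eventually_at_filter elim: eventually_mono)
    qed
    moreover have "\<forall>\<^sub>F s in at_right (0::real). 0 < s" by (simp add: eventually_at_right_less)
    ultimately have "\<forall>\<^sub>F s in at_right 0. h s = g s"
      by eventually_elim (auto simp: h_def eq)
    from Lim_transform_eventually[OF l(1) this] have "(g \<longlongrightarrow> l) (at_right 0)" .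
    then have "l = g 0" using zero[OF S0] by (intro tendsto_unique[of "at_right (0::real)" g]) auto
    then show ?thesis using True by simp
  next
    case False
    then show ?thesis using t eq by (auto simp: h_def)
  qed
  then show ?thesis
    unfolding extends_operator_monotone_on_def using S l(2) by blast
qed

section \<open>Logarithms of \<open>F\<close>, \<open>u\<close> and \<open>D\<close>\<close>

context pick_function
begin

lemma Ln_u_holomorphic: "a \<ge> 0 \<Longrightarrow> (\<lambda>z. Ln (u a z)) holomorphic_on slit"
  using u_slit by (intro holomorphic_on_Ln' u_holomorphic) auto

lemma Ln_F_holomorphic: "(\<lambda>z. Ln (F z)) holomorphic_on slit"
  using F_slit by (intro holomorphic_on_Ln' holo) auto

lemma Ln_D_holomorphic: "b \<ge> 0 \<Longrightarrow> (\<lambda>z. Ln (D b z)) holomorphic_on slit"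
  using D_slit by (intro holomorphic_on_Ln' D_holomorphic) auto

lemma Ln_u_cnj: "z \<in> slit \<Longrightarrow> a \<ge> 0 \<Longrightarrow> Ln (u a (cnj z)) = cnj (Ln (u a z))"
  using u_slit[of z a] by (subst cnj_Ln) (auto simp: u_cnj)

lemma Ln_F_cnj: "z \<in> slit \<Longrightarrow> Ln (F (cnj z)) = cnj (Ln (F z))"
  using F_slit[of z] by (subst cnj_Ln) (auto simp: F_cnj)

lemma Ln_D_cnj: "z \<in> slit \<Longrightarrow> b \<ge> 0 \<Longrightarrow> Ln (D b (cnj z)) = cnj (Ln (D b z))"
  using D_slit[of z b] by (subst cnj_Ln) (auto simp: D_cnj)

lemma f_quot_pos: "t > 0 \<Longrightarrow> a \<ge> 0 \<Longrightarrow> t \<noteq> a \<Longrightarrow> (f t - f a) / (t - a) > 0"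
  using f_strict_mono[of t a] f_strict_mono[of a t]
  by (cases "t < a") (auto intro: divide_neg_neg divide_pos_pos)

lemma exp_Ln_u:
  assumes "t > 0" "a \<ge> 0" "t \<noteq> a"
  shows "exp (Re (Ln (u a (of_real t)))) = (f t - f a) / (t - a)"
  using assms f_quot_pos[OF assms] by (simp add: u_real Ln_of_real del: of_real_divide of_real_diff)

lemma exp_Ln_F: "t > 0 \<Longrightarrow> exp (Re (Ln (F (of_real t)))) = f t"
  using f_pos[of t] by (simp add: F_real Ln_of_real)

lemma exp_Ln_D:
  assumes "t > 0" "b \<ge> 0" "t \<noteq> b"
  shows "exp (Re (Ln (D b (of_real t)))) = (t * f t - b * f b) / (t - b)"
proof -
  have "D b (of_real t) = of_real (f t + b * ((f t - f b) / (t - b)))"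
    using assms by (simp add: D_def F_real u_real)
  moreover have "f t + b * ((f t - f b) / (t - b)) > 0"
    using f_pos[OF assms(1)] f_quot_pos[OF assms] assms(2) by (intro add_pos_nonneg mult_nonneg_nonneg) auto
  moreover have "f t + b * ((f t - f b) / (t - b)) = (t * f t - b * f b) / (t - b)"
    using assms(3) by (simp add: field_simps)
  ultimately show ?thesis by (simp only: Ln_of_real Re_complex_of_real exp_ln)
qed

lemma Im_Ln_u:
  assumes "Im z > 0" "a \<ge> 0"
  shows "Im (Ln (u a z)) \<le> 0" "Im (Ln (F z)) \<le> Im (Ln (u a z)) + Arg z"
proof -
  have "F z \<noteq> 0" using F_Im_pos[OF assms(1)] by auto
  then show "Im (Ln (u a z)) \<le> 0" "Im (Ln (F z)) \<le> Im (Ln (u a z)) + Arg z"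
    using Arg_u[OF assms] u_upper(4)[OF assms] by (simp_all add: Arg_eq_Im_Ln)
qed

lemma Im_Ln_D:
  assumes "Im z > 0" "b \<ge> 0"
  shows "0 \<le> Im (Ln (D b z))" "Im (Ln (D b z)) \<le> Im (Ln (F z))"
proof -
  have "F z \<noteq> 0" "D b z \<noteq> 0" using F_Im_pos[OF assms(1)] D_upper[OF assms] by auto
  then show "0 \<le> Im (Ln (D b z))" "Im (Ln (D b z)) \<le> Im (Ln (F z))"
    using Arg_D[OF assms] by (simp_all add: Arg_eq_Im_Ln)
qed

lemma f_tendsto_zero: "(f \<longlongrightarrow> f 0) (at_right 0)"
proof -
  have "(f \<longlongrightarrow> f 0) (at 0 within {0..})" using cont unfolding continuous_on_def by simp
  then show ?thesis by (simp add: at_within_Ici_at_right)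
qed

end

lemma pick_function_exists:
  assumes f: "operator_monotone_on {0..} f" and "\<And>t. t \<ge> 0 \<Longrightarrow> f t \<ge> 0" and "\<not> f constant_on {0..}"
  obtains F where "pick_function f F"
proof -
  have "f 0 \<ge> 0" using assms(2) by simp
  then obtain F where "pick_extension f F" by (rule pick_extension_exists[OF f])
  then have "pick_function f F"
    using assms(3) by (simp add: pick_function_def pick_function_axioms_def)
  then show ?thesis by (rule that)
qed


text \<open>A non-negative sine confines Im \<Lambda> to bands of width pi. On the segment from 1 to
  z it starts at 0 and varies continuously, so it cannot cross the forbidden gap between -pi and 0.
  This replaces \<open>Arg_sum_nonneg\<close> when no a priori window is at hand.\<close>

lemma Im_nonneg_of_sin_nonneg:
  assumes \<Lambda>: "\<Lambda> holomorphic_on slit" and one: "Im (\<Lambda> 1) = 0"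
    and sin: "\<And>z. Im z > 0 \<Longrightarrow> 0 \<le> sin (Im (\<Lambda> z))" and z: "Im z > 0"
  shows "0 \<le> Im (\<Lambda> z)"
proof (rule ccontr)
  assume neg: "\<not> 0 \<le> Im (\<Lambda> z)"
  define p where "p = (\<lambda>s::real. (1 - s) *\<^sub>R (1::complex) + s *\<^sub>R z)"
  \<comment> \<open>A value inside the gap that must be attained on the segment if Im \<Lambda>(z)
    is negative.\<close>
  define c where "c = max (Im (\<Lambda> z)) (- (pi / 2))"
  have c: "- pi < c" "c < 0" using neg pi_gt_zero by (auto simp: c_def less_max_iff_disj)
  have p: "p s \<in> slit" if "0 \<le> s" "s \<le> 1" for s
    using starlike_slit_segment[OF Im_pos_in_slit[OF z]] that unfolding p_def in_segment subset_iff by blast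
  have "continuous_on {0..1} (\<lambda>s. Im (\<Lambda> (p s)))"
    by (intro continuous_intros continuous_on_compose2[OF holomorphic_on_imp_continuous_on[OF \<Lambda>]])
       (use p in \<open>auto simp: p_def intro!: continuous_intros\<close>)
  moreover have "Im (\<Lambda> (p 1)) \<le> c" "c \<le> Im (\<Lambda> (p 0))" using c one by (auto simp: p_def c_def)
  ultimately obtain s where s: "0 \<le> s" "s \<le> 1" "Im (\<Lambda> (p s)) = c"
    using IVT2'[of "\<lambda>s. Im (\<Lambda> (p s))" 1 c 0] by auto
  have "s \<noteq> 0" using s c one by (auto simp: p_def)
  then have "Im (p s) > 0" using s z by (simp add: p_def)
  from sin[OF this] have "0 \<le> sin c" unfolding s(3) .
  then show False using sin_nonneg_imp_nonneg[of c] c pi_gt_zero by linarith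
qed

text \<open>The formula for a quotient says nothing about its extension at 0, so the sign there
  comes from continuity.\<close>

lemma continuous_nonneg_at_zero:
  fixes K :: "real \<Rightarrow> real"
  assumes K: "continuous_on {0..} K" and pos: "\<And>t. t > 0 \<Longrightarrow> K t \<ge> 0"
  shows "K 0 \<ge> 0"
proof -
  have "(\<lambda>j. K (inverse (real (Suc j)))) \<longlonglongrightarrow> K 0"
    by (rule continuous_on_tendsto_compose[OF K LIMSEQ_inverse_real_of_nat]) (auto intro!: always_eventually)
  then show ?thesis
    by (rule tendsto_lowerbound) (auto intro!: always_eventually pos)
qed

section \<open>The two quotients\<close>

lemma product_quotient_operator_monotone:
  assumes f: "pick_function f F" and g: "pick_function g G"
    and a: "a \<ge> 0" and b: "b \<ge> 0"
    and ext: "extends_operator_monotone_on {0..} {0} (\<lambda>t. f t * g t / t)"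
  shows "extends_operator_monotone_on {0..} {a, b} (\<lambda>t. (t - a) * (t - b) / ((f t - f a) * (g t - g b)))"
proof -
  interpret f: pick_function f F by (rule f)
  interpret g: pick_function g G by (rule g)
  obtain K where K: "operator_monotone_on {0..} K" and Keq: "\<And>t. t > 0 \<Longrightarrow> K t = f t * g t / t"
    using ext by (auto simp: extends_operator_monotone_on_def)
  have Kpos: "K t > 0" if "t > 0" for t using that f.f_pos g.f_pos Keq by simp
  have "continuous_on {0..} K" using K by (simp only: operator_monotone_on_def)
  then have "K 0 \<ge> 0" using less_imp_le[OF Kpos] by (rule continuous_nonneg_at_zero)
  then obtain KK where "pick_extension K KK" by (rule pick_extension_exists[OF K])
  then interpret K: pick_extension K KK .
  have KK: "KK z = F z * G z / z" if "z \<in> slit" for z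
  proof (rule slit_identity[where F = KK and G = "\<lambda>z. F z * G z / z" and s = 1 and r = 2])
    show "(\<lambda>z. F z * G z / z) holomorphic_on slit"
      by (intro holomorphic_intros f.holo g.holo) auto
  qed (use that K.holo in \<open>auto simp: K.F_real f.F_real g.F_real Keq\<close>)
  define \<phi> where "\<phi> = (\<lambda>z. - Ln (f.u a z) - Ln (g.u b z))"
  \<comment> \<open>The upper bound is (arg z - arg F) + (arg z - arg G), which is at most arg z
    once arg z \<le> arg F + arg G is known.\<close>
  have bound: "0 \<le> Im (\<phi> z) \<and> Im (\<phi> z) \<le> Arg z" if z: "Im z > 0" for z
  proof -
    have F0: "F z \<noteq> 0" "G z \<noteq> 0" "z \<noteq> 0" using f.F_Im_pos[OF z] g.F_Im_pos[OF z] z by auto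
    have Az: "0 < Arg z" "Arg z < pi" using z Arg_lt_pi by blast+
    have AF: "0 < Arg (F z)" "Arg (F z) < pi" using f.F_Im_pos[OF z] Arg_lt_pi by blast+
    have AG: "0 < Arg (G z)" "Arg (G z) < pi" using g.F_Im_pos[OF z] Arg_lt_pi by blast+
    \<comment> \<open>FG / z is the extension of the hypothesised function and has non-negative
      imaginary part. The window holds because all three arguments lie between 0 and pi and arg F
      \<le> arg z.\<close>
    have "0 \<le> Arg (F z) + Arg (G z) - Arg z"
    proof (rule Arg_sum_nonneg)
      have "F z * G z * cnj z = KK z * of_real ((cmod z)\<^sup>2)"
        using F0 unfolding KK[OF Im_pos_in_slit[OF z]] complex_norm_square by simp
      then have "Im (F z * G z * cnj z) = Im (KK z) * (cmod z)\<^sup>2" by (simp del: of_real_power)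
      then show "0 \<le> Im (F z * G z * cnj z)" using K.Im_nonneg[OF z Kpos] by simp
    qed (use F0 Az AF AG f.Arg_F_le[OF z] in auto)
    then have "Arg z \<le> Im (Ln (F z)) + Im (Ln (G z))" using F0 by (simp add: Arg_eq_Im_Ln)
    then show ?thesis
      using f.Im_Ln_u[OF z a] g.Im_Ln_u[OF z b] unfolding \<phi>_def by simp
  qed
  show ?thesis
  proof (rule exp_extends_operator_monotone[of \<phi>])
    show "\<phi> holomorphic_on slit"
      unfolding \<phi>_def by (intro holomorphic_intros f.Ln_u_holomorphic g.Ln_u_holomorphic a b)
    show "\<phi> (cnj z) = cnj (\<phi> z)" if "z \<in> slit" for z
      unfolding \<phi>_def using that a b by (simp add: f.Ln_u_cnj g.Ln_u_cnj)
    fix t :: real assume t: "t > 0" "t \<notin> {a, b}"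
    then have "exp (Re (\<phi> (of_real t))) = 1 / ((f t - f a) / (t - a)) / ((g t - g b) / (t - b))"
      unfolding \<phi>_def using f.exp_Ln_u[of t a] g.exp_Ln_u[of t b] a b
      by (simp add: exp_diff exp_minus inverse_eq_divide del: Re_Ln)
    then show "exp (Re (\<phi> (of_real t))) = (t - a) * (t - b) / ((f t - f a) * (g t - g b))" by simp
  next
    assume "0 \<notin> {a, b}"
    then have "f 0 - f a \<noteq> 0" "g 0 - g b \<noteq> 0"
      using f.f_strict_mono[of 0 a] g.f_strict_mono[of 0 b] a b by auto
    then show "((\<lambda>t. (t - a) * (t - b) / ((f t - f a) * (g t - g b)))
      \<longlongrightarrow> (0 - a) * (0 - b) / ((f 0 - f a) * (g 0 - g b))) (at_right 0)"
      by (intro tendsto_intros f.f_tendsto_zero g.f_tendsto_zero) auto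
  qed (use bound in auto)
qed

lemma quotient_product_operator_monotone:
  fixes gs :: "nat \<Rightarrow> real \<Rightarrow> real" and bs :: "nat \<Rightarrow> real"
  assumes f: "pick_function f F" and I: "finite I"
    and g: "\<And>i. i \<in> I \<Longrightarrow> pick_function (gs i) (G i)"
    and a: "a \<ge> 0" and b: "\<And>i. i \<in> I \<Longrightarrow> bs i \<ge> 0"
    and ext: "extends_operator_monotone_on {0..} {0} (\<lambda>t. f t / (\<Prod>i\<in>I. gs i t))"
  shows "extends_operator_monotone_on {0..} (insert a (bs ` I))
     (\<lambda>t. (t - a) / (f t - f a) * (\<Prod>i\<in>I. gs i t * (t - bs i) / (t * gs i t - bs i * gs i (bs i))))"
proof -
  interpret f: pick_function f F by (rule f)
  note ne = pick_function.axioms(1)[OF g, THEN pick_extension.holo]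
  have gpos: "gs i t > 0" if "i \<in> I" "t > 0" for i t
    using pick_function.f_pos[OF g] that by blast
  have Greal: "G i (of_real t) = of_real (gs i t)" if "i \<in> I" "t > 0" for i t
    using pick_extension.F_real[OF pick_function.axioms(1)[OF g]] that by blast
  obtain K where K: "operator_monotone_on {0..} K" and Keq: "\<And>t. t > 0 \<Longrightarrow> K t = f t / (\<Prod>i\<in>I. gs i t)"
    using ext by (auto simp: extends_operator_monotone_on_def)
  have Kpos: "K t > 0" if "t > 0" for t
    using that f.f_pos gpos Keq by (simp add: prod_pos)
  have "continuous_on {0..} K" using K by (simp only: operator_monotone_on_def)
  then have "K 0 \<ge> 0" using less_imp_le[OF Kpos] by (rule continuous_nonneg_at_zero)
  then obtain KK where "pick_extension K KK" by (rule pick_extension_exists[OF K])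
  then interpret K: pick_extension K KK .
  \<comment> \<open>The logarithm of the extended quotient, built as a sum of principal logarithms
    so that its imaginary part is exactly arg F minus the sum of the arg G_i.\<close>
  define \<Lambda> where "\<Lambda> = (\<lambda>z. Ln (F z) - (\<Sum>i\<in>I. Ln (G i z)))"
  have \<Lambda>h: "\<Lambda> holomorphic_on slit"
    unfolding \<Lambda>_def by (intro holomorphic_intros f.Ln_F_holomorphic pick_function.Ln_F_holomorphic[OF g])
  have KK: "KK z = exp (\<Lambda> z)" if "z \<in> slit" for z
  proof (rule slit_identity[where F = KK and G = "\<lambda>z. exp (\<Lambda> z)" and s = 1 and r = 2])
    show "(\<lambda>z. exp (\<Lambda> z)) holomorphic_on slit" using \<Lambda>h by (intro holomorphic_intros)
    fix t :: real assume "1 < t" "t < 2"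
    then have t: "t > 0" by simp
    have "exp (\<Lambda> (of_real t)) = F (of_real t) / (\<Prod>i\<in>I. G i (of_real t))"
    proof -
      have "F (of_real t) \<noteq> 0" using f.f_pos[OF t] t by (simp add: f.F_real)
      moreover have "G i (of_real t) \<noteq> 0" if "i \<in> I" for i using gpos[OF that t] Greal[OF that t] by simp
      ultimately show ?thesis unfolding \<Lambda>_def by (simp add: exp_diff exp_sum[OF I])
    qed
    then show "KK (of_real t) = exp (\<Lambda> (of_real t))"
      using t by (simp add: K.F_real f.F_real Greal Keq)
  qed (use that K.holo in auto)
  \<comment> \<open>The imaginary part of exp \<Lambda> has the sign of sin (Im \<Lambda>), and
    \<Lambda> is real at 1, so the continuity argument applies.\<close>
  have \<Lambda>pos: "0 \<le> Im (\<Lambda> z)" if "Im z > 0" for z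
  proof (rule Im_nonneg_of_sin_nonneg[OF \<Lambda>h _ _ that])
    have "Im (Ln (F 1)) = 0" using f.F_real[of 1] f.f_pos[of 1] by (simp add: Ln_of_real)
    moreover have "Im (Ln (G i 1)) = 0" if "i \<in> I" for i
      using Greal[OF that, of 1] gpos[OF that, of 1] by (simp add: Ln_of_real)
    ultimately show "Im (\<Lambda> 1) = 0" by (simp add: \<Lambda>_def)
    fix w assume w: "Im w > 0"
    have "0 \<le> Im (exp (\<Lambda> w))" using K.Im_nonneg[OF w Kpos] KK[OF Im_pos_in_slit[OF w]] by simp
    then show "0 \<le> sin (Im (\<Lambda> w))" unfolding Im_exp by (simp add: zero_le_mult_iff)
  qed
  define DD where "DD = (\<lambda>i. pick_function.D (gs i) (G i) (bs i))"
  define \<phi> where "\<phi> = (\<lambda>z. (\<Sum>i\<in>I. Ln (G i z) - Ln (DD i z)) - Ln (f.u a z))"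
  \<comment> \<open>The i-th factor adds between 0 and arg G_i, all factors together at most arg F
    by \<open>\<Lambda>pos\<close>, and - arg u_a adds between 0 and arg z - arg F.\<close>
  have bound: "0 \<le> Im (\<phi> z) \<and> Im (\<phi> z) \<le> Arg z" if z: "Im z > 0" for z
  proof -
    have D: "0 \<le> Im (Ln (DD i z)) \<and> Im (Ln (DD i z)) \<le> Im (Ln (G i z))" if "i \<in> I" for i
      unfolding DD_def using pick_function.Im_Ln_D[OF g[OF that] z b[OF that]] by blast
    have "0 \<le> (\<Sum>i\<in>I. Im (Ln (G i z)) - Im (Ln (DD i z)))" using D by (intro sum_nonneg) auto
    moreover have "(\<Sum>i\<in>I. Im (Ln (G i z)) - Im (Ln (DD i z))) \<le> (\<Sum>i\<in>I. Im (Ln (G i z)))"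
      using D by (intro sum_mono) auto
    moreover have "(\<Sum>i\<in>I. Im (Ln (G i z))) \<le> Im (Ln (F z))"
      using \<Lambda>pos[OF z] by (simp add: \<Lambda>_def)
    moreover have "Im (\<phi> z) = (\<Sum>i\<in>I. Im (Ln (G i z)) - Im (Ln (DD i z))) - Im (Ln (f.u a z))"
      by (simp only: \<phi>_def minus_complex.sel Im_sum)
    ultimately show ?thesis using f.Im_Ln_u[OF z a] by linarith
  qed
  show ?thesis
  proof (rule exp_extends_operator_monotone[of \<phi>])
    show "\<phi> holomorphic_on slit"
      unfolding \<phi>_def DD_def
      by (intro holomorphic_intros f.Ln_u_holomorphic[OF a] pick_function.Ln_F_holomorphic[OF g]
          pick_function.Ln_D_holomorphic[OF g b])
    show "\<phi> (cnj z) = cnj (\<phi> z)" if z: "z \<in> slit" for z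
    proof -
      have "Ln (G i (cnj z)) = cnj (Ln (G i z))" "Ln (DD i (cnj z)) = cnj (Ln (DD i z))" if "i \<in> I" for i
        unfolding DD_def using pick_function.Ln_F_cnj[OF g[OF that] z]
          pick_function.Ln_D_cnj[OF g[OF that] z b[OF that]] by blast+
      then show ?thesis unfolding \<phi>_def using f.Ln_u_cnj[OF z a] by simp
    qed
    fix t :: real assume t: "t > 0" "t \<notin> insert a (bs ` I)"
    have "exp (Re (\<phi> (of_real t))) = (\<Prod>i\<in>I. exp (Re (Ln (G i (of_real t))) - Re (Ln (DD i (of_real t))))) / exp (Re (Ln (f.u a (of_real t))))"
      by (simp only: \<phi>_def minus_complex.sel Re_sum exp_diff[of "sum _ _"] exp_sum[OF I])
    also have "exp (Re (Ln (f.u a (of_real t)))) = (f t - f a) / (t - a)"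
      using t a by (intro f.exp_Ln_u) auto
    also have "(\<Prod>i\<in>I. exp (Re (Ln (G i (of_real t))) - Re (Ln (DD i (of_real t)))))
      = (\<Prod>i\<in>I. gs i t * (t - bs i) / (t * gs i t - bs i * gs i (bs i)))"
    proof (intro prod.cong refl)
      fix i assume i: "i \<in> I"
      have "exp (Re (Ln (G i (of_real t)))) = gs i t"
        by (rule pick_function.exp_Ln_F[OF g[OF i] t(1)])
      moreover have "exp (Re (Ln (DD i (of_real t)))) = (t * gs i t - bs i * gs i (bs i)) / (t - bs i)"
        unfolding DD_def using i t by (intro pick_function.exp_Ln_D[OF g[OF i] t(1) b[OF i]]) auto
      ultimately show "exp (Re (Ln (G i (of_real t))) - Re (Ln (DD i (of_real t))))
         = gs i t * (t - bs i) / (t * gs i t - bs i * gs i (bs i))"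
        by (simp only: exp_diff divide_divide_eq_right)
    qed
    finally show "exp (Re (\<phi> (of_real t))) = (t - a) / (f t - f a) *
        (\<Prod>i\<in>I. gs i t * (t - bs i) / (t * gs i t - bs i * gs i (bs i)))"
      by (simp only: divide_divide_eq_right times_divide_eq_left mult.commute)
  next
    \<comment> \<open>When 0 is not excluded, a and all b_i are positive, so no denominator vanishes
      at 0 and the formula itself is continuous there.\<close>
    assume "0 \<notin> insert a (bs ` I)"
    then have a0: "a > 0" and b0: "\<And>i. i \<in> I \<Longrightarrow> bs i > 0" using a b by (auto simp: order_less_le)
    have "f 0 - f a \<noteq> 0" using f.f_strict_mono[of 0 a] a0 by simp
    moreover have "0 * gs i 0 - bs i * gs i (bs i) \<noteq> 0" if "i \<in> I" for i
      using gpos[OF that b0[OF that]] b0[OF that] by simp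
    ultimately show "((\<lambda>t. (t - a) / (f t - f a) * (\<Prod>i\<in>I. gs i t * (t - bs i) / (t * gs i t - bs i * gs i (bs i))))
      \<longlongrightarrow> (0 - a) / (f 0 - f a) * (\<Prod>i\<in>I. gs i 0 * (0 - bs i) / (0 * gs i 0 - bs i * gs i (bs i)))) (at_right 0)"
      by (intro tendsto_intros f.f_tendsto_zero pick_function.f_tendsto_zero[OF g]) auto
  qed (use bound I in auto)
qed

theorem theorem4:
  fixes n :: nat and a b :: real and bs :: "nat \<Rightarrow> real"
    and f g :: "real \<Rightarrow> real" and gs :: "nat \<Rightarrow> real \<Rightarrow> real"
  assumes "n \<ge> 1"
    and "a \<ge> 0" and "b \<ge> 0" and "\<And>i. i \<in> {1..n} \<Longrightarrow> bs i \<ge> 0"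
    and "operator_monotone_on {0..} f" and "\<And>t. t \<ge> 0 \<Longrightarrow> f t \<ge> 0" and "\<not> f constant_on {0..}"
    and "operator_monotone_on {0..} g" and "\<And>t. t \<ge> 0 \<Longrightarrow> g t \<ge> 0" and "\<not> g constant_on {0..}"
    and "\<And>i. i \<in> {1..n} \<Longrightarrow> operator_monotone_on {0..} (gs i)"
    and "\<And>i t. i \<in> {1..n} \<Longrightarrow> t \<ge> 0 \<Longrightarrow> gs i t \<ge> 0"
    and "\<And>i. i \<in> {1..n} \<Longrightarrow> \<not> gs i constant_on {0..}"
  shows "(extends_operator_monotone_on {0..} {0} (\<lambda>t. f t * g t / t) \<longrightarrow>
           extends_operator_monotone_on {0..} {a, b}
             (\<lambda>t. (t - a) * (t - b) / ((f t - f a) * (g t - g b))))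
       \<and> (extends_operator_monotone_on {0..} {0} (\<lambda>t. f t / (\<Prod>i = 1..n. gs i t)) \<longrightarrow>
           extends_operator_monotone_on {0..} (insert a (bs ` {1..n}))
             (\<lambda>t. (t - a) / (f t - f a) *
                  (\<Prod>i = 1..n. gs i t * (t - bs i) / (t * gs i t - bs i * gs i (bs i)))))"
proof -
  obtain F where F: "pick_function f F"
    using assms(6) by (rule pick_function_exists[OF assms(5) _ assms(7)])
  obtain G where G: "pick_function g G"
    using assms(9) by (rule pick_function_exists[OF assms(8) _ assms(10)])
  have "\<exists>H. pick_function (gs i) H" if i: "i \<in> {1..n}" for i
    using pick_function_exists[OF assms(11)[OF i] assms(12)[OF i] assms(13)[OF i]] by blast
  then obtain Gs where Gs: "\<And>i. i \<in> {1..n} \<Longrightarrow> pick_function (gs i) (Gs i)"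
    by metis
  show ?thesis
  proof (intro conjI impI)
    assume "extends_operator_monotone_on {0..} {0} (\<lambda>t. f t * g t / t)"
    then show "extends_operator_monotone_on {0..} {a, b} (\<lambda>t. (t - a) * (t - b) / ((f t - f a) * (g t - g b)))"
      by (rule product_quotient_operator_monotone[OF F G assms(2,3)])
  next
    assume ext: "extends_operator_monotone_on {0..} {0} (\<lambda>t. f t / (\<Prod>i = 1..n. gs i t))"
    show "extends_operator_monotone_on {0..} (insert a (bs ` {1..n}))
       (\<lambda>t. (t - a) / (f t - f a) * (\<Prod>i = 1..n. gs i t * (t - bs i) / (t * gs i t - bs i * gs i (bs i))))"
      using Gs assms(4) by (intro quotient_product_operator_monotone[OF F _ _ assms(2) _ ext, of Gs]) auto
  qed
qed

end
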